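(* Let $(P_\theta)_{\theta\in\Theta}$, $\Theta\subseteq\mathbb R^p$, be a model with single-observation Fisher information matrix $I_x(\theta)$, and let $\pi$ be a prior on $\Theta$ with Fisher information matrix $J_\pi$, satisfying the regularity conditions stated in the context. Let $\rho>0$ and let $\hat\theta$ be any randomized $\rho$-zCDP estimator with values in $\mathbb R^p$ computed from $n$ i.i.d. samples from $P_\theta$. Then $$ \mathbb E_{\theta\sim\pi}\,\mathbb E_\theta\|\hat\theta-\theta\|_2^2\;\ge\;\frac{p^2}{I+\operatorname{Tr}J_\pi}, \qquad I=\Bigl\{C_\rho\,\rho\,n^2\int_\Theta\|I_x(\theta)\|\,d\pi(\theta)\Bigr\}\wedge\Bigl\{n\int_\Theta\operatorname{Tr}I_x(\theta)\,d\pi(\theta)\Bigr\}, $$ where $C_\rho=(e^{2\rho}-1)/\rho$, $\|\cdot\|$ is the spectral (operator) norm, and $a\wedge b=\min(a,b)$.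
   Context: Privacy. Two datasets of $n$ points of the sample space are adjacent if they differ in one observation. For $\lambda>1$ the R\'enyi divergence of laws $P,Q$ is $D_\lambda(P\|Q)=\frac1{\lambda-1}\log\int(\frac{dP}{dQ})^\lambda dQ$ ($=\infty$ if $P\not\ll Q$). A randomized algorithm $A$ is $\rho$-zCDP if $D_\lambda(A(S)\|A(S'))\le\rho\lambda$ for all adjacent $S,S'$ and all $\lambda\in(1,\infty)$ (divergence over the internal randomness of $A$ only). Regularity conditions. $\Theta\subseteq\mathbb R^p$ is compact with piecewise smooth boundary, and $(P_\theta)_{\theta\in\Theta}$ is a dominated model on a standard Borel sample space with densities $p_\theta$. The model is differentiable in quadratic mean at every interior point of $\Theta$, with a jointly measurable score $s(x;\theta)$ satisfying $\mathbb E_\theta s(X;\theta)=0$, $I_x(\theta)=\mathbb E_\theta[s(X;\theta)s(X;\theta)^\top]$, and $\int_\Theta\|I_x(\theta)\|\,d\pi(\theta)<\infty$. The map $\theta\mapsto p_\theta$ is continuously differentiable as an $L^1$-valued map on a neighborhood of $\Theta$, with derivative $p_\theta s(\cdot;\theta)$. The prior $\pi$ has a continuously differentiable density (also denoted $\pi$), vanishes on the boundary of $\Theta$, and has finite Fisher information matrix $J_\pi=\mathbb E_\pi[\nabla_\theta\log\pi(\theta)\,\nabla_\theta\log\pi(\theta)^\top]$. *)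

theory Defs
  imports "HOL-Probability.Probability"
begin

section \<open>Sample space and privacy\<close>

definition standard_borel :: "'x measure \<Rightarrow> bool" where
  "standard_borel M \<longleftrightarrow>
     (\<exists>X. completely_metrizable_space X \<and> second_countable X \<and> topspace X = space M \<and>
          sets M = sigma_sets (topspace X) {U. openin X U})"

text \<open>A data set of \<open>n\<close> points is an element of \<^term>\<open>space (PiM {..<n} (\<lambda>_. M))\<close>.\<close>

definition adjacent :: "nat \<Rightarrow> (nat \<Rightarrow> 'x) \<Rightarrow> (nat \<Rightarrow> 'x) \<Rightarrow> bool" where
  "adjacent n S S' \<longleftrightarrow> (\<exists>!i. i < n \<and> S i \<noteq> S' i)"

text \<open>
  \<^term>\<open>RN_deriv Q P\<close> is dP/dQ; it is finite Q-almost everywhere for finite measures, so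
  \<^const>\<open>enn2real\<close> loses nothing. An infinite integral gives divergence \<^term>\<open>\<infinity>::ereal\<close>.
\<close>

definition renyi_divergence :: "real \<Rightarrow> 'a measure \<Rightarrow> 'a measure \<Rightarrow> ereal" where
  "renyi_divergence l P Q =
     (let J = (\<integral>\<^sup>+x. ennreal (enn2real (RN_deriv Q P x) powr l) \<partial>Q)
      in if absolutely_continuous Q P \<and> J < \<infinity>
         then ereal (1 / (l - 1) * ln (enn2real J)) else \<infinity>)"

text \<open>A randomized algorithm is a Markov kernel from data sets to outputs.\<close>

definition zCDP ::
  "real \<Rightarrow> nat \<Rightarrow> 'x measure \<Rightarrow> 'y measure \<Rightarrow> ((nat \<Rightarrow> 'x) \<Rightarrow> 'y measure) \<Rightarrow> bool" where
  "zCDP \<rho> n M N A \<longleftrightarrow>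
     A \<in> measurable (PiM {..<n} (\<lambda>_. M)) (prob_algebra N) \<and>
     (\<forall>S\<in>space (PiM {..<n} (\<lambda>_. M)). \<forall>S'\<in>space (PiM {..<n} (\<lambda>_. M)). adjacent n S S' \<longrightarrow>
        (\<forall>l>1. renyi_divergence l (A S) (A S') \<le> ereal (\<rho> * l)))"

section \<open>Regularity\<close>

definition C1_on ::
  "'a::real_normed_vector set \<Rightarrow> ('a \<Rightarrow> 'b::real_normed_vector) \<Rightarrow> ('a \<Rightarrow> 'a \<Rightarrow>\<^sub>L 'b) \<Rightarrow> bool" where
  "C1_on U f f' \<longleftrightarrow> open U \<and> continuous_on U f' \<and>
     (\<forall>x\<in>U. (f has_derivative blinfun_apply (f' x)) (at x))"

text \<open>
  A patch is the image of a closed cube of dimension one less than that of the ambient space,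
  realised as the coordinate face \<open>x $ k = 0\<close> of the unit cube, under a map that is continuously
  differentiable near the face and an injective immersion on the relative interior of the face.
  In dimension one the face, and hence the patch, is a single point.
\<close>

definition smooth_patch :: "(real^'p) set \<Rightarrow> bool" where
  "smooth_patch \<Gamma> \<longleftrightarrow>
     (\<exists>(k::'p) U (f :: real^'p \<Rightarrow> real^'p) f'.
        C1_on U f f' \<and>
        {x \<in> cbox 0 1. x $ k = 0} \<subseteq> U \<and>
        \<Gamma> = f ` {x \<in> cbox 0 1. x $ k = 0} \<and>
        inj_on f {x. x $ k = 0 \<and> (\<forall>i. i \<noteq> k \<longrightarrow> 0 < x $ i \<and> x $ i < 1)} \<and>
        (\<forall>x. x $ k = 0 \<and> (\<forall>i. i \<noteq> k \<longrightarrow> 0 < x $ i \<and> x $ i < 1) \<longrightarrow>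
             inj_on (blinfun_apply (f' x)) {v. v $ k = 0}))"

definition piecewise_smooth_boundary :: "(real^'p) set \<Rightarrow> bool" where
  "piecewise_smooth_boundary \<Theta> \<longleftrightarrow>
     (\<exists>F. finite F \<and> (\<forall>\<Gamma>\<in>F. smooth_patch \<Gamma>) \<and> frontier \<Theta> = \<Union>F)"

text \<open>
  Both differentiability notions below use nonnegative integrals, so that a non-integrable
  remainder counts as infinite rather than as zero.
\<close>

definition dqm_at ::
  "'x measure \<Rightarrow> ('v::euclidean_space \<Rightarrow> 'x \<Rightarrow> real) \<Rightarrow> ('v \<Rightarrow> 'x \<Rightarrow> 'v) \<Rightarrow> 'v \<Rightarrow> bool" where
  "dqm_at \<mu> p s \<theta> \<longleftrightarrow>
     ((\<lambda>h. (\<integral>\<^sup>+x. ennreal ((sqrt (p (\<theta> + h) x) - sqrt (p \<theta> x)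
                          - 1 / 2 * (h \<bullet> s \<theta> x) * sqrt (p \<theta> x))\<^sup>2) \<partial>\<mu>)
           / ennreal ((norm h)\<^sup>2)) \<longlongrightarrow> 0) (at 0)"

text \<open>
  \<open>\<theta> \<mapsto> p \<theta>\<close> is continuously (Frechet) differentiable as a map from \<open>U\<close> to \<open>L\<^sup>1(\<mu>)\<close>, and its
  derivative at \<open>\<theta>\<close> is \<open>h \<mapsto> h \<bullet> d \<theta>\<close>. In finite dimension the operator norm of this derivative is
  equivalent to the \<open>L\<^sup>1\<close> norm of the vector-valued function \<open>d \<theta>\<close>, which is used for continuity.
\<close>

definition L1_C1_on ::
  "'v::euclidean_space set \<Rightarrow> 'x measure \<Rightarrow> ('v \<Rightarrow> 'x \<Rightarrow> real) \<Rightarrow> ('v \<Rightarrow> 'x \<Rightarrow> 'v) \<Rightarrow> bool" where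
  "L1_C1_on U \<mu> p d \<longleftrightarrow> open U \<and>
     (\<forall>\<theta>\<in>U. integrable \<mu> (p \<theta>) \<and> integrable \<mu> (d \<theta>) \<and>
        ((\<lambda>h. (\<integral>\<^sup>+x. ennreal \<bar>p (\<theta> + h) x - p \<theta> x - h \<bullet> d \<theta> x\<bar> \<partial>\<mu>) / ennreal (norm h))
           \<longlongrightarrow> 0) (at 0) \<and>
        ((\<lambda>\<theta>'. \<integral>\<^sup>+x. ennreal (norm (d \<theta>' x - d \<theta> x)) \<partial>\<mu>) \<longlongrightarrow> 0) (at \<theta>))"

section \<open>Fisher information\<close>

definition fisher_info :: "'x measure \<Rightarrow> ('x \<Rightarrow> real^'p) \<Rightarrow> real^'p^'p" where
  "fisher_info P s = (\<chi> i j. \<integral>x. s x $ i * s x $ j \<partial>P)"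

definition spectral_norm :: "real^'p^'p \<Rightarrow> real" where
  "spectral_norm M = onorm (\<lambda>v. M *v v)"

definition gradient :: "('v::real_inner \<Rightarrow> real) \<Rightarrow> 'v \<Rightarrow> 'v" where
  "gradient f x = (THE D. GDERIV f x :> D)"

text \<open>Set to zero where the density \<open>\<pi>\<close> is zero, which is a null set for the prior.\<close>

definition prior_score :: "(real^'p \<Rightarrow> real) \<Rightarrow> real^'p \<Rightarrow> real^'p" where
  "prior_score \<pi> \<theta> = (if 0 < \<pi> \<theta> then gradient (\<lambda>t. ln (\<pi> t)) \<theta> else 0)"

definition prior_fisher_info ::
  "(real^'p) set \<Rightarrow> (real^'p) measure \<Rightarrow> (real^'p \<Rightarrow> real) \<Rightarrow> real^'p^'p" where
  "prior_fisher_info \<Theta> \<nu> \<pi> =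
     (\<chi> i j. LINT \<theta>:\<Theta>|\<nu>. prior_score \<pi> \<theta> $ i * prior_score \<pi> \<theta> $ j)"

section \<open>Model and prior\<close>

text \<open>
  \<open>p \<theta>\<close> and \<open>s \<theta>\<close> are meaningful on a neighbourhood of \<open>\<Theta>\<close>, but \<open>p \<theta>\<close> is required to be a
  probability density only for \<open>\<theta> \<in> \<Theta>\<close>.
\<close>

definition regular_model ::
  "(real^'p) set \<Rightarrow> 'x measure \<Rightarrow> (real^'p \<Rightarrow> 'x measure) \<Rightarrow> (real^'p \<Rightarrow> 'x \<Rightarrow> real) \<Rightarrow>
   (real^'p \<Rightarrow> 'x \<Rightarrow> real^'p) \<Rightarrow> bool" where
  "regular_model \<Theta> \<mu> P p s \<longleftrightarrow>
     standard_borel \<mu> \<and> sigma_finite_measure \<mu> \<and>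
     (\<forall>\<theta>\<in>\<Theta>. prob_space (P \<theta>) \<and> p \<theta> \<in> borel_measurable \<mu> \<and> (\<forall>x\<in>space \<mu>. 0 \<le> p \<theta> x) \<and>
            P \<theta> = density \<mu> (\<lambda>x. ennreal (p \<theta> x))) \<and>
     (\<lambda>(x, \<theta>). s \<theta> x) \<in> borel_measurable (\<mu> \<Otimes>\<^sub>M restrict_space borel \<Theta>) \<and>
     (\<forall>\<theta>\<in>interior \<Theta>. dqm_at \<mu> p s \<theta> \<and>
            integrable (P \<theta>) (s \<theta>) \<and> (\<integral>x. s \<theta> x \<partial>P \<theta>) = 0) \<and>
     (\<exists>U. \<Theta> \<subseteq> U \<and> L1_C1_on U \<mu> p (\<lambda>\<theta> x. p \<theta> x *\<^sub>R s \<theta> x))"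

definition regular_prior ::
  "(real^'p) set \<Rightarrow> (real^'p) measure \<Rightarrow> (real^'p \<Rightarrow> real) \<Rightarrow> bool" where
  "regular_prior \<Theta> \<nu> \<pi> \<longleftrightarrow>
     prob_space \<nu> \<and> \<nu> = density lborel (\<lambda>\<theta>. ennreal (\<pi> \<theta> * indicator \<Theta> \<theta>)) \<and>
     (\<forall>\<theta>\<in>\<Theta>. 0 \<le> \<pi> \<theta>) \<and>
     continuous_on \<Theta> \<pi> \<and> (\<exists>\<pi>'. C1_on (interior \<Theta>) \<pi> \<pi>') \<and>
     (\<forall>\<theta>\<in>frontier \<Theta>. \<pi> \<theta> = 0) \<and>
     (\<forall>i j. set_integrable \<nu> \<Theta> (\<lambda>\<theta>. prior_score \<pi> \<theta> $ i * prior_score \<pi> \<theta> $ j))"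

end

theory Submission
  imports Defs
begin

text \<open>
  The bound is a van Trees (Bayesian Cramer-Rao) inequality in which the Fisher information of the
  released output is controlled in two ways: by the information of the whole sample, and by privacy.

  Replace the output \<open>t\<close> by its projection \<open>\<tau> t\<close> onto a ball containing \<open>\<Theta>\<close>. This does not
  increase the distance to any \<open>\<theta> \<in> \<Theta>\<close>, and it makes all quantities bounded. Let \<open>m(\<theta>)\<close> be the
  mean of \<open>\<tau>\<close> under \<open>\<theta>\<close> and \<open>V(\<theta>)\<close> its spread about \<open>m(\<theta>)\<close>, so that the risk at \<open>\<theta>\<close> is
  \<open>V(\<theta>) + |m(\<theta>) - \<theta>|\<^sup>2\<close>. Since \<open>\<pi>\<close> vanishes on the boundary, the field \<open>\<pi> (m - id)\<close> has
  integral divergence zero (\<open>integration_by_parts_weight\<close>), which reads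

    \<open>p = E\<^sub>\<pi> [ (m(\<theta>) - \<theta>) \<bullet> \<nabla> log \<pi>(\<theta>) + div m(\<theta>) ]\<close>    (\<open>van_trees_identity\<close>).

  By differentiation under the integral, \<open>div m(\<theta>)\<close> is the sum over \<open>i\<close> of the correlations
  \<open>E\<^sub>\<theta> [(\<tau> - m(\<theta>)) \<bullet> s(X\<^sub>i; \<theta>)]\<close> of the output with the score of a single observation. It satisfies
  \<open>(div m)\<^sup>2 \<le> V b\<close> for two functions \<open>b\<close>:

  \<^item> Cauchy-Schwarz and independence give \<open>b = n Tr I\<^sub>x(\<theta>)\<close> (\<open>div_mean_le_sampling\<close>).
  \<^item> Resample the \<open>i\<close>-th observation independently. The correlation with \<open>s(X\<^sub>i; \<theta>)\<close> becomes
    zero because the score is centred, while zCDP at order two says that the law of the output has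
    changed by at most \<open>e\<^bsup>2\<rho>\<^esup> - 1\<close> in chi-square distance. After resampling, the output is
    independent of \<open>X\<^sub>i\<close>, so the second moment of \<open>(\<tau> - m) \<bullet> s(X\<^sub>i; \<theta>)\<close> is at most
    \<open>\<parallel>I\<^sub>x(\<theta>)\<parallel> V\<close>. Adding up the \<open>n\<close> correlations gives
    \<open>b = (e\<^bsup>2\<rho>\<^esup> - 1) n\<^sup>2 \<parallel>I\<^sub>x(\<theta>)\<parallel>\<close> (\<open>div_mean_le_private\<close>).

  A last Cauchy-Schwarz inequality over \<open>\<pi>\<close> pairs the two terms of the identity with the two terms of
  the risk and yields \<open>p\<^sup>2 \<le> risk \<sqdot> (E\<^sub>\<pi> b + Tr J\<^sub>\<pi>)\<close>. Keeping the bias and the spread separate is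
  what makes the two informations add.

  Every Cauchy-Schwarz step is used in the linearised form \<open>xy \<le> (t x\<^sup>2 + y\<^sup>2 / t) / 2\<close> for a
  parameter \<open>t > 0\<close>, which passes through integrals without square roots. One and the same \<open>t\<close> is
  carried to the end and optimised there.
\<close>

section \<open>From zCDP to a chi-square bound\<close>

lemma (in finite_measure) integrable_bounded:
  fixes f :: "'a \<Rightarrow> 'b::{banach, second_countable_topology}"
  assumes "f \<in> borel_measurable M" "\<And>x. x \<in> space M \<Longrightarrow> norm (f x) \<le> B"
  shows "integrable M f"
  using assms by (intro integrable_const_bound[where B=B]) auto

lemma (in prob_space) norm_integral_le_const:
  fixes f :: "'a \<Rightarrow> 'b::{banach, second_countable_topology}"
  assumes "f \<in> borel_measurable M" "\<And>x. x \<in> space M \<Longrightarrow> norm (f x) \<le> B"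
  shows "norm (integral\<^sup>L M f) \<le> B"
proof -
  have "norm (integral\<^sup>L M f) \<le> (\<integral>x. norm (f x) \<partial>M)" by simp
  also have "\<dots> \<le> (\<integral>x. B \<partial>M)"
    using assms by (intro integral_mono integrable_norm integrable_bounded[where B=B and f=f] integrable_const) auto
  finally show ?thesis by (simp add: prob_space)
qed

lemma integrable_dominated:
  fixes f :: "'a \<Rightarrow> 'b::{banach, second_countable_topology}" and g :: "'a \<Rightarrow> 'c::{banach, second_countable_topology}"
  assumes "integrable M g" "f \<in> borel_measurable M" "\<And>x. x \<in> space M \<Longrightarrow> norm (f x) \<le> norm (g x)"
  shows "integrable M f"
  by (rule Bochner_Integration.integrable_bound[OF assms(1,2)]) (rule AE_I2, rule assms(3))

lemma integrable_inner_bounded: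
  fixes G s :: "'a \<Rightarrow> 'v::euclidean_space"
  assumes s: "integrable P s" and G: "G \<in> borel_measurable P" and B: "\<And>x. x \<in> space P \<Longrightarrow> norm (G x) \<le> B"
  shows "integrable P (\<lambda>x. G x \<bullet> s x)"
proof (rule integrable_dominated)
  show "integrable P (\<lambda>x. B * norm (s x))" using s by simp
  show "(\<lambda>x. G x \<bullet> s x) \<in> borel_measurable P" using s G by auto
  show "norm (G x \<bullet> s x) \<le> norm (B * norm (s x))" if "x \<in> space P" for x
    using Cauchy_Schwarz_ineq2[of "G x" "s x"] mult_right_mono[OF B[OF that], of "norm (s x)"] by simp
qed

text \<open>
  With \<open>r = dP/dQ\<close> the left-hand side is the \<open>Q\<close>-integral of \<open>f (r - 1)\<close>, and the bound on the
  divergence of order two is a bound on the integral of \<open>(r - 1)\<^sup>2\<close>.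
\<close>

lemma integral_diff_le_renyi_two:
  fixes f :: "'a \<Rightarrow> real"
  assumes P: "prob_space P" and Q: "prob_space Q" and sets: "sets P = sets Q"
    and D: "renyi_divergence 2 P Q \<le> ereal (\<rho> * 2)"
    and f [measurable]: "f \<in> borel_measurable Q" and b: "\<And>x. x \<in> space Q \<Longrightarrow> \<bar>f x\<bar> \<le> B"
    and u: "u > 0"
  shows "(\<integral>x. f x \<partial>P) - (\<integral>x. f x \<partial>Q) \<le> (u * (\<integral>x. (f x)\<^sup>2 \<partial>Q) + (exp (2 * \<rho>) - 1) / u) / 2"
proof -
  interpret P: prob_space P by fact
  interpret Q: prob_space Q by fact
  define r where "r x = enn2real (RN_deriv Q P x)" for x
  define J where "J = (\<integral>\<^sup>+x. ennreal ((r x)\<^sup>2) \<partial>Q)"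
  have r0: "0 \<le> r x" for x by (simp add: r_def)
  have [measurable]: "r \<in> borel_measurable Q" by (simp add: r_def[abs_def])
  have J: "(\<integral>\<^sup>+x. ennreal (enn2real (RN_deriv Q P x) powr 2) \<partial>Q) = J"
    unfolding J_def r_def by (intro nn_integral_cong) (simp add: powr_numeral)
  have ac: "absolutely_continuous Q P" and Jfin: "J < \<infinity>" and lnJ: "ln (enn2real J) \<le> 2 * \<rho>"
    using D unfolding renyi_divergence_def Let_def J by (auto split: if_splits simp: mult.commute)
  have dens: "density Q (RN_deriv Q P) = P"
    using ac sets by (intro Q.density_RN_deriv) auto
  have P_eq: "P = density Q (\<lambda>x. ennreal (r x))"
  proof -
    have "AE x in Q. RN_deriv Q P x \<noteq> \<infinity>"
      using ac sets P.sigma_finite_measure_axioms by (intro Q.RN_deriv_finite) auto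
    then have "density Q (\<lambda>x. ennreal (r x)) = density Q (RN_deriv Q P)"
      by (intro density_cong) (auto simp: r_def less_top)
    then show ?thesis using dens by simp
  qed
  have int_r2: "integrable Q (\<lambda>x. (r x)\<^sup>2)"
    using Jfin unfolding J_def by (intro integrableI_bounded) auto
  have int_r: "integrable Q r"
    by (rule Q.square_integrable_imp_integrable[OF _ int_r2]) auto
  have r1: "(\<integral>x. r x \<partial>Q) = 1"
  proof -
    have "(\<integral>x. 1 \<partial>P) = (\<integral>x. r x *\<^sub>R (1::real) \<partial>Q)"
      unfolding P_eq using r0 by (intro integral_density) auto
    then show ?thesis by (simp add: P.prob_space)
  qed
  have r2: "(\<integral>x. (r x)\<^sup>2 \<partial>Q) \<le> exp (2 * \<rho>)"
  proof -
    have e: "enn2real J = (\<integral>x. (r x)\<^sup>2 \<partial>Q)"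
      unfolding J_def by (subst integral_eq_nn_integral) auto
    have "0 \<le> (\<integral>x. (r x)\<^sup>2 \<partial>Q)" by simp
    then show ?thesis using lnJ unfolding e
      by (metis exp_ge_zero exp_le_cancel_iff exp_ln le_less order_trans)
  qed
  have fb: "integrable Q f" "integrable Q (\<lambda>x. (f x)\<^sup>2)"
    subgoal using b by (intro Q.integrable_bounded[where B=B]) auto
    subgoal using power_mono[OF b abs_ge_zero, of _ 2]
      by (intro Q.integrable_bounded[where B="B\<^sup>2"]) auto
    done
  have int_rf: "integrable Q (\<lambda>x. r x * f x)"
  proof (rule integrable_dominated)
    show "integrable Q (\<lambda>x. B * r x)" using int_r by simp
    show "norm (r x * f x) \<le> norm (B * r x)" if "x \<in> space Q" for x
      using b[OF that] r0[of x] by (simp add: abs_mult mult.commute[of B] mult_left_mono)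
  qed simp
  have eq: "(\<integral>x. f x \<partial>P) = (\<integral>x. r x * f x \<partial>Q)"
    unfolding P_eq using r0 by (subst integral_density) auto
  have int2: "integrable Q (\<lambda>x. (r x - 1)\<^sup>2)"
    using int_r int_r2 by (simp add: power2_diff)
  have sq: "(\<integral>x. (r x - 1)\<^sup>2 \<partial>Q) \<le> exp (2 * \<rho>) - 1"
    using int_r int_r2 r1 r2 by (simp add: power2_diff Q.prob_space)
  have "(\<integral>x. f x \<partial>P) - (\<integral>x. f x \<partial>Q) = (\<integral>x. f x * (r x - 1) \<partial>Q)"
    unfolding eq using fb int_rf by (simp add: algebra_simps)
  also have "\<dots> \<le> (\<integral>x. (u * (f x)\<^sup>2 + (r x - 1)\<^sup>2 / u) / 2 \<partial>Q)"
  proof (rule integral_mono)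
    show "integrable Q (\<lambda>x. f x * (r x - 1))" using fb int_rf by (simp add: algebra_simps)
    show "integrable Q (\<lambda>x. (u * (f x)\<^sup>2 + (r x - 1)\<^sup>2 / u) / 2)" using fb int2 by simp
    fix x
    have "0 \<le> (u * f x - (r x - 1))\<^sup>2 / u" using u by simp
    then show "f x * (r x - 1) \<le> (u * (f x)\<^sup>2 + (r x - 1)\<^sup>2 / u) / 2"
      using u by (simp add: field_simps power2_eq_square)
  qed
  also have "\<dots> = (u * (\<integral>x. (f x)\<^sup>2 \<partial>Q) + (\<integral>x. (r x - 1)\<^sup>2 \<partial>Q) / u) / 2"
    using fb int2 by simp
  also have "\<dots> \<le> (u * (\<integral>x. (f x)\<^sup>2 \<partial>Q) + (exp (2 * \<rho>) - 1) / u) / 2"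
    using sq u by (simp add: divide_right_mono)
  finally show ?thesis .
qed

section \<open>One private observation\<close>

text \<open>
  The case of a single private observation: \<open>x\<close> is drawn from \<open>P\<close> and the output from \<open>K x\<close>. If the
  output came from \<open>K x'\<close> with \<open>x'\<close> an independent copy of \<open>x\<close>, the left-hand side would vanish, because
  \<open>s\<close> has mean zero. So it equals the effect of replacing \<open>K x\<close> by \<open>K x'\<close>, which the
  chi-square bound controls by the second moment of \<open>g y \<bullet> s x\<close> with \<open>y\<close> drawn independently of
  \<open>x\<close> from the mixture of the \<open>K x'\<close>; there the second moment of \<open>s\<close> factors out.
\<close>

lemma inner_integral_le_renyi_kernel:
  fixes g :: "'y \<Rightarrow> 'v::euclidean_space" and s :: "'x \<Rightarrow> 'v"
  assumes P: "prob_space P" and K: "K \<in> P \<rightarrow>\<^sub>M prob_algebra N"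
    and D: "\<And>x x'. x \<in> space P \<Longrightarrow> x' \<in> space P \<Longrightarrow> x \<noteq> x' \<Longrightarrow> renyi_divergence 2 (K x) (K x') \<le> ereal (\<rho> * 2)"
    and rho: "0 \<le> \<rho>" and u: "0 < u"
    and g [measurable]: "g \<in> borel_measurable N" and b: "\<And>y. y \<in> space N \<Longrightarrow> norm (g y) \<le> B"
    and s: "integrable P s" and s0: "(\<integral>x. s x \<partial>P) = 0"
    and s2: "integrable P (\<lambda>x. (norm (s x))\<^sup>2)" and L: "\<And>v. (\<integral>x. (v \<bullet> s x)\<^sup>2 \<partial>P) \<le> L * (norm v)\<^sup>2"
  shows "(\<integral>x. (\<integral>y. g y \<partial>K x) \<bullet> s x \<partial>P)
    \<le> (u * L * (\<integral>x. (\<integral>y. (norm (g y))\<^sup>2 \<partial>K x) \<partial>P) + (exp (2 * \<rho>) - 1) / u) / 2"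
proof -
  interpret P: prob_space P by fact
  have [measurable]: "s \<in> borel_measurable P" using s by auto
  have Ks [measurable]: "K \<in> P \<rightarrow>\<^sub>M subprob_algebra N" using K by (rule measurable_prob_algebraD)
  \<comment> \<open>the law of an output computed from an observation that is then forgotten\<close>
  define Y where "Y = P \<bind> K"
  have sKx: "sets (K x) = sets N" "space (K x) = space N" and pKx: "prob_space (K x)" if "x \<in> space P" for x
    using measurable_space[OF K that] sets_eq_imp_space_eq by (auto simp: space_prob_algebra)
  interpret Y: prob_space Y
    unfolding Y_def by (intro P.prob_space_bind[where S=N] AE_I2 pKx) auto
  have sY: "sets Y = sets N" "space Y = space N"
  proof -
    show "sets Y = sets N" unfolding Y_def by (rule sets_bind[OF sKx(1) P.not_empty])
    then show "space Y = space N" by (rule sets_eq_imp_space_eq)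
  qed
  have [measurable_cong]: "sets Y = sets N" by (rule sY)
  have bindY: "(\<integral>y. f y \<partial>Y) = (\<integral>x. (\<integral>y. f y \<partial>K x) \<partial>P)"
    if "f \<in> borel_measurable N" "\<And>y. y \<in> space N \<Longrightarrow> \<bar>f y\<bar> \<le> C" for f :: "'y \<Rightarrow> real" and C
    unfolding Y_def using that
    by (intro integral_bind[where B=C and B'=1 and K=N] Ks) 
       (auto simp: P.finite_measure_axioms prob_space.emeasure_space_1[OF pKx])
  define G where "G x = (\<integral>y. g y \<partial>K x)" for x
  have [measurable]: "G \<in> borel_measurable P"
    unfolding G_def by measurable
  have Gb: "norm (G x) \<le> B" if "x \<in> space P" for x
  proof -
    interpret K: prob_space "K x" by (rule pKx[OF that])
    show ?thesis unfolding G_def using b sKx[OF that]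
      by (intro K.norm_integral_le_const) (auto cong: measurable_cong_sets)
  qed
  have intG: "integrable P G" using Gb by (intro P.integrable_bounded) auto
  have Kint: "integrable (K x) g" if "x \<in> space P" for x
  proof -
    interpret K: prob_space "K x" by (rule pKx[OF that])
    show ?thesis using b sKx[OF that]
      by (intro K.integrable_bounded) (auto cong: measurable_cong_sets)
  qed
  have gs_b: "\<bar>g y \<bullet> v\<bar> \<le> B * norm v" if "y \<in> space N" for y v
    using Cauchy_Schwarz_ineq2[of "g y" v] mult_right_mono[OF b[OF that], of "norm v"] by simp
  have gs2_b: "\<bar>(g y \<bullet> v)\<^sup>2\<bar> \<le> (B * norm v)\<^sup>2" if "y \<in> space N" for y v
    using power_mono[OF gs_b[OF that] abs_ge_zero, of v 2] by simp
  have pair: "G x \<bullet> s x - G x' \<bullet> s x \<le> (u * (\<integral>y. (g y \<bullet> s x)\<^sup>2 \<partial>K x') + (exp (2 * \<rho>) - 1) / u) / 2"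
    if x: "x \<in> space P" and x': "x' \<in> space P" for x x'
  proof (cases "x = x'")
    case True
    have "0 \<le> u * (\<integral>y. (g y \<bullet> s x)\<^sup>2 \<partial>K x')" using u by simp
    moreover have "0 \<le> (exp (2 * \<rho>) - 1) / u" using u rho by simp
    ultimately show ?thesis using True by simp
  next
    case False
    have "(\<integral>y. g y \<bullet> s x \<partial>K x) - (\<integral>y. g y \<bullet> s x \<partial>K x')
       \<le> (u * (\<integral>y. (g y \<bullet> s x)\<^sup>2 \<partial>K x') + (exp (2 * \<rho>) - 1) / u) / 2"
      using sKx[OF x] sKx[OF x'] gs_b
      by (intro integral_diff_le_renyi_two[where B="B * norm (s x)"] pKx x x' D False u)
         (auto cong: measurable_cong_sets)
    then show ?thesis by (simp add: G_def Kint x x')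
  qed
  have step: "G x \<bullet> s x - (\<integral>x'. G x' \<partial>P) \<bullet> s x \<le> (u * (\<integral>y. (g y \<bullet> s x)\<^sup>2 \<partial>Y) + (exp (2 * \<rho>) - 1) / u) / 2"
    if x: "x \<in> space P" for x
  proof -
    have m: "(\<lambda>x'. \<integral>y. (g y \<bullet> s x)\<^sup>2 \<partial>K x') \<in> borel_measurable P" by measurable
    have i: "integrable P (\<lambda>x'. \<integral>y. (g y \<bullet> s x)\<^sup>2 \<partial>K x')"
    proof (rule P.integrable_bounded[OF m, where B="(B * norm (s x))\<^sup>2"])
      fix x' assume x': "x' \<in> space P"
      interpret K: prob_space "K x'" by (rule pKx[OF x'])
      show "norm (\<integral>y. (g y \<bullet> s x)\<^sup>2 \<partial>K x') \<le> (B * norm (s x))\<^sup>2"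
        using gs2_b sKx[OF x'] by (intro K.norm_integral_le_const) (auto cong: measurable_cong_sets)
    qed
    have "G x \<bullet> s x - (\<integral>x'. G x' \<partial>P) \<bullet> s x = (\<integral>x'. G x \<bullet> s x - G x' \<bullet> s x \<partial>P)"
      using intG by (simp add: P.prob_space)
    also have "\<dots> \<le> (\<integral>x'. (u * (\<integral>y. (g y \<bullet> s x)\<^sup>2 \<partial>K x') + (exp (2 * \<rho>) - 1) / u) / 2 \<partial>P)"
      using pair[OF x] intG i by (intro integral_mono) auto
    also have "\<dots> = (u * (\<integral>x'. (\<integral>y. (g y \<bullet> s x)\<^sup>2 \<partial>K x') \<partial>P) + (exp (2 * \<rho>) - 1) / u) / 2"
      using i by (simp add: P.prob_space)
    also have "(\<integral>x'. (\<integral>y. (g y \<bullet> s x)\<^sup>2 \<partial>K x') \<partial>P) = (\<integral>y. (g y \<bullet> s x)\<^sup>2 \<partial>Y)"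
      using gs2_b by (intro bindY[symmetric]) auto
    finally show ?thesis .
  qed
  interpret PY: pair_prob_space P Y ..
  have ipair: "integrable (P \<Otimes>\<^sub>M Y) (\<lambda>(x, y). (g y \<bullet> s x)\<^sup>2)"
  proof (rule integrable_dominated)
    show "integrable (P \<Otimes>\<^sub>M Y) (\<lambda>(x, y). B\<^sup>2 * (norm (s x))\<^sup>2)"
    proof -
      have "integrable (distr (P \<Otimes>\<^sub>M Y) P fst) (\<lambda>x. B\<^sup>2 * (norm (s x))\<^sup>2)"
        unfolding Y.distr_pair_fst using s2 by simp
      from integrable_distr[OF measurable_fst this] show ?thesis unfolding case_prod_beta .
    qed
  qed (measurable, use gs2_b in \<open>auto simp: space_pair_measure sY power_mult_distrib\<close>)
  have iGs: "integrable P (\<lambda>x. G x \<bullet> s x)"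
    by (rule integrable_inner_bounded[OF s]) (simp, rule Gb)
  have "(\<integral>x. G x \<bullet> s x \<partial>P) = (\<integral>x. G x \<bullet> s x - (\<integral>x'. G x' \<partial>P) \<bullet> s x \<partial>P)"
    using iGs s s0 by simp
  also have "\<dots> \<le> (\<integral>x. (u * (\<integral>y. (g y \<bullet> s x)\<^sup>2 \<partial>Y) + (exp (2 * \<rho>) - 1) / u) / 2 \<partial>P)"
    using step iGs s PY.integrable_fst[OF ipair] by (intro integral_mono) auto
  also have "\<dots> = (u * (\<integral>x. (\<integral>y. (g y \<bullet> s x)\<^sup>2 \<partial>Y) \<partial>P) + (exp (2 * \<rho>) - 1) / u) / 2"
    using PY.integrable_fst[OF ipair] by (simp add: P.prob_space)
  also have "(\<integral>x. (\<integral>y. (g y \<bullet> s x)\<^sup>2 \<partial>Y) \<partial>P) = (\<integral>y. (\<integral>x. (g y \<bullet> s x)\<^sup>2 \<partial>P) \<partial>Y)"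
    using PY.Fubini_integral[OF ipair] by simp
  also have "\<dots> \<le> (\<integral>y. L * (norm (g y))\<^sup>2 \<partial>Y)"
  proof (rule integral_mono)
    show "integrable Y (\<lambda>y. \<integral>x. (g y \<bullet> s x)\<^sup>2 \<partial>P)" using PY.integrable_snd[OF ipair] by simp
    show "integrable Y (\<lambda>y. L * (norm (g y))\<^sup>2)"
      using power_mono[OF b norm_ge_zero, of _ 2]
      by (intro integrable_mult_right Y.integrable_bounded[where B="B\<^sup>2"]) (auto simp: sY)
  qed (rule L)
  also have "\<dots> = L * (\<integral>y. (norm (g y))\<^sup>2 \<partial>Y)" by simp
  also have "(\<integral>y. (norm (g y))\<^sup>2 \<partial>Y) = (\<integral>x. (\<integral>y. (norm (g y))\<^sup>2 \<partial>K x) \<partial>P)"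
    using power_mono[OF b norm_ge_zero, of _ 2] by (intro bindY) auto
  finally show ?thesis using u by (simp add: G_def mult_ac mult_left_mono divide_right_mono)
qed

lemma integrable_PiM_component:
  fixes f :: "'x \<Rightarrow> 'b::{banach, second_countable_topology}"
  assumes P: "prob_space P" and i: "i \<in> I" and f: "integrable P f"
  shows "integrable (PiM I (\<lambda>_. P)) (\<lambda>S. f (S i))"
    and "(\<integral>S. f (S i) \<partial>PiM I (\<lambda>_. P)) = (\<integral>x. f x \<partial>P)"
proof -
  have d: "distr (PiM I (\<lambda>_. P)) P (\<lambda>S. S i) = P"
    using P i by (rule distr_PiM_component[where M="\<lambda>_. P"])
  have m: "(\<lambda>S. S i) \<in> PiM I (\<lambda>_. P) \<rightarrow>\<^sub>M P" using i by simp
  have "integrable (distr (PiM I (\<lambda>_. P)) P (\<lambda>S. S i)) f" unfolding d by (rule f)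
  from integrable_distr[OF m this] show "integrable (PiM I (\<lambda>_. P)) (\<lambda>S. f (S i))" .
  have "(\<integral>x. f x \<partial>distr (PiM I (\<lambda>_. P)) P (\<lambda>S. S i)) = (\<integral>S. f (S i) \<partial>PiM I (\<lambda>_. P))"
    using f by (intro integral_distr m) auto
  then show "(\<integral>S. f (S i) \<partial>PiM I (\<lambda>_. P)) = (\<integral>x. f x \<partial>P)" unfolding d by simp
qed

lemma zCDP_measurable_iid:
  assumes "zCDP \<rho> n M N A" "sets P = sets M"
  shows "A \<in> PiM {..<n} (\<lambda>_. P) \<rightarrow>\<^sub>M prob_algebra N"
proof -
  have "sets (PiM {..<n} (\<lambda>_. P)) = sets (PiM {..<n} (\<lambda>_. M))"
    using assms by (intro sets_PiM_cong) auto
  from measurable_cong_sets[OF this refl] show ?thesis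
    using assms by (auto simp: zCDP_def)
qed

text \<open>
  Fix all observations except the \<open>i\<close>-th; then the algorithm is a kernel in one observation whose
  outputs are close in divergence, and the previous lemma applies for every value of the others.
\<close>

lemma inner_integral_le_zCDP_coordinate:
  fixes g :: "'y \<Rightarrow> 'v::euclidean_space" and s :: "'x \<Rightarrow> 'v"
  assumes A: "zCDP \<rho> n M N A" and rho: "0 \<le> \<rho>"
    and P: "prob_space P" and sP: "sets P = sets M" and i: "i < n" and u: "0 < u"
    and g [measurable]: "g \<in> borel_measurable N" and b: "\<And>y. y \<in> space N \<Longrightarrow> norm (g y) \<le> B"
    and s: "integrable P s" and s0: "(\<integral>x. s x \<partial>P) = 0"
    and s2: "integrable P (\<lambda>x. (norm (s x))\<^sup>2)" and L: "\<And>v. (\<integral>x. (v \<bullet> s x)\<^sup>2 \<partial>P) \<le> L * (norm v)\<^sup>2"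
  shows "(\<integral>S. (\<integral>y. g y \<partial>A S) \<bullet> s (S i) \<partial>PiM {..<n} (\<lambda>_. P))
    \<le> (u * L * (\<integral>S. (\<integral>y. (norm (g y))\<^sup>2 \<partial>A S) \<partial>PiM {..<n} (\<lambda>_. P)) + (exp (2 * \<rho>) - 1) / u) / 2"
proof -
  define I where "I = {..<n} - {i}"
  have I: "finite I" "i \<notin> I" "insert i I = {..<n}" using i by (auto simp: I_def)
  interpret P: prob_space P by fact
  interpret product_sigma_finite "\<lambda>_::nat. P" ..
  interpret S: prob_space "PiM {..<n} (\<lambda>_. P)" by (rule prob_space_PiM[OF P])
  interpret R: prob_space "PiM I (\<lambda>_. P)" by (rule prob_space_PiM[OF P])
  have Am: "A \<in> PiM {..<n} (\<lambda>_. P) \<rightarrow>\<^sub>M prob_algebra N" by (rule zCDP_measurable_iid[OF A sP])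
  have Am' [measurable]: "A \<in> PiM {..<n} (\<lambda>_. P) \<rightarrow>\<^sub>M subprob_algebra N" by (rule measurable_prob_algebraD[OF Am])
  have sA: "sets (A S) = sets N" "space (A S) = space N" and pA: "prob_space (A S)"
    if "S \<in> space (PiM {..<n} (\<lambda>_. P))" for S
    using measurable_space[OF Am that] sets_eq_imp_space_eq by (auto simp: space_prob_algebra)
  define G where "G S = (\<integral>y. g y \<partial>A S)" for S
  define V where "V S = (\<integral>y. (norm (g y))\<^sup>2 \<partial>A S)" for S
  have [measurable]: "G \<in> borel_measurable (PiM {..<n} (\<lambda>_. P))" "V \<in> borel_measurable (PiM {..<n} (\<lambda>_. P))"
    unfolding G_def V_def by measurable
  have Gb: "norm (G S) \<le> B" and Vb: "norm (V S) \<le> B\<^sup>2" if "S \<in> space (PiM {..<n} (\<lambda>_. P))" for S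
  proof -
    interpret K: prob_space "A S" by (rule pA[OF that])
    show "norm (G S) \<le> B" unfolding G_def using b sA[OF that]
      by (intro K.norm_integral_le_const) (auto cong: measurable_cong_sets)
    show "norm (V S) \<le> B\<^sup>2" unfolding V_def using power_mono[OF b norm_ge_zero, of _ 2] sA[OF that]
      by (intro K.norm_integral_le_const) (auto cong: measurable_cong_sets)
  qed
  have iV: "integrable (PiM (insert i I) (\<lambda>_. P)) V"
    unfolding I using Vb by (intro S.integrable_bounded) auto
  have iG: "integrable (PiM (insert i I) (\<lambda>_. P)) (\<lambda>S. G S \<bullet> s (S i))"
    unfolding I using i by (intro integrable_inner_bounded[where B=B] integrable_PiM_component P s Gb) auto
  have fold: "(\<integral>S. f S \<partial>PiM {..<n} (\<lambda>_. P)) = (\<integral>R. (\<integral>x. f (R(i := x)) \<partial>P) \<partial>PiM I (\<lambda>_. P))"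
    and foldi: "integrable (PiM I (\<lambda>_. P)) (\<lambda>R. \<integral>x. f (R(i := x)) \<partial>P)"
    if "integrable (PiM (insert i I) (\<lambda>_. P)) f" for f :: "_ \<Rightarrow> real"
  proof -
    show "(\<integral>S. f S \<partial>PiM {..<n} (\<lambda>_. P)) = (\<integral>R. (\<integral>x. f (R(i := x)) \<partial>P) \<partial>PiM I (\<lambda>_. P))"
      using product_integral_insert[OF I(1,2) that] unfolding I(3) .
    interpret PR: pair_prob_space P "PiM I (\<lambda>_. P)" ..
    have d: "distr (P \<Otimes>\<^sub>M PiM I (\<lambda>_. P)) (PiM (insert i I) (\<lambda>_. P)) (\<lambda>(x, R). R(i := x)) = PiM (insert i I) (\<lambda>_. P)"
      by (rule distr_pair_PiM_eq_PiM[of I "\<lambda>_. P" i]) (rule P)+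
    have "integrable (P \<Otimes>\<^sub>M PiM I (\<lambda>_. P)) (\<lambda>z. f ((\<lambda>(x, R). R(i := x)) z))"
      by (rule integrable_distr[where M'="PiM (insert i I) (\<lambda>_. P)"]) (simp_all only: d that, measurable)
    from PR.integrable_snd[where f="\<lambda>x R. f (R(i := x))"] this
    show "integrable (PiM I (\<lambda>_. P)) (\<lambda>R. \<integral>x. f (R(i := x)) \<partial>P)"
      by (simp add: case_prod_beta')
  qed
  have "(\<integral>S. G S \<bullet> s (S i) \<partial>PiM {..<n} (\<lambda>_. P)) = (\<integral>R. (\<integral>x. G (R(i := x)) \<bullet> s ((R(i := x)) i) \<partial>P) \<partial>PiM I (\<lambda>_. P))"
    by (rule fold[OF iG])
  also have "\<dots> \<le> (\<integral>R. (u * L * (\<integral>x. V (R(i := x)) \<partial>P) + (exp (2 * \<rho>) - 1) / u) / 2 \<partial>PiM I (\<lambda>_. P))"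
  proof (rule integral_mono)
    fix R assume R: "R \<in> space (PiM I (\<lambda>_. P))"
    have upd: "(\<lambda>x. R(i := x)) \<in> P \<rightarrow>\<^sub>M PiM {..<n} (\<lambda>_. P)"
      using measurable_component_update[OF R I(2)] unfolding I(3) .
    have K: "(\<lambda>x. A (R(i := x))) \<in> P \<rightarrow>\<^sub>M prob_algebra N" using measurable_compose[OF upd Am] .
    have D: "renyi_divergence 2 (A (R(i := x))) (A (R(i := x'))) \<le> ereal (\<rho> * 2)"
      if "x \<in> space P" "x' \<in> space P" "x \<noteq> x'" for x x'
    proof -
      have sp: "space (PiM {..<n} (\<lambda>_. P)) = space (PiM {..<n} (\<lambda>_. M))"
        using sP by (intro sets_eq_imp_space_eq sets_PiM_cong) auto
      have "adjacent n (R(i := x)) (R(i := x'))"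
        using i that unfolding adjacent_def by auto
      then show ?thesis
        using A measurable_space[OF upd that(1)] measurable_space[OF upd that(2)]
        unfolding zCDP_def sp by fastforce
    qed
    show "(\<integral>x. G (R(i := x)) \<bullet> s ((R(i := x)) i) \<partial>P) \<le> (u * L * (\<integral>x. V (R(i := x)) \<partial>P) + (exp (2 * \<rho>) - 1) / u) / 2"
      using inner_integral_le_renyi_kernel[OF P K D rho u g b s s0 s2 L] unfolding G_def V_def by simp
  qed (use foldi[OF iG] foldi[OF iV] in auto)
  also have "\<dots> = (u * L * (\<integral>R. (\<integral>x. V (R(i := x)) \<partial>P) \<partial>PiM I (\<lambda>_. P)) + (exp (2 * \<rho>) - 1) / u) / 2"
    using foldi[OF iV] by (simp add: R.prob_space)
  also have "(\<integral>R. (\<integral>x. V (R(i := x)) \<partial>P) \<partial>PiM I (\<lambda>_. P)) = (\<integral>S. V S \<partial>PiM {..<n} (\<lambda>_. P))"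
    by (rule fold[OF iV, symmetric])
  finally show ?thesis unfolding G_def V_def .
qed

section \<open>Differentiability in total variation and scores of product measures\<close>

text \<open>
  Independent centred variables are orthogonal, so only the diagonal of the double sum survives.
\<close>

lemma
  fixes c :: "'x \<Rightarrow> real"
  assumes P: "prob_space P" and I: "finite I"
    and c: "integrable P c" and c2: "integrable P (\<lambda>x. (c x)\<^sup>2)" and c0: "(\<integral>x. c x \<partial>P) = 0"
  shows integrable_iid_sum_sq: "integrable (PiM I (\<lambda>_. P)) (\<lambda>S. (\<Sum>i\<in>I. c (S i))\<^sup>2)"
    and integral_iid_sum_sq: "(\<integral>S. (\<Sum>i\<in>I. c (S i))\<^sup>2 \<partial>PiM I (\<lambda>_. P)) = real (card I) * (\<integral>x. (c x)\<^sup>2 \<partial>P)"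
proof -
  interpret P: prob_space P by fact
  interpret product_sigma_finite "\<lambda>_. P" ..
  have expand: "(\<Sum>i\<in>I. c (S i))\<^sup>2 = (\<Sum>i\<in>I. \<Sum>j\<in>I. c (S i) * c (S j))" for S
    by (simp add: power2_eq_square sum_product)
  have diag: "integrable (PiM I (\<lambda>_. P)) (\<lambda>S. c (S i) * c (S i))"
    "(\<integral>S. c (S i) * c (S i) \<partial>PiM I (\<lambda>_. P)) = (\<integral>x. (c x)\<^sup>2 \<partial>P)" if "i \<in> I" for i
    using integrable_PiM_component[OF P that c2] by (simp_all add: power2_eq_square)
  have off: "integrable (PiM I (\<lambda>_. P)) (\<lambda>S. c (S i) * c (S j)) \<and>
    (\<integral>S. c (S i) * c (S j) \<partial>PiM I (\<lambda>_. P)) = 0" if ij: "i \<in> I" "j \<in> I" "i \<noteq> j" for i j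
  proof -
    \<comment> \<open>written as a product over all coordinates, to use independence of the coordinates\<close>
    define f where "f k = (if k = i \<or> k = j then c else (\<lambda>_. 1))" for k
    have f: "integrable P (f k)" for k using c by (simp add: f_def)
    have "(\<Prod>k\<in>I. f k (S k)) = c (S i) * c (S j)" for S
    proof -
      have "(\<Prod>k\<in>I. f k (S k)) = f i (S i) * (\<Prod>k\<in>I - {i}. f k (S k))"
        using I ij by (simp add: prod.remove)
      also have "(\<Prod>k\<in>I - {i}. f k (S k)) = f j (S j) * (\<Prod>k\<in>I - {i} - {j}. f k (S k))"
        using I ij by (intro prod.remove) auto
      also have "(\<Prod>k\<in>I - {i} - {j}. f k (S k)) = 1"
        by (intro prod.neutral) (auto simp: f_def)
      finally show ?thesis by (simp add: f_def)
    qed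
    moreover have "(\<Prod>k\<in>I. \<integral>x. f k x \<partial>P) = 0"
      using I ij c0 by (intro prod_zero) (auto simp: f_def)
    ultimately show ?thesis
      using product_integrable_prod[of I f, OF I f] product_integral_prod[of I f, OF I f] by simp
  qed
  have all: "integrable (PiM I (\<lambda>_. P)) (\<lambda>S. c (S i) * c (S j))" if "i \<in> I" "j \<in> I" for i j
    using diag off that by (cases "i = j") auto
  show "integrable (PiM I (\<lambda>_. P)) (\<lambda>S. (\<Sum>i\<in>I. c (S i))\<^sup>2)"
    unfolding expand using all by (intro Bochner_Integration.integrable_sum) auto
  have "(\<integral>S. (\<Sum>i\<in>I. c (S i))\<^sup>2 \<partial>PiM I (\<lambda>_. P))
      = (\<Sum>i\<in>I. \<Sum>j\<in>I. \<integral>S. c (S i) * c (S j) \<partial>PiM I (\<lambda>_. P))"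
    unfolding expand using all
    by (subst Bochner_Integration.integral_sum, intro Bochner_Integration.integrable_sum, simp)
       (intro sum.cong refl Bochner_Integration.integral_sum, simp)
  also have "\<dots> = (\<Sum>i\<in>I. \<Sum>j\<in>I. if j = i then \<integral>x. (c x)\<^sup>2 \<partial>P else 0)"
    using diag off by (intro sum.cong) auto
  also have "\<dots> = real (card I) * (\<integral>x. (c x)\<^sup>2 \<partial>P)" using I by simp
  finally show "(\<integral>S. (\<Sum>i\<in>I. c (S i))\<^sup>2 \<partial>PiM I (\<lambda>_. P)) = real (card I) * (\<integral>x. (c x)\<^sup>2 \<partial>P)" .
qed

abbreviation score_remainder ::
  "('v::euclidean_space \<Rightarrow> 'x measure) \<Rightarrow> 'v \<Rightarrow> ('x \<Rightarrow> 'v) \<Rightarrow> ('x \<Rightarrow> real) \<Rightarrow> 'v \<Rightarrow> real" where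
  "score_remainder Q a s f h \<equiv>
     (\<integral>x. f x \<partial>Q (a + h)) - (\<integral>x. f x \<partial>Q a) - (\<integral>x. f x * (h \<bullet> s x) \<partial>Q a)"

definition tv_error_le ::
  "'x measure \<Rightarrow> ('v::euclidean_space \<Rightarrow> 'x measure) \<Rightarrow> 'v \<Rightarrow> ('x \<Rightarrow> 'v) \<Rightarrow> real \<Rightarrow> 'v \<Rightarrow> bool" where
  "tv_error_le M Q a s \<epsilon> h \<longleftrightarrow> prob_space (Q (a + h)) \<and> sets (Q (a + h)) = sets M \<and>
     (\<forall>f\<in>borel_measurable M. (\<forall>x\<in>space M. \<bar>f x\<bar> \<le> 1) \<longrightarrow> \<bar>score_remainder Q a s f h\<bar> \<le> \<epsilon> * norm h)"

text \<open>
  Differentiability of \<open>a \<mapsto> Q a\<close> in total variation with derivative \<open>s Q a\<close>, tested against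
  bounded functions. The remainder is uniform over all \<open>f\<close> bounded by one: this is what lets the notion
  pass to product measures, since a section of a bounded function on a product is one of the admitted
  test functions. In this form it mentions neither densities nor a dominating measure of the product.
\<close>

definition tv_differentiable ::
  "'x measure \<Rightarrow> ('v::euclidean_space \<Rightarrow> 'x measure) \<Rightarrow> 'v \<Rightarrow> ('x \<Rightarrow> 'v) \<Rightarrow> bool" where
  "tv_differentiable M Q a s \<longleftrightarrow>
     integrable (Q a) s \<and> (\<forall>\<epsilon>>0. \<forall>\<^sub>F h in nhds 0. tv_error_le M Q a s \<epsilon> h)"

lemma tv_error_leI:
  assumes "prob_space (Q (a + h))" "sets (Q (a + h)) = sets M"
    and "\<And>f. f \<in> borel_measurable M \<Longrightarrow> (\<And>x. x \<in> space M \<Longrightarrow> \<bar>f x\<bar> \<le> 1) \<Longrightarrow>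
      \<bar>score_remainder Q a s f h\<bar> \<le> \<epsilon> * norm h"
  shows "tv_error_le M Q a s \<epsilon> h"
  unfolding tv_error_le_def by (intro conjI ballI impI assms) (assumption, erule (1) bspec)

lemma tv_error_leD:
  assumes "tv_error_le M Q a s \<epsilon> h"
  shows "prob_space (Q (a + h))" "sets (Q (a + h)) = sets M"
    and "f \<in> borel_measurable M \<Longrightarrow> (\<And>x. x \<in> space M \<Longrightarrow> \<bar>f x\<bar> \<le> 1) \<Longrightarrow>
      \<bar>score_remainder Q a s f h\<bar> \<le> \<epsilon> * norm h"
  using assms unfolding tv_error_le_def by simp_all

lemma tv_differentiableD:
  assumes "tv_differentiable M Q a s"
  shows "integrable (Q a) s" "prob_space (Q a)" "sets (Q a) = sets M" "space (Q a) = space M"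
    and "0 < \<epsilon> \<Longrightarrow> \<forall>\<^sub>F h in nhds 0. tv_error_le M Q a s \<epsilon> h"
proof -
  show "integrable (Q a) s" and e: "0 < \<epsilon> \<Longrightarrow> \<forall>\<^sub>F h in nhds 0. tv_error_le M Q a s \<epsilon> h" for \<epsilon>
    using assms by (simp_all add: tv_differentiable_def)
  from eventually_nhds_x_imp_x[OF e[OF zero_less_one]] have "tv_error_le M Q a s 1 0" .
  from tv_error_leD(1,2)[OF this] show "prob_space (Q a)" "sets (Q a) = sets M" by simp_all
  then show "space (Q a) = space M" by (intro sets_eq_imp_space_eq)
qed

lemma abs_integral_mult_score_le:
  fixes s :: "'x \<Rightarrow> 'v::euclidean_space"
  assumes s: "integrable P s" and f: "f \<in> borel_measurable P" and b: "\<And>x. x \<in> space P \<Longrightarrow> \<bar>f x\<bar> \<le> B"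
  shows "integrable P (\<lambda>x. f x * (h \<bullet> s x))"
    and "\<bar>\<integral>x. f x * (h \<bullet> s x) \<partial>P\<bar> \<le> B * norm h * (\<integral>x. norm (s x) \<partial>P)"
proof -
  have le: "\<bar>f x * (h \<bullet> s x)\<bar> \<le> B * norm h * norm (s x)" if "x \<in> space P" for x
    using mult_mono[OF b[OF that] Cauchy_Schwarz_ineq2[of h "s x"]] b[OF that]
    by (simp add: abs_mult mult.assoc)
  have i: "integrable P (\<lambda>x. B * norm h * norm (s x))" using s by simp
  show fi: "integrable P (\<lambda>x. f x * (h \<bullet> s x))"
  proof (rule integrable_dominated[OF i])
    show "norm (f x * (h \<bullet> s x)) \<le> norm (B * norm h * norm (s x))" if "x \<in> space P" for x
      using le[OF that] by simp
  qed (use f s in auto)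
  have "\<bar>\<integral>x. f x * (h \<bullet> s x) \<partial>P\<bar> \<le> (\<integral>x. \<bar>f x * (h \<bullet> s x)\<bar> \<partial>P)" by simp
  also have "\<dots> \<le> (\<integral>x. B * norm h * norm (s x) \<partial>P)"
    using fi i le by (intro integral_mono) auto
  finally show "\<bar>\<integral>x. f x * (h \<bullet> s x) \<partial>P\<bar> \<le> B * norm h * (\<integral>x. norm (s x) \<partial>P)" by simp
qed

text \<open>
  The product rule, where scores add. With \<open>F x\<close> and \<open>F0 x\<close> the integrals of \<open>f (x, \<cdot>)\<close> under the
  perturbed and the original second factor, the remainder splits into the remainder of the first factor
  tested on \<open>F\<close>, the average remainder of the second factor, and a mixed term of second order
  in which \<open>F - F0\<close> meets the first score.
\<close>

lemma tv_differentiable_pair: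
  fixes s1 :: "'x \<Rightarrow> 'v::euclidean_space" and s2 :: "'y \<Rightarrow> 'v"
  assumes T1: "tv_differentiable M1 Q1 a s1" and T2: "tv_differentiable M2 Q2 a s2"
  shows "tv_differentiable (M1 \<Otimes>\<^sub>M M2) (\<lambda>a. Q1 a \<Otimes>\<^sub>M Q2 a) a (\<lambda>(x, y). s1 x + s2 y)"
  unfolding tv_differentiable_def
proof (intro conjI allI impI)
  note D1 = tv_differentiableD[OF T1] and D2 = tv_differentiableD[OF T2]
  interpret Q1: prob_space "Q1 a" by (rule D1)
  interpret Q2: prob_space "Q2 a" by (rule D2)
  interpret Q12: pair_prob_space "Q1 a" "Q2 a" ..
  have i1: "integrable (Q1 a \<Otimes>\<^sub>M Q2 a) (\<lambda>z. s1 (fst z))"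
    using D1(1) by (intro integrable_distr[OF measurable_fst]) (simp add: Q2.distr_pair_fst)
  have i2: "integrable (Q1 a \<Otimes>\<^sub>M Q2 a) (\<lambda>z. s2 (snd z))"
  proof -
    have "integrable (Q2 a \<Otimes>\<^sub>M Q1 a) (\<lambda>z. s2 (fst z))"
      using D2(1) by (intro integrable_distr[OF measurable_fst]) (simp add: Q1.distr_pair_fst)
    then show ?thesis
      using Q12.integrable_product_swap_iff[of "\<lambda>z. s2 (snd z)"] by (simp add: case_prod_beta')
  qed
  show "integrable (Q1 a \<Otimes>\<^sub>M Q2 a) (\<lambda>(x, y). s1 x + s2 y)"
    using i1 i2 by (simp add: case_prod_beta')
  fix \<epsilon> :: real assume \<epsilon>: "0 < \<epsilon>"
  define E1 where "E1 = (\<integral>x. norm (s1 x) \<partial>Q1 a)"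
  define E2 where "E2 = (\<integral>x. norm (s2 x) \<partial>Q2 a)"
  have E: "0 \<le> E1" "0 \<le> E2" by (auto simp: E1_def E2_def)
  define \<eta> where "\<eta> = \<epsilon> / (3 * ((\<epsilon>/3 + E2) * E1 + 1))"
  have den: "0 < (\<epsilon>/3 + E2) * E1 + 1" using \<epsilon> E by (simp add: add_nonneg_pos)
  \<comment> \<open>a radius at which the mixed second-order term costs at most a third of the error\<close>
  have \<eta>: "0 < \<eta>" using \<epsilon> den by (simp add: \<eta>_def)
  have "\<forall>\<^sub>F h in nhds (0::'v). norm h < \<eta>"
    using \<eta> unfolding eventually_nhds_metric by (auto simp: dist_norm)
  moreover have "\<forall>\<^sub>F h in nhds 0. tv_error_le M1 Q1 a s1 (\<epsilon>/3) h" "\<forall>\<^sub>F h in nhds 0. tv_error_le M2 Q2 a s2 (\<epsilon>/3) h"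
    using \<epsilon> by (auto intro: tv_differentiableD(5) T1 T2)
  ultimately show "\<forall>\<^sub>F h in nhds 0. tv_error_le (M1 \<Otimes>\<^sub>M M2) (\<lambda>a. Q1 a \<Otimes>\<^sub>M Q2 a) a (\<lambda>(x, y). s1 x + s2 y) \<epsilon> h"
  proof eventually_elim
    case (elim h)
    note h = elim(1) and e1 = elim(2) and e2 = elim(3)
    note s1 = tv_error_leD(2)[OF e1] and s2 = tv_error_leD(2)[OF e2]
    note sp1 = sets_eq_imp_space_eq[OF s1] and sp2 = sets_eq_imp_space_eq[OF s2]
    interpret R1: prob_space "Q1 (a + h)" by (rule tv_error_leD[OF e1])
    interpret R2: prob_space "Q2 (a + h)" by (rule tv_error_leD[OF e2])
    interpret R12: pair_prob_space "Q1 (a + h)" "Q2 (a + h)" ..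
    have sp: "sets (Q1 (a + h) \<Otimes>\<^sub>M Q2 (a + h)) = sets (M1 \<Otimes>\<^sub>M M2)"
      using s1 s2 by (rule sets_pair_measure_cong)
    have sq: "sets (Q1 a \<Otimes>\<^sub>M Q2 a) = sets (M1 \<Otimes>\<^sub>M M2)"
      using D1 D2 by (intro sets_pair_measure_cong) auto
    note [measurable_cong] = s1 s2 D1(3) D2(3)
    show ?case
    proof (rule tv_error_leI)
      show "prob_space (Q1 (a + h) \<Otimes>\<^sub>M Q2 (a + h))" by (rule R12.P.prob_space_axioms)
      show "sets (Q1 (a + h) \<Otimes>\<^sub>M Q2 (a + h)) = sets (M1 \<Otimes>\<^sub>M M2)" by (rule sp)
      fix f :: "'x \<times> 'y \<Rightarrow> real" assume f[measurable]: "f \<in> borel_measurable (M1 \<Otimes>\<^sub>M M2)"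
        and fb: "\<And>x. x \<in> space (M1 \<Otimes>\<^sub>M M2) \<Longrightarrow> \<bar>f x\<bar> \<le> 1"
      have fb': "\<bar>f (x, y)\<bar> \<le> 1" if "x \<in> space M1" "y \<in> space M2" for x y
        using fb that by (auto simp: space_pair_measure)
      have fR: "integrable (Q1 (a + h) \<Otimes>\<^sub>M Q2 (a + h)) f"
        using fb sets_eq_imp_space_eq[OF sp] by (intro R12.P.integrable_bounded[where B=1]) auto
      have fQ: "integrable (Q1 a \<Otimes>\<^sub>M Q2 a) f"
        using fb sets_eq_imp_space_eq[OF sq] by (intro Q12.P.integrable_bounded[where B=1]) auto
      define F where "F x = (\<integral>y. f (x, y) \<partial>Q2 (a + h))" for x
      define F0 where "F0 x = (\<integral>y. f (x, y) \<partial>Q2 a)" for x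
      define F1 where "F1 x = (\<integral>y. f (x, y) * (h \<bullet> s2 y) \<partial>Q2 a)" for x
      have Fm [measurable]: "F \<in> borel_measurable M1" unfolding F_def
        by (rule R2.borel_measurable_lebesgue_integral) measurable
      have F0m [measurable]: "F0 \<in> borel_measurable M1" unfolding F0_def
        by (rule Q2.borel_measurable_lebesgue_integral) measurable
      have Fb: "\<bar>F x\<bar> \<le> 1" if "x \<in> space M1" for x
        using R2.norm_integral_le_const[of "\<lambda>y. f (x, y)" 1] fb' that sp2 unfolding F_def by auto
      have F0b: "\<bar>F0 x\<bar> \<le> 1" if "x \<in> space M1" for x
        using Q2.norm_integral_le_const[of "\<lambda>y. f (x, y)" 1] fb' that D2(4) unfolding F0_def by auto
      have m2: "(\<lambda>y. f (x, y)) \<in> borel_measurable M2" if "x \<in> space M1" for x using that by measurable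
      have F1b: "\<bar>F1 x\<bar> \<le> norm h * E2" if "x \<in> space M1" for x
        using abs_integral_mult_score_le(2)[OF D2(1), of "\<lambda>y. f (x, y)" 1 h] fb' that D2(4) m2[OF that]
        unfolding F1_def E2_def by (auto cong: measurable_cong_sets)
      have rem2: "\<bar>F x - F0 x - F1 x\<bar> \<le> \<epsilon>/3 * norm h" if "x \<in> space M1" for x
        using tv_error_leD(3)[OF e2 m2[OF that]] fb' that unfolding F_def F0_def F1_def by auto
      have rem1: "\<bar>(\<integral>x. F x \<partial>Q1 (a + h)) - (\<integral>x. F x \<partial>Q1 a) - (\<integral>x. F x * (h \<bullet> s1 x) \<partial>Q1 a)\<bar> \<le> \<epsilon>/3 * norm h"
        by (rule tv_error_leD(3)[OF e1 Fm Fb])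
      have iF: "integrable (Q1 a) F" "integrable (Q1 a) F0"
        using Fb F0b D1(4) by (auto intro!: Q1.integrable_bounded[where B=1])
      have hs2: "integrable (Q1 a \<Otimes>\<^sub>M Q2 a) (\<lambda>z. f z * (h \<bullet> s2 (snd z)))"
        using abs_integral_mult_score_le(1)[OF i2, of f 1 h] fb sets_eq_imp_space_eq[OF sq] by auto
      have hs1: "integrable (Q1 a \<Otimes>\<^sub>M Q2 a) (\<lambda>z. f z * (h \<bullet> s1 (fst z)))"
        using abs_integral_mult_score_le(1)[OF i1, of f 1 h] fb sets_eq_imp_space_eq[OF sq] by auto
      have eF1: "(\<integral>z. f z * (h \<bullet> s2 (snd z)) \<partial>(Q1 a \<Otimes>\<^sub>M Q2 a)) = (\<integral>x. F1 x \<partial>Q1 a)"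
        and iF1: "integrable (Q1 a) F1"
        using Q12.integral_fst'[OF hs2] Q12.integrable_fst'[OF hs2] unfolding F1_def by simp_all
      have eF0: "(\<integral>z. f z * (h \<bullet> s1 (fst z)) \<partial>(Q1 a \<Otimes>\<^sub>M Q2 a)) = (\<integral>x. F0 x * (h \<bullet> s1 x) \<partial>Q1 a)"
        using Q12.integral_fst'[OF hs1] unfolding F0_def by simp
      have iFs: "integrable (Q1 a) (\<lambda>x. F x * (h \<bullet> s1 x))" "integrable (Q1 a) (\<lambda>x. F0 x * (h \<bullet> s1 x))"
        using abs_integral_mult_score_le(1)[OF D1(1), of F 1 h] abs_integral_mult_score_le(1)[OF D1(1), of F0 1 h]
          Fb F0b D1(4) by auto
      have split: "(\<integral>z. f z * (h \<bullet> (case z of (x, y) \<Rightarrow> s1 x + s2 y)) \<partial>(Q1 a \<Otimes>\<^sub>M Q2 a))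
        = (\<integral>x. F0 x * (h \<bullet> s1 x) \<partial>Q1 a) + (\<integral>x. F1 x \<partial>Q1 a)"
        unfolding eF0[symmetric] eF1[symmetric] using hs1 hs2
        by (simp add: case_prod_beta' inner_add_right distrib_left)
      have fst1: "(\<integral>x. f x \<partial>(Q1 (a + h) \<Otimes>\<^sub>M Q2 (a + h))) = (\<integral>x. F x \<partial>Q1 (a + h))"
        using R12.integral_fst'[OF fR] by (simp add: F_def)
      have fst0: "(\<integral>x. f x \<partial>(Q1 a \<Otimes>\<^sub>M Q2 a)) = (\<integral>x. F0 x \<partial>Q1 a)"
        using Q12.integral_fst'[OF fQ] by (simp add: F0_def)
      define t2 where "t2 = (\<integral>x. F x - F0 x - F1 x \<partial>Q1 a)"
      define t3 where "t3 = (\<integral>x. (F x - F0 x) * (h \<bullet> s1 x) \<partial>Q1 a)"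
      have t2: "\<bar>t2\<bar> \<le> \<epsilon>/3 * norm h"
        using Q1.norm_integral_le_const[of "\<lambda>x. F x - F0 x - F1 x" "\<epsilon>/3 * norm h"] rem2 D1(4) iF iF1
        unfolding t2_def by auto
      have "\<bar>F x - F0 x\<bar> \<le> (\<epsilon>/3 + E2) * norm h" if "x \<in> space M1" for x
        using rem2[OF that] F1b[OF that]
        unfolding distrib_right mult.commute[of E2] by linarith
      then have "\<bar>t3\<bar> \<le> (\<epsilon>/3 + E2) * norm h * norm h * E1"
        using abs_integral_mult_score_le(2)[OF D1(1), of "\<lambda>x. F x - F0 x" "(\<epsilon>/3 + E2) * norm h" h] D1(4)
        unfolding t3_def E1_def by auto
      also have "\<dots> = ((\<epsilon>/3 + E2) * E1) * norm h * norm h" by simp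
      also have "\<dots> \<le> ((\<epsilon>/3 + E2) * E1 + 1) * \<eta> * norm h"
        using h E \<epsilon> \<eta> by (intro mult_right_mono mult_mono) auto
      also have "\<dots> = \<epsilon>/3 * norm h" using den by (simp add: \<eta>_def field_simps)
      finally have t3: "\<bar>t3\<bar> \<le> \<epsilon>/3 * norm h" .
      have "(\<integral>x. F x \<partial>Q1 (a + h)) - (\<integral>x. F0 x \<partial>Q1 a) - ((\<integral>x. F0 x * (h \<bullet> s1 x) \<partial>Q1 a) + (\<integral>x. F1 x \<partial>Q1 a))
        = ((\<integral>x. F x \<partial>Q1 (a + h)) - (\<integral>x. F x \<partial>Q1 a) - (\<integral>x. F x * (h \<bullet> s1 x) \<partial>Q1 a)) + t2 + t3"
        unfolding t2_def t3_def using iF iF1 iFs by (simp add: left_diff_distrib)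
      then show "\<bar>score_remainder (\<lambda>a. Q1 a \<Otimes>\<^sub>M Q2 a) a (\<lambda>(x, y). s1 x + s2 y) f h\<bar> \<le> \<epsilon> * norm h"
        unfolding split fst1 fst0 using rem1 t2 t3 by linarith
    qed
  qed
qed

lemma tv_differentiable_distr:
  fixes s :: "'y \<Rightarrow> 'v::euclidean_space"
  assumes T: "tv_differentiable M Q a (\<lambda>x. s (\<phi> x))" and \<phi>: "\<phi> \<in> M \<rightarrow>\<^sub>M N" and s: "s \<in> borel_measurable N"
  shows "tv_differentiable N (\<lambda>a. distr (Q a) N \<phi>) a s"
  unfolding tv_differentiable_def
proof (intro conjI allI impI)
  note D = tv_differentiableD[OF T]
  have \<phi>0: "\<phi> \<in> Q a \<rightarrow>\<^sub>M N" using \<phi> D(3) by (simp cong: measurable_cong_sets)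
  show "integrable (distr (Q a) N \<phi>) s" using D(1) s \<phi>0 by (simp add: integrable_distr_eq)
  fix \<epsilon> :: real assume "0 < \<epsilon>"
  from D(5)[OF this] show "\<forall>\<^sub>F h in nhds 0. tv_error_le N (\<lambda>a. distr (Q a) N \<phi>) a s \<epsilon> h"
  proof eventually_elim
    case (elim h)
    note E = tv_error_leD[OF elim]
    have \<phi>h: "\<phi> \<in> Q (a + h) \<rightarrow>\<^sub>M N" using \<phi> E(2) by (simp cong: measurable_cong_sets)
    show ?case
    proof (rule tv_error_leI)
      show "prob_space (distr (Q (a + h)) N \<phi>)" using E(1) \<phi>h by (rule prob_space.prob_space_distr)
      fix f :: "'y \<Rightarrow> real" assume f [measurable]: "f \<in> borel_measurable N" and b: "\<And>x. x \<in> space N \<Longrightarrow> \<bar>f x\<bar> \<le> 1"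
      have "(\<lambda>x. f (\<phi> x)) \<in> borel_measurable M" using \<phi> by measurable
      from E(3)[OF this b[OF measurable_space[OF \<phi>]]]
      show "\<bar>score_remainder (\<lambda>a. distr (Q a) N \<phi>) a s f h\<bar> \<le> \<epsilon> * norm h"
        using \<phi>0 \<phi>h s by (simp add: integral_distr)
    qed simp
  qed
qed

lemma tv_differentiable_cong:
  assumes T: "tv_differentiable M Q a s"
    and Q: "\<forall>\<^sub>F a' in nhds a. Q a' = Q' a'" and s: "\<And>x. x \<in> space M \<Longrightarrow> s x = s' x"
  shows "tv_differentiable M Q' a s'"
  unfolding tv_differentiable_def
proof (intro conjI allI impI)
  note D = tv_differentiableD[OF T]
  have Q0: "Q' a = Q a" using eventually_nhds_x_imp_x[OF Q] by simp
  show "integrable (Q' a) s'" unfolding Q0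
    using D(1) by (rule Bochner_Integration.integrable_cong[THEN iffD1, rotated -1]) (auto simp: D(4) s)
  have eq: "(\<integral>x. f x * (h \<bullet> s' x) \<partial>Q a) = (\<integral>x. f x * (h \<bullet> s x) \<partial>Q a)" for f h
    by (intro Bochner_Integration.integral_cong) (auto simp: D(4) s)
  have "((\<lambda>h. a + h) \<longlongrightarrow> a) (nhds 0)"
    using tendsto_add[OF tendsto_const[of a] filterlim_ident[of "nhds 0"]] by simp
  with Q have "\<forall>\<^sub>F h in nhds 0. Q (a + h) = Q' (a + h)" by (rule eventually_compose_filterlim)
  moreover fix \<epsilon> :: real assume "0 < \<epsilon>"
  note D(5)[OF this]
  ultimately show "\<forall>\<^sub>F h in nhds 0. tv_error_le M Q' a s' \<epsilon> h"
  proof eventually_elim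
    case (elim h)
    then show ?case unfolding tv_error_le_def Q0 eq by simp
  qed
qed

text \<open>
  The score of an i.i.d. sample is the sum of the scores of its observations: induction on the index
  set, adding one coordinate with the product rule.
\<close>

lemma tv_differentiable_PiM:
  fixes s :: "'x \<Rightarrow> 'v::euclidean_space" and I :: "'i set"
  assumes T: "tv_differentiable M Q a s" and I: "finite I"
  shows "tv_differentiable (PiM I (\<lambda>_. M)) (\<lambda>a. PiM I (\<lambda>_. Q a)) a (\<lambda>S. \<Sum>i\<in>I. s (S i))"
  using I
proof (induction I)
  case empty
  have "PiM ({} :: 'i set) (\<lambda>_. Q a') = PiM {} (\<lambda>_. M)" for a' by (simp add: PiM_empty)
  moreover have "prob_space (PiM ({} :: 'i set) (\<lambda>_. M))" by (rule prob_space_PiM) auto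
  ultimately show ?case unfolding tv_differentiable_def tv_error_le_def by simp
next
  case (insert i I)
  note D = tv_differentiableD[OF T]
  have [measurable]: "s \<in> borel_measurable M" using D(1,3) by (auto cong: measurable_cong_sets)
  let ?\<phi> = "\<lambda>(x, R). R(i := x)"
  have \<phi> [measurable]: "?\<phi> \<in> M \<Otimes>\<^sub>M PiM I (\<lambda>_. M) \<rightarrow>\<^sub>M PiM (insert i I) (\<lambda>_. M)" by measurable
  have "tv_differentiable (M \<Otimes>\<^sub>M PiM I (\<lambda>_. M)) (\<lambda>a. Q a \<Otimes>\<^sub>M PiM I (\<lambda>_. Q a)) a (\<lambda>z. \<Sum>j\<in>insert i I. s (?\<phi> z j))"
  proof (rule tv_differentiable_cong[OF tv_differentiable_pair[OF T insert.IH]])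
    fix z assume "z \<in> space (M \<Otimes>\<^sub>M PiM I (\<lambda>_. M))"
    show "(case z of (x, R) \<Rightarrow> s x + (\<Sum>i\<in>I. s (R i))) = (\<Sum>j\<in>insert i I. s (?\<phi> z j))"
    proof (cases z)
      case (Pair x R)
      have "(\<Sum>j\<in>I. s ((R(i := x)) j)) = (\<Sum>j\<in>I. s (R j))"
        using insert.hyps by (intro sum.cong) auto
      then show ?thesis using insert.hyps Pair by simp
    qed
  qed auto
  then have "tv_differentiable (PiM (insert i I) (\<lambda>_. M))
    (\<lambda>a. distr (Q a \<Otimes>\<^sub>M PiM I (\<lambda>_. Q a)) (PiM (insert i I) (\<lambda>_. M)) ?\<phi>) a (\<lambda>S. \<Sum>j\<in>insert i I. s (S j))"
    by (rule tv_differentiable_distr[where \<phi>="?\<phi>" and s="\<lambda>S. \<Sum>j\<in>insert i I. s (S j)", OF _ \<phi>]) measurable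
  then show ?case
  proof (rule tv_differentiable_cong)
    have "((\<lambda>a'. a' - a) \<longlongrightarrow> 0) (nhds a)"
      using tendsto_diff[OF filterlim_ident[of "nhds a"] tendsto_const[of a]] by simp
    with D(5)[OF zero_less_one] have "\<forall>\<^sub>F a' in nhds a. tv_error_le M Q a s 1 (a' - a)"
      by (rule eventually_compose_filterlim)
    then show "\<forall>\<^sub>F a' in nhds a. distr (Q a' \<Otimes>\<^sub>M PiM I (\<lambda>_. Q a')) (PiM (insert i I) (\<lambda>_. M)) ?\<phi> = PiM (insert i I) (\<lambda>_. Q a')"
    proof eventually_elim
      case (elim a')
      then have p: "prob_space (Q a')" and s: "sets (Q a') = sets M" using tv_error_leD(1,2)[OF elim] by simp_all
      have "distr (Q a' \<Otimes>\<^sub>M PiM I (\<lambda>_. Q a')) (PiM (insert i I) (\<lambda>_. M)) ?\<phi>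
        = distr (Q a' \<Otimes>\<^sub>M PiM I (\<lambda>_. Q a')) (PiM (insert i I) (\<lambda>_. Q a')) ?\<phi>"
        using s by (intro distr_cong sets_PiM_cong) auto
      also have "\<dots> = PiM (insert i I) (\<lambda>_. Q a')"
        using p by (intro distr_pair_PiM_eq_PiM[of I "\<lambda>_. Q a'" i])
      finally show ?case .
    qed
  qed auto
qed

text \<open>
  Differentiation under the integral sign: scale \<open>f\<close> to be bounded by one and apply the definition.
\<close>

lemma tv_differentiable_has_derivative:
  fixes s :: "'x \<Rightarrow> 'v::euclidean_space"
  assumes T: "tv_differentiable M Q a s" and f: "f \<in> borel_measurable M"
    and b: "\<And>x. x \<in> space M \<Longrightarrow> \<bar>f x\<bar> \<le> B"
  shows "((\<lambda>a'. \<integral>x. f x \<partial>Q a') has_derivative (\<lambda>h. \<integral>x. f x * (h \<bullet> s x) \<partial>Q a)) (at a)"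
proof -
  note D = tv_differentiableD[OF T]
  have f': "f \<in> borel_measurable (Q a)" using f D(3) by (simp cong: measurable_cong_sets)
  have b': "\<And>x. x \<in> space (Q a) \<Longrightarrow> \<bar>f x\<bar> \<le> B" using b D(4) by simp
  note I = abs_integral_mult_score_le[OF D(1) f' b']
  have lin: "bounded_linear (\<lambda>h. \<integral>x. f x * (h \<bullet> s x) \<partial>Q a)"
  proof (rule bounded_linear_intro)
    show "(\<integral>x. f x * ((h + h') \<bullet> s x) \<partial>Q a) = (\<integral>x. f x * (h \<bullet> s x) \<partial>Q a) + (\<integral>x. f x * (h' \<bullet> s x) \<partial>Q a)" for h h'
      using I(1) by (simp add: inner_add_left distrib_left)
    show "(\<integral>x. f x * ((r *\<^sub>R h) \<bullet> s x) \<partial>Q a) = r *\<^sub>R (\<integral>x. f x * (h \<bullet> s x) \<partial>Q a)" for r h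
      using I(1) by (simp add: mult.left_commute[of _ r])
    show "norm (\<integral>x. f x * (h \<bullet> s x) \<partial>Q a) \<le> norm h * (B * (\<integral>x. norm (s x) \<partial>Q a))" for h
      using I(2)[of h] by (simp add: mult_ac)
  qed
  define c where "c = \<bar>B\<bar> + 1"
  have c: "0 < c" by (simp add: c_def)
  have fc: "(\<lambda>x. f x / c) \<in> borel_measurable M" "\<And>x. x \<in> space M \<Longrightarrow> \<bar>f x / c\<bar> \<le> 1"
  proof -
    show "(\<lambda>x. f x / c) \<in> borel_measurable M" using f by simp
    fix x assume "x \<in> space M"
    from b[OF this] have "\<bar>f x\<bar> \<le> c" by (simp add: c_def)
    then show "\<bar>f x / c\<bar> \<le> 1" using c by (simp add: abs_divide)
  qed
  have "((\<lambda>h. norm (score_remainder Q a s f h) / norm h) \<longlongrightarrow> 0) (at 0)"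
  proof (rule tendstoI)
    fix e :: real assume e: "0 < e"
    have "\<forall>\<^sub>F h in at 0. tv_error_le M Q a s (e / (2 * c)) h"
      using D(5)[of "e / (2 * c)"] e c unfolding eventually_at_filter by (auto elim: eventually_mono)
    moreover have "\<forall>\<^sub>F h::'v in at 0. h \<noteq> 0" unfolding eventually_at_filter by simp
    ultimately show "\<forall>\<^sub>F h in at 0. dist (norm (score_remainder Q a s f h) / norm h) 0 < e"
    proof eventually_elim
      case (elim h)
      have "score_remainder Q a s (\<lambda>x. f x / c) h = score_remainder Q a s f h / c"
        by (simp add: diff_divide_distrib)
      with tv_error_leD(3)[OF elim(1) fc] have "\<bar>score_remainder Q a s f h / c\<bar> \<le> e / (2 * c) * norm h" by simp
      then have "\<bar>score_remainder Q a s f h\<bar> \<le> e / 2 * norm h" using c by (simp add: field_simps abs_divide)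
      also have "\<dots> < e * norm h" using e elim(2) by simp
      finally show ?case using elim(2) by (simp add: field_simps)
    qed
  qed
  then show ?thesis using lin unfolding has_derivative_at by simp
qed

section \<open>Consequences of the regularity of the model\<close>

lemma regular_model_density:
  assumes M: "regular_model \<Theta> \<mu> P p s" and \<theta>: "\<theta> \<in> \<Theta>"
  shows "prob_space (P \<theta>)" "p \<theta> \<in> borel_measurable \<mu>" "\<And>x. x \<in> space \<mu> \<Longrightarrow> 0 \<le> p \<theta> x"
    "P \<theta> = density \<mu> (\<lambda>x. ennreal (p \<theta> x))" "sets (P \<theta>) = sets \<mu>" "space (P \<theta>) = space \<mu>"
    "s \<theta> \<in> borel_measurable \<mu>"
proof -
  show 1: "prob_space (P \<theta>)" "p \<theta> \<in> borel_measurable \<mu>" "\<And>x. x \<in> space \<mu> \<Longrightarrow> 0 \<le> p \<theta> x"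
    "P \<theta> = density \<mu> (\<lambda>x. ennreal (p \<theta> x))"
    using M \<theta> unfolding regular_model_def by blast+
  show "sets (P \<theta>) = sets \<mu>" "space (P \<theta>) = space \<mu>" unfolding 1(4) by simp_all
  have j: "(\<lambda>(x, \<theta>). s \<theta> x) \<in> borel_measurable (\<mu> \<Otimes>\<^sub>M restrict_space borel \<Theta>)"
    using M unfolding regular_model_def by blast
  have "(\<lambda>x. (x, \<theta>)) \<in> \<mu> \<rightarrow>\<^sub>M \<mu> \<Otimes>\<^sub>M restrict_space borel \<Theta>"
    using \<theta> by (intro measurable_Pair) (auto simp: space_restrict_space)
  from measurable_compose[OF this j] show "s \<theta> \<in> borel_measurable \<mu>" by simp
qed

lemma regular_model_integral:
  fixes f :: "'x \<Rightarrow> real"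
  assumes M: "regular_model \<Theta> \<mu> P p s" and \<theta>: "\<theta> \<in> \<Theta>" and f: "f \<in> borel_measurable \<mu>"
  shows "(\<integral>x. f x \<partial>P \<theta>) = (\<integral>x. p \<theta> x * f x \<partial>\<mu>)"
    and "integrable (P \<theta>) f \<longleftrightarrow> integrable \<mu> (\<lambda>x. p \<theta> x * f x)"
  using regular_model_density[OF M \<theta>] f
  by (simp_all add: integral_density integrable_density)

lemma regular_model_L1:
  assumes "regular_model \<Theta> \<mu> P p s"
  obtains U where "open U" "\<Theta> \<subseteq> U" "L1_C1_on U \<mu> p (\<lambda>\<theta> x. p \<theta> x *\<^sub>R s \<theta> x)"
  using assms unfolding regular_model_def L1_C1_on_def by blast

lemma regular_model_integrable:
  assumes "regular_model \<Theta> \<mu> P p s" and "\<theta> \<in> \<Theta>"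
  shows "integrable \<mu> (p \<theta>)" "integrable \<mu> (\<lambda>x. p \<theta> x *\<^sub>R s \<theta> x)"
  by (rule regular_model_L1[OF assms(1)], use assms(2) in \<open>auto simp: L1_C1_on_def\<close>)+

abbreviation density_remainder ::
  "('v::real_inner \<Rightarrow> 'x \<Rightarrow> real) \<Rightarrow> ('v \<Rightarrow> 'x \<Rightarrow> 'v) \<Rightarrow> 'v \<Rightarrow> 'v \<Rightarrow> 'x \<Rightarrow> real" where
  "density_remainder p s \<theta> h x \<equiv> p (\<theta> + h) x - p \<theta> x - h \<bullet> (p \<theta> x *\<^sub>R s \<theta> x)"

lemma regular_model_L1_remainder:
  fixes \<theta> :: "real^'p"
  assumes M: "regular_model \<Theta> \<mu> P p s" and \<theta>: "\<theta> \<in> \<Theta>" and \<epsilon>: "0 < \<epsilon>"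
  obtains \<delta> where "\<delta> > 0"
    "\<And>h. norm h < \<delta> \<Longrightarrow> \<theta> + h \<in> \<Theta> \<Longrightarrow>
       (\<integral>x. \<bar>density_remainder p s \<theta> h x\<bar> \<partial>\<mu>) \<le> \<epsilon> * norm h"
proof -
  obtain U where "open U" and sub: "\<Theta> \<subseteq> U" and U: "L1_C1_on U \<mu> p (\<lambda>\<theta> x. p \<theta> x *\<^sub>R s \<theta> x)"
    by (rule regular_model_L1[OF M])
  let ?N = "\<lambda>h. \<integral>\<^sup>+x. ennreal \<bar>density_remainder p s \<theta> h x\<bar> \<partial>\<mu>"
  have "eventually (\<lambda>h. ?N h / ennreal (norm h) < ennreal \<epsilon>) (at 0)"
    using U \<theta> sub \<epsilon> unfolding L1_C1_on_def by (intro order_tendstoD(2)[where y=0]) auto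
  then obtain \<delta> where d: "\<delta> > 0" "\<And>h. h \<noteq> 0 \<Longrightarrow> norm h < \<delta> \<Longrightarrow> ?N h / ennreal (norm h) < ennreal \<epsilon>"
    unfolding eventually_at by (auto simp: dist_norm)
  show thesis
  proof (rule that[OF d(1)])
    fix h :: "real^'p" assume h: "norm h < \<delta>" "\<theta> + h \<in> \<Theta>"
    have i: "integrable \<mu> (\<lambda>x. \<bar>density_remainder p s \<theta> h x\<bar>)"
      using regular_model_integrable[OF M \<theta>] regular_model_integrable(1)[OF M h(2)]
      by (intro integrable_abs Bochner_Integration.integrable_diff integrable_inner_right) auto
    have e: "?N h = ennreal (\<integral>x. \<bar>density_remainder p s \<theta> h x\<bar> \<partial>\<mu>)"
      using i by (intro nn_integral_eq_integral) auto
    show "(\<integral>x. \<bar>density_remainder p s \<theta> h x\<bar> \<partial>\<mu>) \<le> \<epsilon> * norm h"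
    proof (cases "h = 0")
      case False
      then have "?N h / ennreal (norm h) = ennreal ((\<integral>x. \<bar>density_remainder p s \<theta> h x\<bar> \<partial>\<mu>) / norm h)"
        unfolding e by (intro divide_ennreal) auto
      with d(2)[OF False h(1)] \<epsilon> have "(\<integral>x. \<bar>density_remainder p s \<theta> h x\<bar> \<partial>\<mu>) / norm h < \<epsilon>"
        by (simp add: ennreal_less_iff)
      then show ?thesis using False by (simp add: field_simps)
    qed simp
  qed
qed

lemma regular_model_integrable_score:
  assumes M: "regular_model \<Theta> \<mu> P p s" and \<theta>: "\<theta> \<in> \<Theta>"
  shows "integrable (P \<theta>) (s \<theta>)"
    and "(\<integral>x. norm (s \<theta> x) \<partial>P \<theta>) = (\<integral>x. norm (p \<theta> x *\<^sub>R s \<theta> x) \<partial>\<mu>)"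
proof -
  have i: "integrable \<mu> (\<lambda>x. p \<theta> x *\<^sub>R s \<theta> x)" by (rule regular_model_integrable(2)[OF M \<theta>])
  note D = regular_model_density[OF M \<theta>]
  show "integrable (P \<theta>) (s \<theta>)"
    unfolding D(4) using D(2,3,7) i by (subst integrable_density) auto
  have "(\<integral>x. norm (s \<theta> x) \<partial>P \<theta>) = (\<integral>x. p \<theta> x * norm (s \<theta> x) \<partial>\<mu>)"
    using D(7) by (intro regular_model_integral[OF M \<theta>]) auto
  also have "\<dots> = (\<integral>x. norm (p \<theta> x *\<^sub>R s \<theta> x) \<partial>\<mu>)"
    using D(3) by (intro Bochner_Integration.integral_cong) auto
  finally show "(\<integral>x. norm (s \<theta> x) \<partial>P \<theta>) = (\<integral>x. norm (p \<theta> x *\<^sub>R s \<theta> x) \<partial>\<mu>)" .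
qed

lemma regular_model_integral_remainder:
  fixes \<theta> :: "real^'p" and f :: "'x \<Rightarrow> real"
  assumes M: "regular_model \<Theta> \<mu> P p s" and \<theta>: "\<theta> \<in> \<Theta>" and h: "\<theta> + h \<in> \<Theta>"
    and f: "f \<in> borel_measurable \<mu>" and b: "\<And>x. x \<in> space \<mu> \<Longrightarrow> \<bar>f x\<bar> \<le> 1"
  shows "\<bar>(\<integral>x. f x \<partial>P (\<theta> + h)) - (\<integral>x. f x \<partial>P \<theta>) - (\<integral>x. f x * (h \<bullet> s \<theta> x) \<partial>P \<theta>)\<bar>
    \<le> (\<integral>x. \<bar>density_remainder p s \<theta> h x\<bar> \<partial>\<mu>)"
proof -
  note D = regular_model_density[OF M \<theta>] and Dh = regular_model_density[OF M h]
  have abs_le: "\<bar>c * f x\<bar> \<le> \<bar>c\<bar>" if "x \<in> space \<mu>" for c x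
    using mult_left_mono[OF b[OF that] abs_ge_zero, of c] by (simp add: abs_mult)
  have bounded_mult: "integrable \<mu> (\<lambda>x. q x * f x)" if "integrable \<mu> q" for q :: "'x \<Rightarrow> real"
    using that f by (intro integrable_dominated[OF that]) (auto simp: abs_le)
  define r where "r x = density_remainder p s \<theta> h x" for x
  have i: "integrable \<mu> (p (\<theta> + h))" "integrable \<mu> (p \<theta>)" "integrable \<mu> (\<lambda>x. h \<bullet> (p \<theta> x *\<^sub>R s \<theta> x))"
    using regular_model_integrable[OF M \<theta>] regular_model_integrable[OF M h]
    by (auto intro!: integrable_inner_right simp del: inner_scaleR_right)
  then have ir: "integrable \<mu> r" unfolding r_def by auto
  have m: "(\<lambda>x. f x * (h \<bullet> s \<theta> x)) \<in> borel_measurable \<mu>" using f D(7) by auto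
  have "(\<integral>x. f x \<partial>P (\<theta> + h)) - (\<integral>x. f x \<partial>P \<theta>) - (\<integral>x. f x * (h \<bullet> s \<theta> x) \<partial>P \<theta>)
    = (\<integral>x. p (\<theta> + h) x * f x \<partial>\<mu>) - (\<integral>x. p \<theta> x * f x \<partial>\<mu>) - (\<integral>x. h \<bullet> (p \<theta> x *\<^sub>R s \<theta> x) * f x \<partial>\<mu>)"
    unfolding regular_model_integral(1)[OF M \<theta> f] regular_model_integral(1)[OF M h f] regular_model_integral(1)[OF M \<theta> m]
    by (simp add: mult_ac)
  also have "\<dots> = (\<integral>x. r x * f x \<partial>\<mu>)"
    unfolding r_def left_diff_distrib using i bounded_mult by simp
  finally have "\<bar>(\<integral>x. f x \<partial>P (\<theta> + h)) - (\<integral>x. f x \<partial>P \<theta>) - (\<integral>x. f x * (h \<bullet> s \<theta> x) \<partial>P \<theta>)\<bar> \<le> (\<integral>x. \<bar>r x * f x\<bar> \<partial>\<mu>)"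
    by simp
  also have "\<dots> \<le> (\<integral>x. \<bar>r x\<bar> \<partial>\<mu>)"
    using ir bounded_mult[OF ir] by (intro integral_mono integrable_abs abs_le)
  finally show ?thesis unfolding r_def .
qed

lemma regular_model_tv_differentiable:
  assumes M: "regular_model \<Theta> \<mu> P p s" and \<theta>: "\<theta> \<in> interior \<Theta>"
  shows "tv_differentiable \<mu> P \<theta> (s \<theta>)"
  unfolding tv_differentiable_def
proof (intro conjI allI impI)
  have \<theta>': "\<theta> \<in> \<Theta>" using \<theta> interior_subset by auto
  show "integrable (P \<theta>) (s \<theta>)" by (rule regular_model_integrable_score[OF M \<theta>'])
  fix \<epsilon> :: real assume \<epsilon>: "0 < \<epsilon>"
  obtain r where r: "r > 0" "ball \<theta> r \<subseteq> \<Theta>" using \<theta> by (auto simp: mem_interior)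
  obtain \<delta> where d: "\<delta> > 0" "\<And>h. norm h < \<delta> \<Longrightarrow> \<theta> + h \<in> \<Theta> \<Longrightarrow>
       (\<integral>x. \<bar>density_remainder p s \<theta> h x\<bar> \<partial>\<mu>) \<le> \<epsilon> * norm h"
    by (rule regular_model_L1_remainder[OF M \<theta>' \<epsilon>], rule that)
  have "\<forall>\<^sub>F h in nhds (0 :: real^'a). norm h < min \<delta> r"
    using d(1) r(1) unfolding eventually_nhds_metric by (intro exI[of _ "min \<delta> r"]) (simp add: dist_norm)
  then show "\<forall>\<^sub>F h in nhds 0. tv_error_le \<mu> P \<theta> (s \<theta>) \<epsilon> h"
  proof eventually_elim
    case (elim h)
    then have h: "norm h < \<delta>" "\<theta> + h \<in> \<Theta>" using r by (auto simp: dist_norm)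
    show ?case
      by (rule tv_error_leI[OF regular_model_density(1,5)[OF M h(2)]
            order_trans[OF regular_model_integral_remainder[OF M \<theta>' h(2)] d(2)[OF h]]])
  qed
qed

text \<open>
  Differentiability in \<open>L\<^sup>1\<close> makes \<open>\<theta> \<mapsto> P \<theta> A\<close> continuous for each event \<open>A\<close>, hence
  measurable. This is what makes the Fisher information a measurable function of \<open>\<theta>\<close>.
\<close>

lemma regular_model_kernel:
  assumes M: "regular_model \<Theta> \<mu> P p s"
  shows "P \<in> restrict_space borel \<Theta> \<rightarrow>\<^sub>M prob_algebra \<mu>"
proof (rule measurable_prob_algebraI)
  show "prob_space (P \<theta>)" if "\<theta> \<in> space (restrict_space borel \<Theta>)" for \<theta>
    using that regular_model_density[OF M] by (auto simp: space_restrict_space)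
  show "P \<in> restrict_space borel \<Theta> \<rightarrow>\<^sub>M subprob_algebra \<mu>"
  proof (rule measurable_subprob_algebra)
    fix \<theta> assume "\<theta> \<in> space (restrict_space borel \<Theta>)"
    then have \<theta>: "\<theta> \<in> \<Theta>" by (simp add: space_restrict_space)
    note D = regular_model_density[OF M \<theta>]
    show "subprob_space (P \<theta>)" using D(1) by (rule prob_space_imp_subprob_space)
    show "sets (P \<theta>) = sets \<mu>" by (rule D)
  next
    fix A assume A: "A \<in> sets \<mu>"
    have eq: "measure (P \<theta>) A = (\<integral>x. indicator A x \<partial>P \<theta>)" if "\<theta> \<in> \<Theta>" for \<theta>
      using regular_model_density[OF M that] A by simp
    have "continuous_on \<Theta> (\<lambda>\<theta>. measure (P \<theta>) A)"
      unfolding continuous_on_iff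
    proof (intro ballI allI impI)
      fix \<theta> and e :: real assume \<theta>: "\<theta> \<in> \<Theta>" and e: "0 < e"
      note D = regular_model_density[OF M \<theta>]
      define E where "E = (\<integral>x. norm (s \<theta> x) \<partial>P \<theta>)"
      have E: "0 \<le> E" by (simp add: E_def)
      obtain \<delta> where d: "\<delta> > 0" "\<And>h. norm h < \<delta> \<Longrightarrow> \<theta> + h \<in> \<Theta> \<Longrightarrow>
          (\<integral>x. \<bar>density_remainder p s \<theta> h x\<bar> \<partial>\<mu>) \<le> 1 * norm h"
        by (rule regular_model_L1_remainder[OF M \<theta> zero_less_one], rule that)
      show "\<exists>d>0. \<forall>\<theta>'\<in>\<Theta>. dist \<theta>' \<theta> < d \<longrightarrow> dist (measure (P \<theta>') A) (measure (P \<theta>) A) < e"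
      proof (intro exI[of _ "min \<delta> (e / (1 + E))"] conjI ballI impI)
        show "0 < min \<delta> (e / (1 + E))" using d e E by simp
        fix \<theta>' assume \<theta>': "\<theta>' \<in> \<Theta>" "dist \<theta>' \<theta> < min \<delta> (e / (1 + E))"
        define h where "h = \<theta>' - \<theta>"
        have h: "\<theta>' = \<theta> + h" "\<theta> + h \<in> \<Theta>" "norm h < \<delta>" "norm h < e / (1 + E)"
          using \<theta>' by (auto simp: h_def dist_norm)
        have "\<bar>(\<integral>x. indicator A x \<partial>P (\<theta> + h)) - (\<integral>x. indicator A x \<partial>P \<theta>) - (\<integral>x. indicator A x * (h \<bullet> s \<theta> x) \<partial>P \<theta>)\<bar> \<le> norm h"
          using regular_model_integral_remainder[OF M \<theta> h(2), of "indicator A"] d(2)[OF h(3) h(2)] A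
          by (auto simp: indicator_def)
        moreover have "\<bar>\<integral>x. indicator A x * (h \<bullet> s \<theta> x) \<partial>P \<theta>\<bar> \<le> 1 * norm h * E"
          unfolding E_def using regular_model_integrable_score[OF M \<theta>] A D(5)
          by (intro abs_integral_mult_score_le(2)) (auto simp: indicator_def)
        ultimately have "\<bar>measure (P \<theta>') A - measure (P \<theta>) A\<bar> \<le> norm h * (1 + E)"
          unfolding h(1) eq[OF \<theta>] eq[OF h(2)] distrib_left by linarith
        also have "\<dots> < e" using h(4) E by (simp add: field_simps)
        finally show "dist (measure (P \<theta>') A) (measure (P \<theta>) A) < e" by (simp add: dist_real_def)
      qed
    qed
    then have "(\<lambda>\<theta>. measure (P \<theta>) A) \<in> borel_measurable (restrict_space borel \<Theta>)"
      by (rule borel_measurable_continuous_on_restrict)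
    then have "(\<lambda>\<theta>. ennreal (measure (P \<theta>) A)) \<in> borel_measurable (restrict_space borel \<Theta>)" by simp
    then show "(\<lambda>\<theta>. emeasure (P \<theta>) A) \<in> borel_measurable (restrict_space borel \<Theta>)"
    proof (rule measurable_cong[THEN iffD1, rotated])
      fix \<theta> assume "\<theta> \<in> space (restrict_space borel \<Theta>)"
      then interpret prob_space "P \<theta>" using regular_model_density[OF M, of \<theta>] by (simp add: space_restrict_space)
      show "ennreal (measure (P \<theta>) A) = emeasure (P \<theta>) A" by (simp add: emeasure_eq_measure)
    qed
  qed
qed

text \<open>
  Continuity of \<open>\<theta> \<mapsto> p \<theta> s \<theta>\<close> in \<open>L\<^sup>1\<close> on the compact set \<open>\<Theta>\<close>. The bound makes the
  derivative of the mean of an estimator bounded, as integration by parts requires.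
\<close>

lemma regular_model_score_bounded:
  assumes M: "regular_model \<Theta> \<mu> P p s" and \<Theta>: "compact \<Theta>"
  obtains B where "0 \<le> B" "\<And>\<theta>. \<theta> \<in> \<Theta> \<Longrightarrow> (\<integral>x. norm (s \<theta> x) \<partial>P \<theta>) \<le> B"
proof -
  obtain U where U: "open U" "\<Theta> \<subseteq> U" and L1: "L1_C1_on U \<mu> p (\<lambda>\<theta> x. p \<theta> x *\<^sub>R s \<theta> x)"
    by (rule regular_model_L1[OF M])
  have iU: "integrable \<mu> (\<lambda>x. p \<theta> x *\<^sub>R s \<theta> x)" if "\<theta> \<in> U" for \<theta>
    using L1 that unfolding L1_C1_on_def by blast
  define g where "g \<theta> = (\<integral>x. norm (p \<theta> x *\<^sub>R s \<theta> x) \<partial>\<mu>)" for \<theta>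
  have "continuous_on U g"
    unfolding continuous_on_eq_continuous_at[OF U(1)] continuous_at
  proof
    fix \<theta> assume \<theta>: "\<theta> \<in> U"
    show "(g \<longlongrightarrow> g \<theta>) (at \<theta>)"
    proof (rule tendstoI)
      fix e :: real assume e: "0 < e"
      have "eventually (\<lambda>\<theta>'. (\<integral>\<^sup>+x. ennreal (norm (p \<theta>' x *\<^sub>R s \<theta>' x - p \<theta> x *\<^sub>R s \<theta> x)) \<partial>\<mu>) < ennreal e) (at \<theta>)"
        using L1 \<theta> e unfolding L1_C1_on_def by (intro order_tendstoD(2)[where y=0]) auto
      moreover have "eventually (\<lambda>\<theta>'. \<theta>' \<in> U) (at \<theta>)" using U(1) \<theta> by (rule eventually_at_in_open')
      ultimately show "eventually (\<lambda>\<theta>'. dist (g \<theta>') (g \<theta>) < e) (at \<theta>)"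
      proof eventually_elim
        case (elim \<theta>')
        have i: "integrable \<mu> (\<lambda>x. norm (p \<theta>' x *\<^sub>R s \<theta>' x - p \<theta> x *\<^sub>R s \<theta> x))"
          using iU[OF \<theta>] iU[OF elim(2)] by (intro integrable_norm Bochner_Integration.integrable_diff)
        have ii: "integrable \<mu> (\<lambda>x. norm (p \<theta>' x *\<^sub>R s \<theta>' x))" "integrable \<mu> (\<lambda>x. norm (p \<theta> x *\<^sub>R s \<theta> x))"
          using iU[OF \<theta>] iU[OF elim(2)] by (auto intro!: integrable_norm simp del: norm_scaleR)
        have "\<bar>g \<theta>' - g \<theta>\<bar> = \<bar>\<integral>x. norm (p \<theta>' x *\<^sub>R s \<theta>' x) - norm (p \<theta> x *\<^sub>R s \<theta> x) \<partial>\<mu>\<bar>"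
          unfolding g_def using ii by (simp del: norm_scaleR)
        also have "\<dots> \<le> (\<integral>x. \<bar>norm (p \<theta>' x *\<^sub>R s \<theta>' x) - norm (p \<theta> x *\<^sub>R s \<theta> x)\<bar> \<partial>\<mu>)"
          using integral_norm_bound[of \<mu> "\<lambda>x. norm (p \<theta>' x *\<^sub>R s \<theta>' x) - norm (p \<theta> x *\<^sub>R s \<theta> x)"] by (simp del: norm_scaleR)
        also have "\<dots> \<le> (\<integral>x. norm (p \<theta>' x *\<^sub>R s \<theta>' x - p \<theta> x *\<^sub>R s \<theta> x) \<partial>\<mu>)"
          by (intro integral_mono integrable_abs Bochner_Integration.integrable_diff i ii norm_triangle_ineq3)
        also have "\<dots> < e"
          using elim(1) e unfolding nn_integral_eq_integral[OF i, simplified] by (simp add: ennreal_less_iff)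
        finally show ?case by (simp add: dist_real_def)
      qed
    qed
  qed
  then have "compact (g ` \<Theta>)" using U(2) \<Theta> by (meson compact_continuous_image continuous_on_subset)
  then obtain B where B: "\<And>y. y \<in> g ` \<Theta> \<Longrightarrow> norm y \<le> B" by (meson bounded_iff compact_imp_bounded)
  show thesis
  proof (rule that[of "max B 0"])
    fix \<theta> assume \<theta>: "\<theta> \<in> \<Theta>"
    then have "g \<theta> \<le> B" using B[of "g \<theta>"] by auto
    then show "(\<integral>x. norm (s \<theta> x) \<partial>P \<theta>) \<le> max B 0"
      unfolding regular_model_integrable_score(2)[OF M \<theta>] g_def by simp
  qed simp
qed

text \<open>
  Differentiability in quadratic mean forces the score to be square integrable: for a single small
  step \<open>h = t b\<close>, half of \<open>(h \<bullet> s) sqrt p\<close> differs by a square-integrable remainder from a difference of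
  two root densities. Hence the entries of the Fisher information matrix are the second moments of the
  score; a divergent entry would be zero by convention.
\<close>

lemma regular_model_score_square_integrable:
  fixes \<theta> :: "real^'p"
  assumes M: "regular_model \<Theta> \<mu> P p s" and \<theta>: "\<theta> \<in> interior \<Theta>"
  shows "integrable (P \<theta>) (\<lambda>x. (norm (s \<theta> x))\<^sup>2)"
proof -
  have \<theta>': "\<theta> \<in> \<Theta>" using \<theta> interior_subset by auto
  note D = regular_model_density[OF M \<theta>']
  note [measurable] = D(2) D(7)
  have dqm: "dqm_at \<mu> p s \<theta>" using M \<theta> unfolding regular_model_def by blast
  let ?R = "\<lambda>h x. (sqrt (p (\<theta> + h) x) - sqrt (p \<theta> x) - 1 / 2 * (h \<bullet> s \<theta> x) * sqrt (p \<theta> x))\<^sup>2"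
  obtain r where r: "r > 0" "ball \<theta> r \<subseteq> \<Theta>" using \<theta> by (auto simp: mem_interior)
  have "eventually (\<lambda>h. (\<integral>\<^sup>+x. ennreal (?R h x) \<partial>\<mu>) / ennreal ((norm h)\<^sup>2) < 1) (at 0)"
    using dqm unfolding dqm_at_def by (intro order_tendstoD(2)[where y=0]) auto
  then obtain \<delta> where d: "\<delta> > 0"
    "\<And>h. h \<noteq> 0 \<Longrightarrow> norm h < \<delta> \<Longrightarrow> (\<integral>\<^sup>+x. ennreal (?R h x) \<partial>\<mu>) / ennreal ((norm h)\<^sup>2) < 1"
    unfolding eventually_at by (auto simp: dist_norm)
  have comp: "integrable \<mu> (\<lambda>x. p \<theta> x * (s \<theta> x \<bullet> b)\<^sup>2)" if b: "b \<in> Basis" for b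
  proof -
    define t where "t = min \<delta> r / 2"
    define h where "h = t *\<^sub>R b"
    have t: "0 < t" "t < \<delta>" "t < r" using d r by (auto simp: t_def min_def)
    have nh: "norm h = t" using t b by (simp add: h_def)
    have hT: "\<theta> + h \<in> \<Theta>" using r t nh by (auto simp: dist_norm)
    note Dh = regular_model_density[OF M hT]
    note [measurable] = Dh(2)
    have "(\<integral>\<^sup>+x. ennreal (?R h x) \<partial>\<mu>) < \<infinity>"
    proof (rule ccontr)
      assume "\<not> (\<integral>\<^sup>+x. ennreal (?R h x) \<partial>\<mu>) < \<infinity>"
      then have "(\<integral>\<^sup>+x. ennreal (?R h x) \<partial>\<mu>) = \<infinity>" by (simp only: infinity_ennreal_def top.not_eq_extremum[symmetric] not_not)
      then show False using d(2)[of h] nh t by (auto simp: ennreal_top_divide)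
    qed
    then have iR: "integrable \<mu> (?R h)" by (intro integrableI_bounded) auto
    note ip = regular_model_integrable(1)[OF M \<theta>'] regular_model_integrable(1)[OF M hT]
    show ?thesis
    proof (rule integrable_dominated)
      show "integrable \<mu> (\<lambda>x. 12 / t\<^sup>2 * (p (\<theta> + h) x + p \<theta> x + ?R h x))"
        using iR ip by auto
      fix x assume x: "x \<in> space \<mu>"
      define u where "u = sqrt (p (\<theta> + h) x)"
      define v where "v = sqrt (p \<theta> x)"
      define w where "w = u - v - 1 / 2 * (h \<bullet> s \<theta> x) * v"
      have u2: "u\<^sup>2 = p (\<theta> + h) x" and v2: "v\<^sup>2 = p \<theta> x" using D(3)[OF x] Dh(3)[OF x] by (simp_all add: u_def v_def)
      \<comment> \<open>solve the definition of the remainder for the score term and use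
        \<open>(u - v - w)\<^sup>2 \<le> 3 (u\<^sup>2 + v\<^sup>2 + w\<^sup>2)\<close>\<close>
      have "((h \<bullet> s \<theta> x) * v)\<^sup>2 = 4 * (u - v - w)\<^sup>2" by (simp add: w_def power2_eq_square algebra_simps)
      also have "\<dots> \<le> 12 * (u\<^sup>2 + v\<^sup>2 + w\<^sup>2)"
      proof -
        have "3 * (u\<^sup>2 + v\<^sup>2 + w\<^sup>2) - (u - v - w)\<^sup>2 = (u + v)\<^sup>2 + (u + w)\<^sup>2 + (v - w)\<^sup>2"
          by (simp add: power2_eq_square algebra_simps)
        then show ?thesis by (smt (verit) zero_le_power2)
      qed
      finally have "t\<^sup>2 * (p \<theta> x * (s \<theta> x \<bullet> b)\<^sup>2) \<le> 12 * (u\<^sup>2 + v\<^sup>2 + w\<^sup>2)"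
        by (simp add: h_def power_mult_distrib v2 inner_commute mult_ac)
      then have "p \<theta> x * (s \<theta> x \<bullet> b)\<^sup>2 \<le> 12 / t\<^sup>2 * (u\<^sup>2 + v\<^sup>2 + w\<^sup>2)"
        using t by (simp add: field_simps)
      then show "norm (p \<theta> x * (s \<theta> x \<bullet> b)\<^sup>2) \<le> norm (12 / t\<^sup>2 * (p (\<theta> + h) x + p \<theta> x + ?R h x))"
        using D(3)[OF x] order_trans[OF _ abs_ge_self] unfolding u2 v2
        by (simp only: real_norm_def w_def u_def v_def abs_of_nonneg mult_nonneg_nonneg zero_le_power2)
    qed measurable
  qed
  have "integrable \<mu> (\<lambda>x. p \<theta> x * (norm (s \<theta> x))\<^sup>2)"
    unfolding power2_norm_eq_inner euclidean_inner[of "s \<theta> _" "s \<theta> _"] sum_distrib_left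
    using comp by (intro Bochner_Integration.integrable_sum) (simp add: power2_eq_square)
  then show ?thesis using D(7) by (subst regular_model_integral(2)[OF M \<theta>']) auto
qed

section \<open>Fisher information matrices\<close>

lemma integral_measurable_kernel:
  fixes f :: "'a \<Rightarrow> 'b \<Rightarrow> real"
  assumes f [measurable]: "(\<lambda>(x, y). f x y) \<in> borel_measurable (M \<Otimes>\<^sub>M N)"
    and L: "L \<in> M \<rightarrow>\<^sub>M subprob_algebra N"
  shows "(\<lambda>x. \<integral>y. f x y \<partial>L x) \<in> borel_measurable M"
proof -
  have id: "(\<lambda>(x, y). (x, y)) \<in> M \<Otimes>\<^sub>M N \<rightarrow>\<^sub>M M \<Otimes>\<^sub>M N" by simp
  have "(\<lambda>x. distr (L x) (M \<Otimes>\<^sub>M N) (\<lambda>y. (x, y))) \<in> M \<rightarrow>\<^sub>M subprob_algebra (M \<Otimes>\<^sub>M N)"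
    by (rule measurable_distr2[OF id L])
  from measurable_compose[OF this integral_measurable_subprob_algebra[OF f]]
  have "(\<lambda>x. integral\<^sup>L (distr (L x) (M \<Otimes>\<^sub>M N) (\<lambda>y. (x, y))) (\<lambda>(x, y). f x y)) \<in> borel_measurable M" .
  then show ?thesis
  proof (rule measurable_cong[THEN iffD1, rotated])
    fix x assume x: "x \<in> space M"
    have "sets (L x) = sets N" using measurable_space[OF L x] by (simp add: space_subprob_algebra)
    then have m: "Pair x \<in> L x \<rightarrow>\<^sub>M M \<Otimes>\<^sub>M N"
      using measurable_Pair1'[OF x, of N] measurable_cong_sets by blast
    show "integral\<^sup>L (distr (L x) (M \<Otimes>\<^sub>M N) (\<lambda>y. (x, y))) (\<lambda>(x, y). f x y) = (\<integral>y. f x y \<partial>L x)"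
      using integral_distr[OF m f] by simp
  qed
qed

lemma borel_measurable_vec_nth [measurable (raw)]:
  fixes f :: "'x \<Rightarrow> real^'p"
  assumes "f \<in> borel_measurable M"
  shows "(\<lambda>x. f x $ i) \<in> borel_measurable M"
proof -
  have "(\<lambda>x. f x \<bullet> axis i 1) \<in> borel_measurable M" using assms by measurable
  then show ?thesis by (simp add: inner_axis)
qed

lemma matrix_vector_mult_le_spectral_norm: "norm (M *v v) \<le> spectral_norm M * norm v"
  unfolding spectral_norm_def by (rule onorm[OF matrix_vector_mul_bounded_linear])

lemma spectral_norm_nonneg: "0 \<le> spectral_norm M"
  unfolding spectral_norm_def by (rule onorm_pos_le[OF matrix_vector_mul_bounded_linear])

lemma abs_trace_le_spectral_norm:
  fixes M :: "real^'p^'p"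
  shows "\<bar>trace M\<bar> \<le> real CARD('p) * spectral_norm M"
proof -
  have "\<bar>M $ i $ i\<bar> \<le> spectral_norm M" for i
  proof -
    have "\<bar>M $ i $ i\<bar> = \<bar>(M *v axis i 1) $ i\<bar>"
      by (simp add: matrix_vector_mult_basis column_def)
    also have "\<dots> \<le> norm (M *v axis i 1)" by (rule component_le_norm_cart)
    also have "\<dots> \<le> spectral_norm M" using matrix_vector_mult_le_spectral_norm[of M "axis i 1"] by simp
    finally show ?thesis .
  qed
  then have "(\<Sum>i\<in>UNIV. \<bar>M $ i $ i\<bar>) \<le> (\<Sum>i\<in>(UNIV :: 'p set). spectral_norm M)"
    by (rule sum_mono)
  also have "\<dots> = real CARD('p) * spectral_norm M" by simp
  finally show ?thesis
    unfolding trace_def by (rule order_trans[OF sum_abs])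
qed

lemma fisher_info_quadratic_le:
  fixes s :: "'x \<Rightarrow> real^'p"
  assumes s [measurable]: "s \<in> borel_measurable P" and s2: "integrable P (\<lambda>x. (norm (s x))\<^sup>2)"
  shows "(\<integral>x. (v \<bullet> s x)\<^sup>2 \<partial>P) \<le> spectral_norm (fisher_info P s) * (norm v)\<^sup>2"
proof -
  have ij: "integrable P (\<lambda>x. s x $ i * s x $ j)" for i j
    using component_le_norm_cart[of "s _"]
    by (intro integrable_dominated[OF s2]) (simp_all add: abs_mult power2_eq_square mult_mono')
  have "(\<integral>x. (v \<bullet> s x)\<^sup>2 \<partial>P) = (\<integral>x. (\<Sum>i\<in>UNIV. \<Sum>j\<in>UNIV. v $ i * v $ j * (s x $ i * s x $ j)) \<partial>P)"
    by (simp add: inner_vec_def power2_eq_square sum_product mult_ac)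
  also have "\<dots> = (\<Sum>i\<in>UNIV. \<Sum>j\<in>UNIV. v $ i * v $ j * (\<integral>x. s x $ i * s x $ j \<partial>P))"
    using ij by (subst Bochner_Integration.integral_sum, simp, subst Bochner_Integration.integral_sum) auto
  also have "\<dots> = v \<bullet> (fisher_info P s *v v)"
    by (simp add: inner_vec_def matrix_vector_mult_def fisher_info_def sum_distrib_left mult_ac)
  also have "\<dots> \<le> norm v * norm (fisher_info P s *v v)" by (rule norm_cauchy_schwarz)
  also have "\<dots> \<le> norm v * (spectral_norm (fisher_info P s) * norm v)"
    by (intro mult_left_mono matrix_vector_mult_le_spectral_norm) simp
  finally show "(\<integral>x. (v \<bullet> s x)\<^sup>2 \<partial>P) \<le> spectral_norm (fisher_info P s) * (norm v)\<^sup>2"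
    by (simp add: power2_eq_square mult_ac)
qed

lemma regular_model_trace_measurable:
  fixes s :: "real^'p \<Rightarrow> 'x \<Rightarrow> real^'p"
  assumes M: "regular_model \<Theta> \<mu> P p s"
  shows "(\<lambda>\<theta>. trace (fisher_info (P \<theta>) (s \<theta>))) \<in> borel_measurable (restrict_space borel \<Theta>)"
proof -
  have j: "(\<lambda>(x, \<theta>). s \<theta> x) \<in> borel_measurable (\<mu> \<Otimes>\<^sub>M restrict_space borel \<Theta>)"
    using M unfolding regular_model_def by blast
  have j': "(\<lambda>(\<theta>, x). s \<theta> x) \<in> borel_measurable (restrict_space borel \<Theta> \<Otimes>\<^sub>M \<mu>)"
    using measurable_compose[OF measurable_pair_swap' j] by (simp add: case_prod_beta')
  then have c: "(\<lambda>z. s (fst z) (snd z)) \<in> borel_measurable (restrict_space borel \<Theta> \<Otimes>\<^sub>M \<mu>)"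
    by (simp add: case_prod_beta')
  have "(\<lambda>\<theta>. \<integral>x. s \<theta> x $ i * s \<theta> x $ i \<partial>P \<theta>) \<in> borel_measurable (restrict_space borel \<Theta>)" for i
    using c by (intro integral_measurable_kernel[OF _ measurable_prob_algebraD[OF regular_model_kernel[OF M]]])
       (simp add: case_prod_beta', measurable)
  then show ?thesis unfolding trace_def fisher_info_def by simp
qed

section \<open>Integration by parts against a weight that vanishes at the boundary\<close>

lemma tendsto_line:
  fixes x e :: "'a::real_normed_vector"
  shows "((\<lambda>t::real. x + t *\<^sub>R e) \<longlongrightarrow> x) (nhds 0)"
  using tendsto_add[OF tendsto_const[of x] tendsto_scaleR[OF filterlim_ident[of "nhds (0::real)"] tendsto_const[of e]]] by simp

lemma DERIV_along_line:
  fixes f g :: "'a::real_normed_vector \<Rightarrow> real"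
  assumes f: "(f has_derivative f') (at x)" and S: "open S" "x \<in> S" and eq: "\<And>y. y \<in> S \<Longrightarrow> f y = g y"
  shows "((\<lambda>t. g (x + t *\<^sub>R e)) has_real_derivative f' e) (at 0)"
proof -
  have "((\<lambda>t::real. x + t *\<^sub>R e) has_derivative (\<lambda>t. t *\<^sub>R e)) (at 0)"
    by (auto intro!: derivative_eq_intros)
  moreover have "(f has_derivative f') (at (x + (0::real) *\<^sub>R e))" using f by simp
  ultimately have "((\<lambda>t::real. f (x + t *\<^sub>R e)) has_derivative (\<lambda>t. f' (t *\<^sub>R e))) (at 0)"
    by (rule has_derivative_compose)
  moreover have "f' (t *\<^sub>R e) = f' e * t" for t
    using linear_scale[OF has_derivative_linear[OF f]] by simp
  ultimately have d: "((\<lambda>t. f (x + t *\<^sub>R e)) has_real_derivative f' e) (at 0)"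
    by (simp add: has_field_derivative_def)
  have "\<forall>\<^sub>F t in nhds (0::real). x + t *\<^sub>R e \<in> S" using tendsto_line S by (rule topological_tendstoD)
  then have "\<forall>\<^sub>F t in nhds (0::real). f (x + t *\<^sub>R e) = g (x + t *\<^sub>R e)" by eventually_elim (rule eq)
  from DERIV_cong_ev[OF refl this refl] d show ?thesis by simp
qed

lemma borel_measurable_weight_mult:
  fixes W f :: "'a::euclidean_space \<Rightarrow> real"
  assumes W: "continuous_on UNIV W" "\<And>x. 0 \<le> W x" and f: "continuous_on {x. 0 < W x} (\<lambda>x. W x * f x)"
  shows "(\<lambda>x. W x * f x) \<in> borel_measurable borel"
proof -
  have "open {x. 0 < W x}" by (intro open_Collect_less continuous_intros W)
  then have "(\<lambda>x. indicator {x. 0 < W x} x *\<^sub>R (W x * f x)) \<in> borel_measurable borel"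
    using f by (intro borel_measurable_continuous_on_indicator) auto
  moreover have "indicator {x. 0 < W x} x *\<^sub>R (W x * f x) = W x * f x" for x
    using W(2)[of x] by (cases "W x = 0") (auto simp: less_le)
  ultimately show ?thesis by (simp only:)
qed

lemma directional_derivative_bound:
  fixes F :: "'a::real_normed_vector \<Rightarrow> real"
  assumes F: "\<And>x. ((\<lambda>t. F (x + t *\<^sub>R e)) has_real_derivative F' x) (at 0)" and C: "\<And>x. \<bar>F' x\<bar> \<le> C"
  shows "\<bar>F (x + t *\<^sub>R e) - F x\<bar> \<le> C * \<bar>t\<bar>"
proof -
  have d: "((\<lambda>t. F (x + t *\<^sub>R e)) has_real_derivative F' (x + t *\<^sub>R e)) (at t)" for t
  proof -
    have "((\<lambda>r. F ((x + t *\<^sub>R e) + (r + - t) *\<^sub>R e)) has_real_derivative F' (x + t *\<^sub>R e)) (at t)"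
      using F[of "x + t *\<^sub>R e"] DERIV_shift[of "\<lambda>r. F ((x + t *\<^sub>R e) + r *\<^sub>R e)" "F' (x + t *\<^sub>R e)" t "- t"] by simp
    then show ?thesis by (simp add: algebra_simps)
  qed
  have "norm (F (x + t *\<^sub>R e) - F (x + 0 *\<^sub>R e)) \<le> C * norm (t - 0)"
    using d C by (intro field_differentiable_bound[where S=UNIV and f="\<lambda>t. F (x + t *\<^sub>R e)" and f'="\<lambda>t. F' (x + t *\<^sub>R e)"]) auto
  then show ?thesis by simp
qed

text \<open>
  Lebesgue measure is translation invariant, so every difference quotient of \<open>F\<close> along \<open>e\<close> has integral
  zero; the quotients are uniformly bounded with common bounded support, so the limit has integral zero
  too. This replaces Fubini and the fundamental theorem of calculus on lines.
\<close>

lemma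
  fixes F :: "'a::euclidean_space \<Rightarrow> real"
  assumes F: "integrable lborel F" and supp: "\<And>x. R < norm x \<Longrightarrow> F x = 0"
    and d: "\<And>x. ((\<lambda>t. F (x + t *\<^sub>R e)) has_real_derivative F' x) (at 0)" and C: "\<And>x. \<bar>F' x\<bar> \<le> C"
  shows integrable_directional_derivative: "integrable lborel F'"
    and integral_directional_derivative_eq_0: "(\<integral>x. F' x \<partial>lborel) = 0"
proof -
  define r where "r n = inverse (real (Suc n))" for n
  have r: "0 < r n" "r n \<le> 1" for n by (auto simp: r_def field_simps)
  define q where "q n x = (F (x + r n *\<^sub>R e) - F x) / r n" for n x
  have shift: "integrable lborel (\<lambda>x. F (x + c))" "(\<integral>x. F (x + c) \<partial>lborel) = (\<integral>x. F x \<partial>lborel)" for c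
  proof -
    have m: "(+) c \<in> lborel \<rightarrow>\<^sub>M (borel :: 'a measure)" by simp
    have "integrable (distr lborel borel ((+) c)) F" unfolding lborel_distr_plus by (rule F)
    from integrable_distr[OF m this] show "integrable lborel (\<lambda>x. F (x + c))" by (simp add: add.commute)
    have "(\<integral>x. F x \<partial>distr lborel borel ((+) c)) = (\<integral>x. F (c + x) \<partial>lborel)"
      using F by (intro integral_distr m) auto
    then show "(\<integral>x. F (x + c) \<partial>lborel) = (\<integral>x. F x \<partial>lborel)"
      unfolding lborel_distr_plus by (simp add: add.commute)
  qed
  have iq: "integrable lborel (q n)" for n unfolding q_def using F shift(1) by auto
  have q0: "(\<integral>x. q n x \<partial>lborel) = 0" for n unfolding q_def using F shift by simp
  have lim: "(\<lambda>n. q n x) \<longlonglongrightarrow> F' x" for x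
  proof -
    have "((\<lambda>t. (F (x + t *\<^sub>R e) - F x) / t) \<longlongrightarrow> F' x) (at 0)"
      using d[of x] unfolding DERIV_def by simp
    moreover have "filterlim r (at 0) sequentially"
      unfolding filterlim_at r_def using LIMSEQ_inverse_real_of_nat by auto
    ultimately show ?thesis unfolding q_def by (rule filterlim_compose)
  qed
  let ?w = "\<lambda>x::'a. C * indicator (cball 0 (R + norm e)) x :: real"
  have w: "integrable lborel ?w"
    using emeasure_bounded_finite[of "cball 0 (R + norm e) :: 'a set"]
    by (intro integrable_mult_right integrable_real_indicator) auto
  have C0: "0 \<le> C" using C[of 0] by simp
  have b: "\<bar>q n x\<bar> \<le> ?w x" for n x
  proof (cases "norm x \<le> R + norm e")
    case True
    have "\<bar>F (x + r n *\<^sub>R e) - F x\<bar> \<le> C * r n"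
      using directional_derivative_bound[OF d C, of x "r n"] r[of n] by simp
    then show ?thesis using True r[of n] by (simp add: q_def field_simps)
  next
    case False
    have "norm (r n *\<^sub>R e) \<le> norm e" using r[of n] by (simp add: mult_left_le_one_le)
    then have "R < norm (x + r n *\<^sub>R e)"
      using False norm_triangle_ineq2[of x "- r n *\<^sub>R e"] by simp
    moreover have "R < norm x" using False norm_ge_zero[of e] by linarith
    ultimately show ?thesis using supp C0 by (simp add: q_def)
  qed
  have m': "F' \<in> borel_measurable lborel"
    by (rule borel_measurable_LIMSEQ_real[OF lim]) (use iq in auto)
  show "integrable lborel F'"
    by (rule integrable_dominated_convergence[of F' lborel q ?w]) (use m' iq w lim b in auto)
  have "(\<lambda>n. \<integral>x. q n x \<partial>lborel) \<longlonglongrightarrow> (\<integral>x. F' x \<partial>lborel)"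
    by (rule integral_dominated_convergence[of F' lborel q ?w]) (use m' iq w lim b in auto)
  then show "(\<integral>x. F' x \<partial>lborel) = 0" unfolding q0 by (simp add: LIMSEQ_const_iff)
qed

text \<open>
  A continuously differentiable cut-off that vanishes up to \<open>\<epsilon>\<close> and tends to the identity on the
  positive reals as \<open>\<epsilon>\<close> tends to zero. Its derivative stays between 0 and 1, so it can be
  applied to a density without losing the integrable majorant of the gradient.
\<close>

definition soft_trunc :: "real \<Rightarrow> real \<Rightarrow> real" where
  "soft_trunc \<epsilon> u = (if u \<le> \<epsilon> then 0 else (u - \<epsilon>)\<^sup>2 / u)"

definition soft_trunc' :: "real \<Rightarrow> real \<Rightarrow> real" where
  "soft_trunc' \<epsilon> u = (if u \<le> \<epsilon> then 0 else 1 - (\<epsilon> / u)\<^sup>2)"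

lemma soft_trunc_bounds:
  assumes "0 < \<epsilon>" "0 \<le> u"
  shows "0 \<le> soft_trunc \<epsilon> u" "soft_trunc \<epsilon> u \<le> u" "0 \<le> soft_trunc' \<epsilon> u" "soft_trunc' \<epsilon> u \<le> 1"
proof -
  show "0 \<le> soft_trunc \<epsilon> u" using assms by (simp add: soft_trunc_def)
  show "soft_trunc \<epsilon> u \<le> u"
  proof (cases "u \<le> \<epsilon>")
    case False
    then have "(u - \<epsilon>)\<^sup>2 \<le> u\<^sup>2" using assms by (intro power_mono) auto
    then show ?thesis using False assms by (simp add: soft_trunc_def field_simps power2_eq_square)
  qed (use assms in \<open>simp add: soft_trunc_def\<close>)
  show "0 \<le> soft_trunc' \<epsilon> u"
  proof (cases "u \<le> \<epsilon>")
    case False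
    then have "(\<epsilon> / u)\<^sup>2 \<le> 1\<^sup>2" using assms by (intro power_mono) auto
    then show ?thesis using False by (simp add: soft_trunc'_def)
  qed (simp add: soft_trunc'_def)
  show "soft_trunc' \<epsilon> u \<le> 1" by (simp add: soft_trunc'_def)
qed

lemma DERIV_soft_trunc:
  assumes "0 < \<epsilon>"
  shows "(soft_trunc \<epsilon> has_real_derivative soft_trunc' \<epsilon> u) (at u)"
proof -
  consider "u < \<epsilon>" | "u = \<epsilon>" | "\<epsilon> < u" by linarith
  then show ?thesis
  proof cases
    case 1
    have "((\<lambda>_. 0) has_real_derivative 0) (at u)" by simp
    moreover have "eventually (\<lambda>x. x < \<epsilon>) (nhds u)" using 1 by (intro eventually_nhds_in_open[of "{..<\<epsilon>}", simplified]) auto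
    then have "eventually (\<lambda>x. 0 = soft_trunc \<epsilon> x) (nhds u)"
      by eventually_elim (simp add: soft_trunc_def)
    ultimately show ?thesis using 1 DERIV_cong_ev[OF refl] by (fastforce simp: soft_trunc'_def)
  next
    case 2
    have "((\<lambda>h. (soft_trunc \<epsilon> (\<epsilon> + h) - soft_trunc \<epsilon> \<epsilon>) / h) \<longlongrightarrow> 0) (at 0)"
    proof (rule Lim_null_comparison)
      show "((\<lambda>h. \<bar>h\<bar> / \<epsilon>) \<longlongrightarrow> 0) (at 0)" using assms by (auto intro!: tendsto_eq_intros)
      have "norm ((soft_trunc \<epsilon> (\<epsilon> + h) - soft_trunc \<epsilon> \<epsilon>) / h) \<le> \<bar>h\<bar> / \<epsilon>" for h
      proof (cases "h \<le> 0")
        case False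
        then have "h / (\<epsilon> + h) \<le> h / \<epsilon>" using assms by (intro divide_left_mono) auto
        then show ?thesis using False assms by (simp add: soft_trunc_def power2_eq_square)
      qed (use assms in \<open>simp add: soft_trunc_def divide_nonpos_pos\<close>)
      then show "\<forall>\<^sub>F h in at 0. norm ((soft_trunc \<epsilon> (\<epsilon> + h) - soft_trunc \<epsilon> \<epsilon>) / h) \<le> \<bar>h\<bar> / \<epsilon>" by simp
    qed
    then show ?thesis using 2 by (simp add: DERIV_def soft_trunc'_def)
  next
    case 3
    have "((\<lambda>u. (u - \<epsilon>)\<^sup>2 / u) has_real_derivative 1 - (\<epsilon> / u)\<^sup>2) (at u)"
      using 3 assms by (auto intro!: derivative_eq_intros simp: field_simps power2_eq_square)
    moreover have "eventually (\<lambda>x. \<epsilon> < x) (nhds u)" using 3 by (intro eventually_nhds_in_open[of "{\<epsilon><..}", simplified]) auto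
    then have "eventually (\<lambda>x. (x - \<epsilon>)\<^sup>2 / x = soft_trunc \<epsilon> x) (nhds u)"
      by eventually_elim (simp add: soft_trunc_def)
    ultimately show ?thesis using 3 DERIV_cong_ev[OF refl] by (fastforce simp: soft_trunc'_def)
  qed
qed

lemma soft_trunc_tendsto:
  assumes e: "e \<longlonglongrightarrow> 0" "\<And>n. 0 < e n" and u: "0 < u"
  shows "(\<lambda>n. soft_trunc (e n) u) \<longlonglongrightarrow> u" "(\<lambda>n. soft_trunc' (e n) u) \<longlonglongrightarrow> 1"
proof -
  have ev: "eventually (\<lambda>n. e n < u) sequentially" using order_tendstoD(2)[OF e(1) u] .
  have "(\<lambda>n. (u - e n)\<^sup>2 / u) \<longlonglongrightarrow> (u - 0)\<^sup>2 / u" using u by (intro tendsto_intros e) auto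
  then have "(\<lambda>n. (u - e n)\<^sup>2 / u) \<longlonglongrightarrow> u" by (simp add: power2_eq_square)
  then show "(\<lambda>n. soft_trunc (e n) u) \<longlonglongrightarrow> u"
    by (rule Lim_transform_eventually) (use ev in \<open>eventually_elim, simp add: soft_trunc_def\<close>)
  have "(\<lambda>n. 1 - (e n / u)\<^sup>2) \<longlonglongrightarrow> 1 - (0 / u)\<^sup>2" using u by (intro tendsto_intros e) auto
  then have "(\<lambda>n. 1 - (e n / u)\<^sup>2) \<longlonglongrightarrow> 1" by simp
  then show "(\<lambda>n. soft_trunc' (e n) u) \<longlonglongrightarrow> 1"
    by (rule Lim_transform_eventually) (use ev in \<open>eventually_elim, simp add: soft_trunc'_def\<close>)
qed

text \<open>
  Integration by parts for a continuous weight \<open>W\<close> that is differentiable where it is positive.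
  The function \<open>W g\<close> need not be differentiable at the edge of that set, and the derivative of \<open>W\<close> need
  not be bounded there. Cutting the weight off below \<open>\<epsilon>\<close> cures both: the support becomes a compact
  subset of the open set where \<open>W\<close> is positive, so the truncated product has a bounded derivative
  everywhere, and the integral of this derivative is zero. The limit \<open>\<epsilon> \<rightarrow> 0\<close> is dominated.
\<close>

lemma
  fixes W w g g' :: "'a::euclidean_space \<Rightarrow> real"
  defines "D \<equiv> {x. 0 < W x}"
  assumes cont: "continuous_on UNIV W" and nonneg: "\<And>x. 0 \<le> W x" and supp: "\<And>x. R < norm x \<Longrightarrow> W x = 0"
    and dW: "\<And>x. x \<in> D \<Longrightarrow> ((\<lambda>t. W (x + t *\<^sub>R e)) has_real_derivative w x) (at 0)"
    and contw: "continuous_on D w" and intw: "integrable lborel (\<lambda>x. indicator D x * w x)"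
    and gm: "(\<lambda>x. indicator D x * g x) \<in> borel_measurable borel"
    and dg: "\<And>x. x \<in> D \<Longrightarrow> ((\<lambda>t. g (x + t *\<^sub>R e)) has_real_derivative g' x) (at 0)"
    and gb: "\<And>x. x \<in> D \<Longrightarrow> \<bar>g x\<bar> \<le> C" and g'b: "\<And>x. x \<in> D \<Longrightarrow> \<bar>g' x\<bar> \<le> C"
  shows integrable_weight_derivative: "integrable lborel (\<lambda>x. indicator D x * (w x * g x))"
    and integrable_weight_mult: "integrable lborel (\<lambda>x. indicator D x * (W x * g' x))"
    and integration_by_parts_weight:
      "(\<integral>x. indicator D x * (w x * g x) \<partial>lborel) + (\<integral>x. indicator D x * (W x * g' x) \<partial>lborel) = 0"
proof -
  have [measurable]: "W \<in> borel_measurable borel" using cont by (rule borel_measurable_continuous_onI)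
  have D [measurable]: "D \<in> sets borel" unfolding D_def by measurable
  note [measurable] = gm
  have D0: "W x = 0" if "x \<notin> D" for x using that nonneg[of x] by (auto simp: D_def)
  obtain Wm where Wm: "\<And>x. W x \<le> Wm"
  proof -
    have "compact (W ` cball 0 R)" by (intro compact_continuous_image continuous_on_subset[OF cont]) auto
    then obtain B where "\<forall>y\<in>W ` cball 0 R. norm y \<le> B" by (meson bounded_iff compact_imp_bounded)
    then have "\<And>x. norm x \<le> R \<Longrightarrow> W x \<le> B" by force
    then have "W x \<le> max B 0" for x using supp[of x] by (cases "norm x \<le> R") (auto simp: max_def intro: order_trans)
    then show thesis by (rule that)
  qed
  have fin: "emeasure lborel (cball 0 R :: 'a set) < \<infinity>" using emeasure_bounded_finite[of "cball 0 R :: 'a set"] by simp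
  have iW: "integrable lborel W"
  proof (rule integrable_dominated)
    show "integrable lborel (\<lambda>x::'a. Wm * indicator (cball 0 R) x :: real)"
      using fin by (intro integrable_mult_right integrable_real_indicator) auto
    show "norm (W x) \<le> norm (Wm * indicator (cball 0 R) x)" for x
      using supp[of x] nonneg[of x] Wm[of x] by (auto simp: indicator_def)
  qed simp
  show i1: "integrable lborel (\<lambda>x. indicator D x * (w x * g x))"
  proof (rule integrable_dominated)
    show "integrable lborel (\<lambda>x. C * (indicator D x * w x))" using intw by simp
    show "norm (indicator D x * (w x * g x)) \<le> norm (C * (indicator D x * w x))" for x
      using gb[of x] mult_right_mono[OF gb, of x "\<bar>w x\<bar>"] by (auto simp: indicator_def abs_mult mult.commute)
    have "(\<lambda>x. (indicator D x * w x) * (indicator D x * g x)) \<in> borel_measurable lborel"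
      using intw by measurable
    then show "(\<lambda>x. indicator D x * (w x * g x)) \<in> borel_measurable lborel"
      by (rule measurable_cong[THEN iffD1, rotated]) (auto simp: indicator_def)
  qed
  define G where "G x = indicator D x * (w x * g x) + indicator D x * (W x * g' x)" for x
  define F where "F \<epsilon> x = soft_trunc \<epsilon> (W x) * (indicator D x * g x)" for \<epsilon> x
  define F' where "F' \<epsilon> x = indicator D x * (soft_trunc' \<epsilon> (W x) * w x * g x + soft_trunc \<epsilon> (W x) * g' x)" for \<epsilon> x
  have F'b: "\<bar>F' \<epsilon> x\<bar> \<le> C * \<bar>indicator D x * w x\<bar> + C * W x" if "0 < \<epsilon>" for \<epsilon> x
  proof (cases "x \<in> D")
    case True
    note s = soft_trunc_bounds[OF that nonneg[of x]]
    have C0: "0 \<le> C" using gb[OF True] by simp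
    have "\<bar>soft_trunc' \<epsilon> (W x) * w x * g x\<bar> \<le> 1 * \<bar>w x\<bar> * C"
      unfolding abs_mult using s gb[OF True] by (intro mult_mono) auto
    moreover have "\<bar>soft_trunc \<epsilon> (W x) * g' x\<bar> \<le> W x * C"
      unfolding abs_mult using s g'b[OF True] nonneg[of x] by (intro mult_mono) auto
    ultimately show ?thesis using True by (simp add: F'_def mult.commute)
  qed (simp add: F'_def D0)
  have zero: "integrable lborel (F' \<epsilon>) \<and> (\<integral>x. F' \<epsilon> x \<partial>lborel) = 0" if \<epsilon>: "0 < \<epsilon>" for \<epsilon>
  proof -
    define K where "K = {x. \<epsilon> \<le> W x}"
    have "closed K" unfolding K_def by (intro closed_Collect_le continuous_intros cont)
    moreover have "K \<subseteq> cball 0 R"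
    proof
      fix x assume "x \<in> K"
      then have "W x \<noteq> 0" using \<epsilon> by (simp add: K_def)
      then show "x \<in> cball 0 R" using supp[of x] by (simp, linarith)
    qed
    ultimately have cK: "compact K" by (meson bounded_cball bounded_subset compact_eq_bounded_closed)
    have KD: "K \<subseteq> D" using \<epsilon> by (auto simp: K_def D_def)
    have "compact (w ` K)" using cK KD contw by (meson compact_continuous_image continuous_on_subset)
    then obtain B where "\<forall>y\<in>w ` K. norm y \<le> B" by (meson bounded_iff compact_imp_bounded)
    then have B: "\<bar>w x\<bar> \<le> B" if "x \<in> K" for x using that by auto
    have bd: "\<bar>F' \<epsilon> x\<bar> \<le> \<bar>C\<bar> * \<bar>B\<bar> + \<bar>C\<bar> * Wm" for x
    proof (cases "x \<in> K")
      case True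
      then have "x \<in> D" using KD by auto
      have C0: "0 \<le> C" using gb[OF \<open>x \<in> D\<close>] by simp
      have "\<bar>F' \<epsilon> x\<bar> \<le> C * \<bar>w x\<bar> + C * W x" using F'b[OF \<epsilon>, of x] \<open>x \<in> D\<close> by simp
      also have "\<dots> \<le> C * \<bar>B\<bar> + C * Wm" using C0 B[OF True] Wm[of x] by (intro add_mono mult_left_mono) auto
      finally show ?thesis using C0 by simp
    next
      case False
      then have "F' \<epsilon> x = 0" by (simp add: K_def F'_def soft_trunc_def soft_trunc'_def)
      moreover have "0 \<le> Wm" using Wm[of x] nonneg[of x] by simp
      ultimately show ?thesis by simp
    qed
    have der: "((\<lambda>t. F \<epsilon> (x + t *\<^sub>R e)) has_real_derivative F' \<epsilon> x) (at 0)" for x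
    proof (cases "x \<in> D")
      case True
      have oD: "open D" unfolding D_def by (intro open_Collect_less continuous_intros cont)
      have "eventually (\<lambda>t. x + t *\<^sub>R e \<in> D) (nhds 0)"
        using tendsto_line oD True by (rule topological_tendstoD)
      then have ev: "eventually (\<lambda>t. soft_trunc \<epsilon> (W (x + t *\<^sub>R e)) * g (x + t *\<^sub>R e) = F \<epsilon> (x + t *\<^sub>R e)) (nhds 0)"
        by eventually_elim (simp add: F_def)
      have "((\<lambda>t. soft_trunc \<epsilon> (W (x + t *\<^sub>R e))) has_real_derivative soft_trunc' \<epsilon> (W x) * w x) (at 0)"
        using DERIV_chain2[OF _ dW[OF True], of "soft_trunc \<epsilon>" "soft_trunc' \<epsilon> (W x)"] DERIV_soft_trunc[OF \<epsilon>] by simp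
      from DERIV_mult[OF this dg[OF True]]
      have "((\<lambda>t. soft_trunc \<epsilon> (W (x + t *\<^sub>R e)) * g (x + t *\<^sub>R e)) has_real_derivative F' \<epsilon> x) (at 0)"
        using True by (simp add: F'_def algebra_simps)
      then show ?thesis using DERIV_cong_ev[OF refl ev refl] by simp
    next
      case False
      have "((\<lambda>t. W (x + t *\<^sub>R e)) \<longlongrightarrow> W x) (nhds 0)"
        using cont by (intro isCont_tendsto_compose[OF _ tendsto_line]) (simp add: continuous_on_eq_continuous_at)
      then have "eventually (\<lambda>t. W (x + t *\<^sub>R e) < \<epsilon>) (nhds 0)"
        using \<epsilon> D0[OF False] by (intro order_tendstoD(2)) auto
      then have ev: "eventually (\<lambda>t. 0 = F \<epsilon> (x + t *\<^sub>R e)) (nhds 0)"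
        by eventually_elim (simp add: F_def soft_trunc_def)
      have "F' \<epsilon> x = 0" using False by (simp add: F'_def)
      then show ?thesis using DERIV_cong_ev[OF refl ev refl, of 0] by simp
    qed
    have [measurable]: "soft_trunc \<epsilon> \<in> borel_measurable borel" unfolding soft_trunc_def[abs_def] by measurable
    have iF: "integrable lborel (F \<epsilon>)"
    proof (rule integrable_dominated)
      show "integrable lborel (\<lambda>x. \<bar>C\<bar> * W x)" using iW by simp
      show "norm (F \<epsilon> x) \<le> norm (\<bar>C\<bar> * W x)" for x
      proof (cases "x \<in> D")
        case True
        have "\<bar>soft_trunc \<epsilon> (W x) * g x\<bar> \<le> W x * \<bar>C\<bar>"
          unfolding abs_mult using soft_trunc_bounds[OF \<epsilon> nonneg[of x]] gb[OF True] nonneg[of x]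
          by (intro mult_mono) auto
        then show ?thesis using True nonneg[of x] by (simp add: F_def abs_mult mult.commute)
      qed (simp add: F_def)
      show "F \<epsilon> \<in> borel_measurable lborel" unfolding F_def by measurable
    qed
    have sF: "F \<epsilon> x = 0" if "R < norm x" for x using supp[OF that] \<epsilon> by (simp add: F_def soft_trunc_def)
    show ?thesis
      using integrable_directional_derivative[OF iF sF der bd] integral_directional_derivative_eq_0[OF iF sF der bd] by blast
  qed
  define \<epsilon> where "\<epsilon> n = inverse (real (Suc n))" for n
  have \<epsilon>: "0 < \<epsilon> n" "\<epsilon> \<longlonglongrightarrow> 0" for n unfolding \<epsilon>_def using LIMSEQ_inverse_real_of_nat by auto
  have lim: "(\<lambda>n. F' (\<epsilon> n) x) \<longlonglongrightarrow> G x" for x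
  proof (cases "x \<in> D")
    case True
    then have "0 < W x" by (simp add: D_def)
    have "(\<lambda>n. soft_trunc' (\<epsilon> n) (W x) * w x * g x + soft_trunc (\<epsilon> n) (W x) * g' x) \<longlonglongrightarrow> 1 * w x * g x + W x * g' x"
      by (intro tendsto_intros soft_trunc_tendsto \<epsilon> \<open>0 < W x\<close>)
    then show ?thesis using True by (simp add: F'_def G_def)
  qed (simp add: F'_def G_def)
  let ?dom = "\<lambda>x. C * \<bar>indicator D x * w x\<bar> + C * W x"
  have idom: "integrable lborel ?dom" using intw iW by (intro Bochner_Integration.integrable_add integrable_mult_right integrable_abs)
  have mF' [measurable]: "F' (\<epsilon> n) \<in> borel_measurable lborel" for n
    by (rule borel_measurable_integrable) (use zero[OF \<epsilon>(1)] in blast)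
  have mG: "G \<in> borel_measurable lborel"
    by (rule borel_measurable_LIMSEQ_real[OF lim]) (rule mF')
  have iG: "integrable lborel G"
    by (rule integrable_dominated_convergence[of G lborel "\<lambda>n. F' (\<epsilon> n)" ?dom]) (use mG mF' \<epsilon>(1) idom lim F'b in auto)
  have "(\<lambda>n. \<integral>x. F' (\<epsilon> n) x \<partial>lborel) \<longlonglongrightarrow> (\<integral>x. G x \<partial>lborel)"
    by (rule integral_dominated_convergence[of G lborel "\<lambda>n. F' (\<epsilon> n)" ?dom]) (use mG mF' \<epsilon>(1) idom lim F'b in auto)
  then have G0: "(\<integral>x. G x \<partial>lborel) = 0" using zero \<epsilon>(1) by (simp add: LIMSEQ_const_iff)
  have "integrable lborel (\<lambda>x. G x - indicator D x * (w x * g x))" using iG i1 by simp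
  then show i2: "integrable lborel (\<lambda>x. indicator D x * (W x * g' x))" by (simp add: G_def)
  show "(\<integral>x. indicator D x * (w x * g x) \<partial>lborel) + (\<integral>x. indicator D x * (W x * g' x) \<partial>lborel) = 0"
    using G0 i1 i2 unfolding G_def by simp
qed

section \<open>The prior density as a weight\<close>

text \<open>
  Because \<open>\<pi>\<close> vanishes on the boundary of \<open>\<Theta>\<close>, this extension of the prior density by zero is
  continuous on the whole space and positive only in the interior of \<open>\<Theta>\<close>.
\<close>

definition prior_weight :: "(real^'p) set \<Rightarrow> (real^'p \<Rightarrow> real) \<Rightarrow> real^'p \<Rightarrow> real" where
  "prior_weight \<Theta> \<pi> \<theta> = \<pi> \<theta> * indicator \<Theta> \<theta>"

lemma regular_priorD:
  assumes "regular_prior \<Theta> \<nu> \<pi>"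
  shows "prob_space \<nu>" "\<nu> = density lborel (\<lambda>\<theta>. ennreal (prior_weight \<Theta> \<pi> \<theta>))"
    "set_integrable \<nu> \<Theta> (\<lambda>\<theta>. prior_score \<pi> \<theta> $ i * prior_score \<pi> \<theta> $ j)"
  using assms unfolding regular_prior_def prior_weight_def by blast+

lemma prior_weight_nonneg: "regular_prior \<Theta> \<nu> \<pi> \<Longrightarrow> 0 \<le> prior_weight \<Theta> \<pi> \<theta>"
  by (auto simp: regular_prior_def prior_weight_def indicator_def)

lemma prior_weight_pos:
  assumes "regular_prior \<Theta> \<nu> \<pi>" "compact \<Theta>" "0 < prior_weight \<Theta> \<pi> \<theta>"
  shows "\<theta> \<in> interior \<Theta>" "0 < \<pi> \<theta>" "prior_weight \<Theta> \<pi> \<theta> = \<pi> \<theta>"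
proof -
  have "\<theta> \<in> \<Theta>" using assms(3) by (cases "\<theta> \<in> \<Theta>") (auto simp: prior_weight_def)
  then show "0 < \<pi> \<theta>" "prior_weight \<Theta> \<pi> \<theta> = \<pi> \<theta>" using assms(3) by (auto simp: prior_weight_def)
  show "\<theta> \<in> interior \<Theta>"
  proof (rule ccontr)
    assume "\<theta> \<notin> interior \<Theta>"
    then have "\<theta> \<in> frontier \<Theta>" using \<open>\<theta> \<in> \<Theta>\<close> assms(2) by (simp add: frontier_def compact_imp_closed closure_closed)
    then have "\<pi> \<theta> = 0" using assms(1) by (auto simp: regular_prior_def)
    then show False using \<open>0 < \<pi> \<theta>\<close> by simp
  qed
qed

lemma continuous_prior_weight:
  assumes prior: "regular_prior \<Theta> \<nu> \<pi>" and "compact \<Theta>"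
  shows "continuous_on UNIV (prior_weight \<Theta> \<pi>)"
proof -
  have cl: "closed \<Theta>" using assms(2) by (rule compact_imp_closed)
  have "continuous_on \<Theta> \<pi>" using prior by (simp add: regular_prior_def)
  then have 1: "continuous_on \<Theta> (prior_weight \<Theta> \<pi>)"
    by (rule continuous_on_eq) (simp add: prior_weight_def)
  have "prior_weight \<Theta> \<pi> \<theta> = 0" if "\<theta> \<in> closure (- \<Theta>)" for \<theta>
  proof (rule ccontr)
    assume "prior_weight \<Theta> \<pi> \<theta> \<noteq> 0"
    then have "0 < prior_weight \<Theta> \<pi> \<theta>" using prior_weight_nonneg[OF prior, of \<theta>] by simp
    from prior_weight_pos(1)[OF prior assms(2) this] show False using that by (simp add: closure_complement)
  qed
  then have 2: "continuous_on (closure (- \<Theta>)) (prior_weight \<Theta> \<pi>)"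
    by (intro continuous_on_eq[OF continuous_on_const[of _ 0]]) simp
  have "continuous_on (\<Theta> \<union> closure (- \<Theta>)) (prior_weight \<Theta> \<pi>)"
    by (rule continuous_on_closed_Un[OF cl closed_closure 1 2])
  moreover have "\<Theta> \<union> closure (- \<Theta>) = UNIV" using closure_subset[of "- \<Theta>"] by blast
  ultimately show ?thesis by simp
qed

text \<open>
  The gradient of \<open>log \<pi>\<close> is a definite description; existence and uniqueness of the representing vector
  turn it into the logarithmic derivative.
\<close>

lemma prior_score_eq:
  fixes \<pi> :: "real^'p \<Rightarrow> real"
  assumes d: "(\<pi> has_derivative f') (at \<theta>)" and pos: "0 < \<pi> \<theta>"
  shows "f' h = \<pi> \<theta> * (h \<bullet> prior_score \<pi> \<theta>)"
proof -
  define D where "D = (\<Sum>b\<in>Basis. (f' b / \<pi> \<theta>) *\<^sub>R b)"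
  have lin: "linear f'" using d has_derivative_linear by blast
  have D: "f' h / \<pi> \<theta> = h \<bullet> D" for h
  proof -
    have "f' h = f' (\<Sum>b\<in>Basis. (h \<bullet> b) *\<^sub>R b)" by (simp add: euclidean_representation)
    also have "\<dots> = (\<Sum>b\<in>Basis. (h \<bullet> b) * f' b)"
      by (simp add: linear_sum[OF lin] linear_scale[OF lin])
    finally show ?thesis by (simp add: D_def inner_sum_right sum_divide_distrib mult.commute)
  qed
  have "((\<lambda>t. ln (\<pi> t)) has_derivative (\<lambda>h. f' h / \<pi> \<theta>)) (at \<theta>)"
    using has_derivative_ln[OF pos d] by (simp add: divide_inverse)
  then have G: "GDERIV (\<lambda>t. ln (\<pi> t)) \<theta> :> D" by (simp add: gderiv_def D)
  have "gradient (\<lambda>t. ln (\<pi> t)) \<theta> = D"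
    unfolding gradient_def
  proof (rule the_equality)
    show "GDERIV (\<lambda>t. ln (\<pi> t)) \<theta> :> D" by (rule G)
    fix D' assume "GDERIV (\<lambda>t. ln (\<pi> t)) \<theta> :> D'"
    then have "(\<lambda>h. h \<bullet> D') = (\<lambda>h. h \<bullet> D)"
      using G unfolding gderiv_def by (rule has_derivative_unique)
    then have "D' \<bullet> (D' - D) = D \<bullet> (D' - D)" by (metis inner_commute)
    then have "(D' - D) \<bullet> (D' - D) = 0" by (simp add: inner_diff_left)
    then show "D' = D" by simp
  qed
  then show ?thesis using pos D[of h] by (simp add: prior_score_def field_simps)
qed

lemma prior_weight_derivative:
  fixes \<pi> :: "real^'p \<Rightarrow> real"
  assumes prior: "regular_prior \<Theta> \<nu> \<pi>" and "compact \<Theta>"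
  shows "0 < prior_weight \<Theta> \<pi> \<theta> \<Longrightarrow> ((\<lambda>t. prior_weight \<Theta> \<pi> (\<theta> + t *\<^sub>R axis k 1)) has_real_derivative
      prior_weight \<Theta> \<pi> \<theta> * prior_score \<pi> \<theta> $ k) (at 0)"
    and "continuous_on {\<theta>. 0 < prior_weight \<Theta> \<pi> \<theta>} (\<lambda>\<theta>. prior_weight \<Theta> \<pi> \<theta> * prior_score \<pi> \<theta> $ k)"
proof -
  obtain \<pi>' where C: "continuous_on (interior \<Theta>) \<pi>'" 
    "\<And>x. x \<in> interior \<Theta> \<Longrightarrow> (\<pi> has_derivative blinfun_apply (\<pi>' x)) (at x)"
    using prior unfolding regular_prior_def C1_on_def by blast
  have eq: "prior_weight \<Theta> \<pi> \<theta> * prior_score \<pi> \<theta> $ k = blinfun_apply (\<pi>' \<theta>) (axis k 1)"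
    if "0 < prior_weight \<Theta> \<pi> \<theta>" for \<theta>
    using prior_weight_pos[OF prior assms(2) that] C(2) prior_score_eq[of \<pi> "blinfun_apply (\<pi>' \<theta>)" \<theta> "axis k 1"]
    by (simp add: inner_axis')
  show "((\<lambda>t. prior_weight \<Theta> \<pi> (\<theta> + t *\<^sub>R axis k 1)) has_real_derivative
      prior_weight \<Theta> \<pi> \<theta> * prior_score \<pi> \<theta> $ k) (at 0)" if pos: "0 < prior_weight \<Theta> \<pi> \<theta>"
  proof -
    note p = prior_weight_pos[OF prior assms(2) pos]
    show ?thesis unfolding eq[OF pos]
      by (rule DERIV_along_line[OF C(2)[OF p(1)] open_interior p(1)])
         (simp add: prior_weight_def subsetD[OF interior_subset])
  qed
  have "continuous_on {\<theta>. 0 < prior_weight \<Theta> \<pi> \<theta>} (\<lambda>\<theta>. blinfun_apply (\<pi>' \<theta>) (axis k 1))"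
    using prior_weight_pos(1)[OF prior assms(2)] 
    by (intro continuous_intros continuous_on_subset[OF C(1)]) auto
  then show "continuous_on {\<theta>. 0 < prior_weight \<Theta> \<pi> \<theta>} (\<lambda>\<theta>. prior_weight \<Theta> \<pi> \<theta> * prior_score \<pi> \<theta> $ k)"
    by (rule continuous_on_eq) (simp add: eq)
qed

lemma set_integral_prior:
  fixes h :: "real^'p \<Rightarrow> real"
  assumes prior: "regular_prior \<Theta> \<nu> \<pi>" and "compact \<Theta>" and h: "set_integrable \<nu> \<Theta> h"
  shows "integrable lborel (\<lambda>\<theta>. prior_weight \<Theta> \<pi> \<theta> * h \<theta>)"
    and "(LINT \<theta>:\<Theta>|\<nu>. h \<theta>) = (\<integral>\<theta>. prior_weight \<Theta> \<pi> \<theta> * h \<theta> \<partial>lborel)"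
proof -
  note \<nu> = regular_priorD(2)[OF prior]
  have [measurable]: "prior_weight \<Theta> \<pi> \<in> borel_measurable borel"
    by (rule borel_measurable_continuous_onI[OF continuous_prior_weight[OF prior assms(2)]])
  have i: "integrable \<nu> (\<lambda>\<theta>. indicator \<Theta> \<theta> *\<^sub>R h \<theta>)" using h by (simp add: set_integrable_def)
  then have m: "(\<lambda>\<theta>. indicator \<Theta> \<theta> *\<^sub>R h \<theta>) \<in> borel_measurable lborel" unfolding \<nu> by auto
  have e: "(\<lambda>\<theta>. prior_weight \<Theta> \<pi> \<theta> *\<^sub>R (indicator \<Theta> \<theta> *\<^sub>R h \<theta>)) = (\<lambda>\<theta>. prior_weight \<Theta> \<pi> \<theta> * h \<theta>)"
    by (auto simp: prior_weight_def indicator_def)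
  have "integrable lborel (\<lambda>\<theta>. prior_weight \<Theta> \<pi> \<theta> *\<^sub>R (indicator \<Theta> \<theta> *\<^sub>R h \<theta>))"
    using i prior_weight_nonneg[OF prior] unfolding \<nu> by (subst (asm) integrable_density[OF m]) simp_all
  then show "integrable lborel (\<lambda>\<theta>. prior_weight \<Theta> \<pi> \<theta> * h \<theta>)" unfolding e .
  have "(\<integral>\<theta>. indicator \<Theta> \<theta> *\<^sub>R h \<theta> \<partial>\<nu>) = (\<integral>\<theta>. prior_weight \<Theta> \<pi> \<theta> *\<^sub>R (indicator \<Theta> \<theta> *\<^sub>R h \<theta>) \<partial>lborel)"
    unfolding \<nu> using prior_weight_nonneg[OF prior] by (subst integral_density[OF m]) simp_all
  then show "(LINT \<theta>:\<Theta>|\<nu>. h \<theta>) = (\<integral>\<theta>. prior_weight \<Theta> \<pi> \<theta> * h \<theta> \<partial>lborel)"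
    unfolding e set_lebesgue_integral_def .
qed

lemma prior_weight_integral:
  assumes prior: "regular_prior \<Theta> \<nu> \<pi>" and "compact \<Theta>"
  shows "integrable lborel (prior_weight \<Theta> \<pi>)" "(\<integral>\<theta>. prior_weight \<Theta> \<pi> \<theta> \<partial>lborel) = 1"
proof -
  interpret \<nu>: prob_space \<nu> by (rule regular_priorD(1)[OF prior])
  note \<nu> = regular_priorD(2)[OF prior]
  have [measurable]: "prior_weight \<Theta> \<pi> \<in> borel_measurable borel"
    by (rule borel_measurable_continuous_onI[OF continuous_prior_weight[OF prior assms(2)]])
  have i: "integrable \<nu> (\<lambda>_. 1::real)" by simp
  have "integrable lborel (\<lambda>\<theta>. prior_weight \<Theta> \<pi> \<theta> *\<^sub>R (1::real))"
    using i prior_weight_nonneg[OF prior] unfolding \<nu> by (subst (asm) integrable_density) simp_all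
  then show "integrable lborel (prior_weight \<Theta> \<pi>)" by simp
  have "1 = (\<integral>\<theta>. (1::real) \<partial>\<nu>)" by (simp add: \<nu>.prob_space)
  also have "\<dots> = (\<integral>\<theta>. prior_weight \<Theta> \<pi> \<theta> *\<^sub>R (1::real) \<partial>lborel)"
    unfolding \<nu> using prior_weight_nonneg[OF prior] by (subst integral_density) simp_all
  finally show "(\<integral>\<theta>. prior_weight \<Theta> \<pi> \<theta> \<partial>lborel) = 1" by simp
qed

lemma prior_score_integrable:
  fixes \<pi> :: "real^'p \<Rightarrow> real"
  assumes prior: "regular_prior \<Theta> \<nu> \<pi>" and "compact \<Theta>"
  shows "integrable lborel (\<lambda>\<theta>. prior_weight \<Theta> \<pi> \<theta> * (norm (prior_score \<pi> \<theta>))\<^sup>2)"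
    and "trace (prior_fisher_info \<Theta> \<nu> \<pi>) = (\<integral>\<theta>. prior_weight \<Theta> \<pi> \<theta> * (norm (prior_score \<pi> \<theta>))\<^sup>2 \<partial>lborel)"
    and "integrable lborel (\<lambda>\<theta>. prior_weight \<Theta> \<pi> \<theta> * prior_score \<pi> \<theta> $ k)"
proof -
  let ?W = "prior_weight \<Theta> \<pi>"
  note i = set_integral_prior[OF prior assms(2) regular_priorD(3)[OF prior]]
  have e: "?W \<theta> * (norm (prior_score \<pi> \<theta>))\<^sup>2 = (\<Sum>i\<in>UNIV. ?W \<theta> * (prior_score \<pi> \<theta> $ i * prior_score \<pi> \<theta> $ i))" for \<theta>
    by (simp add: power2_norm_eq_inner inner_vec_def sum_distrib_left)
  show "integrable lborel (\<lambda>\<theta>. ?W \<theta> * (norm (prior_score \<pi> \<theta>))\<^sup>2)"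
    unfolding e using i(1) by (intro Bochner_Integration.integrable_sum)
  show "trace (prior_fisher_info \<Theta> \<nu> \<pi>) = (\<integral>\<theta>. ?W \<theta> * (norm (prior_score \<pi> \<theta>))\<^sup>2 \<partial>lborel)"
    unfolding e trace_def prior_fisher_info_def using i
    by (subst Bochner_Integration.integral_sum) auto
  have m: "(\<lambda>\<theta>. ?W \<theta> * prior_score \<pi> \<theta> $ k) \<in> borel_measurable lborel"
    using borel_measurable_weight_mult[OF continuous_prior_weight[OF prior assms(2)] prior_weight_nonneg[OF prior]
      prior_weight_derivative(2)[OF prior assms(2)]] by simp
  show "integrable lborel (\<lambda>\<theta>. ?W \<theta> * prior_score \<pi> \<theta> $ k)"
  proof (rule integrable_dominated[OF _ m])
    show "integrable lborel (\<lambda>\<theta>. ?W \<theta> + ?W \<theta> * (prior_score \<pi> \<theta> $ k * prior_score \<pi> \<theta> $ k))"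
      using prior_weight_integral(1)[OF prior assms(2)] i(1) by simp
    fix \<theta>
    have "0 \<le> (1 - \<bar>prior_score \<pi> \<theta> $ k\<bar>)\<^sup>2" by simp
    then have "\<bar>prior_score \<pi> \<theta> $ k\<bar> * 2 \<le> 1 + (prior_score \<pi> \<theta> $ k)\<^sup>2"
      by (simp add: power2_diff)
    then have "\<bar>prior_score \<pi> \<theta> $ k\<bar> \<le> 1 + prior_score \<pi> \<theta> $ k * prior_score \<pi> \<theta> $ k"
      unfolding power2_eq_square by linarith
    from mult_left_mono[OF this prior_weight_nonneg[OF prior, of \<theta>]]
    show "norm (?W \<theta> * prior_score \<pi> \<theta> $ k) \<le> norm (?W \<theta> + ?W \<theta> * (prior_score \<pi> \<theta> $ k * prior_score \<pi> \<theta> $ k))"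
      using prior_weight_nonneg[OF prior, of \<theta>] by (simp add: abs_mult distrib_left)
  qed
qed

section \<open>Cramer-Rao bounds for a clipped private estimator\<close>

lemma inner_le_weighted_squares:
  fixes a b :: "'v::real_inner"
  assumes t: "0 < t"
  shows "a \<bullet> b \<le> (t * (norm a)\<^sup>2 + (norm b)\<^sup>2 / t) / 2"
proof -
  have "0 \<le> (norm (t *\<^sub>R a - b))\<^sup>2" by simp
  also have "(norm (t *\<^sub>R a - b))\<^sup>2 = t * (t * (norm a)\<^sup>2) - t * (2 * (a \<bullet> b)) + (norm b)\<^sup>2"
    unfolding power2_norm_eq_inner by (simp add: inner_diff inner_commute[of b a] right_diff_distrib)
  finally have "t * (2 * (a \<bullet> b)) \<le> t * (t * (norm a)\<^sup>2 + (norm b)\<^sup>2 / t)"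
    using t by (simp add: distrib_left)
  then show ?thesis using t by simp
qed

text \<open>
  The estimator is the output of \<open>A\<close> passed through a bounded map \<open>\<tau>\<close>, so that its conditional mean
  given the data is a bounded statistic to which differentiation under the integral applies.
\<close>

locale clipped_private_estimator =
  fixes \<Theta> :: "(real^'p) set" and \<mu> :: "'x measure" and P :: "real^'p \<Rightarrow> 'x measure"
    and p :: "real^'p \<Rightarrow> 'x \<Rightarrow> real" and s :: "real^'p \<Rightarrow> 'x \<Rightarrow> real^'p"
    and \<rho> :: real and n :: nat and A :: "(nat \<Rightarrow> 'x) \<Rightarrow> (real^'p) measure"
    and \<tau> :: "real^'p \<Rightarrow> real^'p" and R :: real
  assumes compact: "compact \<Theta>" and model: "regular_model \<Theta> \<mu> P p s"
    and zcdp: "zCDP \<rho> n \<mu> borel A" and \<rho>: "0 \<le> \<rho>"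
    and \<tau> [measurable]: "\<tau> \<in> borel_measurable borel" and \<tau>_le: "\<And>t. norm (\<tau> t) \<le> R"
begin

abbreviation sample :: "real^'p \<Rightarrow> (nat \<Rightarrow> 'x) measure" where
  "sample \<theta> \<equiv> PiM {..<n} (\<lambda>_. P \<theta>)"

abbreviation data :: "(nat \<Rightarrow> 'x) measure" where
  "data \<equiv> PiM {..<n} (\<lambda>_. \<mu>)"

definition cond_mean :: "(nat \<Rightarrow> 'x) \<Rightarrow> real^'p" where
  "cond_mean S = (\<integral>t. \<tau> t \<partial>A S)"

definition mean :: "real^'p \<Rightarrow> real^'p" where
  "mean \<theta> = (\<integral>S. cond_mean S \<partial>sample \<theta>)"

abbreviation deviation :: "real^'p \<Rightarrow> (nat \<Rightarrow> 'x) \<Rightarrow> real^'p" where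
  "deviation \<theta> S \<equiv> \<integral>t. \<tau> t - mean \<theta> \<partial>A S"

definition score :: "real^'p \<Rightarrow> (nat \<Rightarrow> 'x) \<Rightarrow> real^'p" where
  "score \<theta> S = (\<Sum>i<n. s \<theta> (S i))"

text \<open>
  By \<open>mean_has_derivative\<close> and \<open>inner_score_eq\<close>, this is the divergence of the vector field \<open>mean\<close> in
  the interior of \<open>\<Theta>\<close>.
\<close>

definition div_mean :: "real^'p \<Rightarrow> real" where
  "div_mean \<theta> = (\<integral>S. cond_mean S \<bullet> score \<theta> S \<partial>sample \<theta>)"

definition spread :: "real^'p \<Rightarrow> real^'p \<Rightarrow> real" where
  "spread \<theta> c = (\<integral>S. (\<integral>t. (norm (\<tau> t - c))\<^sup>2 \<partial>A S) \<partial>sample \<theta>)"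

lemma R_nonneg: "0 \<le> R" using \<tau>_le[of 0] norm_ge_zero order_trans by blast

lemma A_kernel [measurable]: "A \<in> data \<rightarrow>\<^sub>M subprob_algebra borel"
  using zcdp measurable_prob_algebraD unfolding zCDP_def by blast

lemma A_prob:
  assumes "S \<in> space data"
  shows "prob_space (A S)" "sets (A S) = sets borel" "space (A S) = UNIV"
proof -
  have "A \<in> data \<rightarrow>\<^sub>M prob_algebra borel" using zcdp unfolding zCDP_def by blast
  from measurable_space[OF this assms] show "prob_space (A S)" "sets (A S) = sets borel"
    by (auto simp: space_prob_algebra)
  from sets_eq_imp_space_eq[OF this(2)] show "space (A S) = UNIV" by simp
qed

lemma A_integral_bounded:
  fixes f :: "real^'p \<Rightarrow> 'b::{banach, second_countable_topology}"
  assumes S: "S \<in> space data" and f: "f \<in> borel_measurable borel" and b: "\<And>t. norm (f t) \<le> B"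
  shows "integrable (A S) f" "norm (\<integral>t. f t \<partial>A S) \<le> B"
proof -
  interpret prob_space "A S" by (rule A_prob[OF S])
  have "f \<in> borel_measurable (A S)" using f A_prob(2)[OF S] by (simp cong: measurable_cong_sets)
  then show "integrable (A S) f" "norm (\<integral>t. f t \<partial>A S) \<le> B"
    using b by (auto intro: integrable_bounded norm_integral_le_const)
qed

lemma sample_prob:
  assumes "\<theta> \<in> \<Theta>"
  shows "prob_space (sample \<theta>)" "sets (sample \<theta>) = sets data" "space (sample \<theta>) = space data"
proof -
  show "prob_space (sample \<theta>)" using regular_model_density(1)[OF model assms] by (intro prob_space_PiM)
  show "sets (sample \<theta>) = sets data" using regular_model_density(5)[OF model assms] by (intro sets_PiM_cong) auto
  then show "space (sample \<theta>) = space data" by (rule sets_eq_imp_space_eq)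
qed

lemma sample_integral_bounded:
  fixes f :: "_ \<Rightarrow> 'b::{banach, second_countable_topology}"
  assumes \<theta>: "\<theta> \<in> \<Theta>" and f: "f \<in> borel_measurable data" and b: "\<And>S. S \<in> space data \<Longrightarrow> norm (f S) \<le> B"
  shows "integrable (sample \<theta>) f" "norm (\<integral>S. f S \<partial>sample \<theta>) \<le> B"
proof -
  interpret prob_space "sample \<theta>" by (rule sample_prob[OF \<theta>])
  have "f \<in> borel_measurable (sample \<theta>)" using f sample_prob(2)[OF \<theta>] by (simp cong: measurable_cong_sets)
  then show "integrable (sample \<theta>) f" "norm (\<integral>S. f S \<partial>sample \<theta>) \<le> B"
    using b sample_prob(3)[OF \<theta>] by (auto intro: integrable_bounded norm_integral_le_const)
qed

lemma cond_mean_measurable [measurable]: "cond_mean \<in> borel_measurable data"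
  unfolding cond_mean_def by measurable

lemma cond_mean_le: "S \<in> space data \<Longrightarrow> norm (cond_mean S) \<le> R"
  unfolding cond_mean_def by (rule A_integral_bounded) (auto simp: \<tau>_le)

lemma integrable_cond_mean: "\<theta> \<in> \<Theta> \<Longrightarrow> integrable (sample \<theta>) cond_mean"
  by (rule sample_integral_bounded) (auto intro: cond_mean_le)

lemma mean_le: "\<theta> \<in> \<Theta> \<Longrightarrow> norm (mean \<theta>) \<le> R"
  unfolding mean_def by (rule sample_integral_bounded) (auto intro: cond_mean_le)

lemma mean_component: "\<theta> \<in> \<Theta> \<Longrightarrow> mean \<theta> $ k = (\<integral>S. cond_mean S $ k \<partial>sample \<theta>)"
  using integral_inner_left[of "axis k 1" "sample \<theta>" cond_mean] integrable_cond_mean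
  by (simp add: mean_def inner_axis)

lemma score_tv_differentiable:
  "\<theta> \<in> interior \<Theta> \<Longrightarrow> tv_differentiable data sample \<theta> (score \<theta>)"
  unfolding score_def by (intro tv_differentiable_PiM regular_model_tv_differentiable[OF model]) auto

lemma integrable_score_component:
  assumes "\<theta> \<in> \<Theta>" "i < n"
  shows "integrable (sample \<theta>) (\<lambda>S. s \<theta> (S i))"
  using assms regular_model_density(1)[OF model] regular_model_integrable_score[OF model]
  by (intro integrable_PiM_component) auto

lemma integrable_score: "\<theta> \<in> \<Theta> \<Longrightarrow> integrable (sample \<theta>) (score \<theta>)"
  unfolding score_def using integrable_score_component by (intro Bochner_Integration.integrable_sum) auto

lemma mean_has_derivative:
  assumes \<theta>: "\<theta> \<in> interior \<Theta>"
  shows "((\<lambda>\<theta>'. \<integral>S. cond_mean S $ k \<partial>sample \<theta>') has_derivative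
    (\<lambda>h. \<integral>S. cond_mean S $ k * (h \<bullet> score \<theta> S) \<partial>sample \<theta>)) (at \<theta>)"
  using order_trans[OF component_le_norm_cart cond_mean_le]
  by (intro tv_differentiable_has_derivative[OF score_tv_differentiable[OF \<theta>]]) auto

lemma integral_score_norm_le:
  assumes \<theta>: "\<theta> \<in> \<Theta>" and B: "(\<integral>x. norm (s \<theta> x) \<partial>P \<theta>) \<le> B"
  shows "(\<integral>S. norm (score \<theta> S) \<partial>sample \<theta>) \<le> real n * B"
proof -
  note c = integrable_score_component[OF \<theta>]
  have "(\<integral>S. norm (score \<theta> S) \<partial>sample \<theta>) \<le> (\<integral>S. (\<Sum>i<n. norm (s \<theta> (S i))) \<partial>sample \<theta>)"
    unfolding score_def using c
    by (intro integral_mono integrable_norm Bochner_Integration.integrable_sum norm_sum) auto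
  also have "\<dots> = (\<Sum>i<n. \<integral>S. norm (s \<theta> (S i)) \<partial>sample \<theta>)"
    using c by (intro Bochner_Integration.integral_sum integrable_norm) auto
  also have "\<dots> = (\<Sum>i<n. \<integral>x. norm (s \<theta> x) \<partial>P \<theta>)"
    using regular_model_density(1)[OF model \<theta>] regular_model_integrable_score[OF model \<theta>]
    by (intro sum.cong integrable_PiM_component(2) integrable_norm) auto
  also have "\<dots> \<le> real n * B" using B by (simp add: mult_left_mono)
  finally show ?thesis .
qed

lemma inner_score_eq:
  assumes \<theta>: "\<theta> \<in> \<Theta>"
  shows "integrable (sample \<theta>) (\<lambda>S. cond_mean S $ k * (axis k 1 \<bullet> score \<theta> S))"
    and "div_mean \<theta> = (\<Sum>k\<in>UNIV. \<integral>S. cond_mean S $ k * (axis k 1 \<bullet> score \<theta> S) \<partial>sample \<theta>)"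
proof -
  have i: "integrable (sample \<theta>) (\<lambda>S. cond_mean S $ k * (axis k 1 \<bullet> score \<theta> S))" for k
  proof (rule abs_integral_mult_score_le(1)[OF integrable_score[OF \<theta>], where B=R])
    show "(\<lambda>S. cond_mean S $ k) \<in> borel_measurable (sample \<theta>)"
      using sample_prob(2)[OF \<theta>] cond_mean_measurable by (auto cong: measurable_cong_sets)
    show "\<bar>cond_mean S $ k\<bar> \<le> R" if "S \<in> space (sample \<theta>)" for S
      using order_trans[OF component_le_norm_cart cond_mean_le] that sample_prob(3)[OF \<theta>] by auto
  qed
  then show "integrable (sample \<theta>) (\<lambda>S. cond_mean S $ k * (axis k 1 \<bullet> score \<theta> S))" .
  show "div_mean \<theta> = (\<Sum>k\<in>UNIV. \<integral>S. cond_mean S $ k * (axis k 1 \<bullet> score \<theta> S) \<partial>sample \<theta>)"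
  proof -
    have "cond_mean S \<bullet> score \<theta> S = (\<Sum>k\<in>UNIV. cond_mean S $ k * (axis k 1 \<bullet> score \<theta> S))" for S
      by (simp add: inner_vec_def[of "cond_mean S"] inner_axis')
    then show ?thesis unfolding div_mean_def using i by simp
  qed
qed

lemma centered:
  assumes \<theta>: "\<theta> \<in> \<Theta>" and S: "S \<in> space data"
  shows "(\<integral>t. \<tau> t - c \<partial>A S) = cond_mean S - c"
proof -
  interpret prob_space "A S" by (rule A_prob[OF S])
  show ?thesis
    using A_integral_bounded(1)[OF S \<tau> \<tau>_le] by (simp add: cond_mean_def prob_space)
qed

lemma norm_centered_le: "norm (\<tau> t - c) \<le> R + norm c"
  using norm_triangle_ineq4[of "\<tau> t" c] \<tau>_le[of t] by simp

lemma norm_centered_sq_le: "norm ((norm (\<tau> t - c))\<^sup>2) \<le> (R + norm c)\<^sup>2"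
  using power_mono[OF norm_centered_le norm_ge_zero, of t c 2] by simp

lemma inner_spread_measurable [measurable]:
  "(\<lambda>S. \<integral>t. (norm (\<tau> t - c))\<^sup>2 \<partial>A S) \<in> borel_measurable data"
  by (rule measurable_compose[OF A_kernel integral_measurable_subprob_algebra]) measurable

lemma inner_spread:
  assumes S: "S \<in> space data"
  shows "integrable (A S) (\<lambda>t. (norm (\<tau> t - c))\<^sup>2)" "norm (\<integral>t. (norm (\<tau> t - c))\<^sup>2 \<partial>A S) \<le> (R + norm c)\<^sup>2"
proof -
  have m: "(\<lambda>t. (norm (\<tau> t - c))\<^sup>2) \<in> borel_measurable borel" by measurable
  show "integrable (A S) (\<lambda>t. (norm (\<tau> t - c))\<^sup>2)" "norm (\<integral>t. (norm (\<tau> t - c))\<^sup>2 \<partial>A S) \<le> (R + norm c)\<^sup>2"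
    by (rule A_integral_bounded[OF S m norm_centered_sq_le])+
qed

lemma integrable_spread:
  assumes \<theta>: "\<theta> \<in> \<Theta>"
  shows "integrable (sample \<theta>) (\<lambda>S. \<integral>t. (norm (\<tau> t - c))\<^sup>2 \<partial>A S)" "\<bar>spread \<theta> c\<bar> \<le> (R + norm c)\<^sup>2"
proof -
  note b = sample_integral_bounded[OF \<theta> inner_spread_measurable inner_spread(2)]
  show "integrable (sample \<theta>) (\<lambda>S. \<integral>t. (norm (\<tau> t - c))\<^sup>2 \<partial>A S)" by (rule b(1))
  show "\<bar>spread \<theta> c\<bar> \<le> (R + norm c)\<^sup>2" using b(2)[of c] by (simp only: spread_def real_norm_def)
qed

lemma spread_expand:
  assumes \<theta>: "\<theta> \<in> \<Theta>"
  shows "spread \<theta> c = spread \<theta> 0 - 2 * (mean \<theta> \<bullet> c) + (norm c)\<^sup>2"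
proof -
  interpret prob_space "sample \<theta>" by (rule sample_prob[OF \<theta>])
  have "spread \<theta> c = (\<integral>S. (\<integral>t. (norm (\<tau> t - 0))\<^sup>2 \<partial>A S) - 2 * (cond_mean S \<bullet> c) + (norm c)\<^sup>2 \<partial>sample \<theta>)"
    unfolding spread_def
  proof (intro Bochner_Integration.integral_cong refl)
    fix S assume "S \<in> space (sample \<theta>)"
    then have S: "S \<in> space data" using sample_prob(3)[OF \<theta>] by simp
    interpret A: prob_space "A S" by (rule A_prob[OF S])
    have i: "integrable (A S) \<tau>" by (rule A_integral_bounded(1)[OF S \<tau> \<tau>_le])
    have e: "(norm (\<tau> t - c))\<^sup>2 = (norm (\<tau> t - 0))\<^sup>2 - 2 * (\<tau> t \<bullet> c) + (norm c)\<^sup>2" for t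
      by (simp add: power2_norm_eq_inner inner_diff inner_commute algebra_simps)
    show "(\<integral>t. (norm (\<tau> t - c))\<^sup>2 \<partial>A S) = (\<integral>t. (norm (\<tau> t - 0))\<^sup>2 \<partial>A S) - 2 * (cond_mean S \<bullet> c) + (norm c)\<^sup>2"
      unfolding e cond_mean_def using inner_spread(1)[OF S, of 0] i by (simp add: A.prob_space)
  qed
  also have "\<dots> = spread \<theta> 0 - 2 * (mean \<theta> \<bullet> c) + (norm c)\<^sup>2"
    unfolding spread_def mean_def
    using integrable_spread(1)[OF \<theta>, of 0] integrable_cond_mean[OF \<theta>] by (simp add: prob_space)
  finally show ?thesis .
qed

lemma spread_bias_variance:
  assumes \<theta>: "\<theta> \<in> \<Theta>"
  shows "spread \<theta> c = spread \<theta> (mean \<theta>) + (norm (mean \<theta> - c))\<^sup>2"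
  unfolding spread_expand[OF \<theta>, of c] spread_expand[OF \<theta>, of "mean \<theta>"]
  by (simp add: power2_norm_eq_inner inner_diff inner_commute algebra_simps)

lemma score_mean_zero:
  assumes \<theta>: "\<theta> \<in> interior \<Theta>"
  shows "(\<integral>x. s \<theta> x \<partial>P \<theta>) = 0"
  using model \<theta> unfolding regular_model_def by blast

text \<open>
  Centring at the mean changes nothing because each score has mean zero; it replaces the risk by the
  spread about the mean in the bounds below.
\<close>

lemma div_mean_centered:
  assumes \<theta>: "\<theta> \<in> interior \<Theta>"
  shows "\<And>i. i < n \<Longrightarrow> integrable (sample \<theta>) (\<lambda>S. deviation \<theta> S \<bullet> s \<theta> (S i))"
    and "div_mean \<theta> = (\<Sum>i<n. \<integral>S. deviation \<theta> S \<bullet> s \<theta> (S i) \<partial>sample \<theta>)"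
proof -
  have \<theta>': "\<theta> \<in> \<Theta>" using \<theta> interior_subset by auto
  have ic: "integrable (sample \<theta>) (\<lambda>S. cond_mean S \<bullet> s \<theta> (S i))" if "i < n" for i
  proof (rule integrable_inner_bounded[OF integrable_score_component[OF \<theta>' that], where B=R])
    show "cond_mean \<in> borel_measurable (sample \<theta>)" using integrable_cond_mean[OF \<theta>'] by auto
  qed (simp add: sample_prob(3)[OF \<theta>'] cond_mean_le)
  have im: "integrable (sample \<theta>) (\<lambda>S. mean \<theta> \<bullet> s \<theta> (S i))"
    and m0: "(\<integral>S. mean \<theta> \<bullet> s \<theta> (S i) \<partial>sample \<theta>) = 0" if "i < n" for i
  proof -
    have "(\<integral>S. s \<theta> (S i) \<partial>sample \<theta>) = 0"
      using integrable_PiM_component(2)[of "P \<theta>" i "{..<n}" "s \<theta>"] that regular_model_density(1)[OF model \<theta>']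
        regular_model_integrable_score(1)[OF model \<theta>'] score_mean_zero[OF \<theta>] by simp
    then show "(\<integral>S. mean \<theta> \<bullet> s \<theta> (S i) \<partial>sample \<theta>) = 0"
      using integrable_score_component[OF \<theta>' that] by simp
    show "integrable (sample \<theta>) (\<lambda>S. mean \<theta> \<bullet> s \<theta> (S i))"
      using integrable_score_component[OF \<theta>' that] by simp
  qed
  have eq: "deviation \<theta> S \<bullet> v = cond_mean S \<bullet> v - mean \<theta> \<bullet> v" if "S \<in> space (sample \<theta>)" for S v
    using that sample_prob(3)[OF \<theta>'] centered[OF \<theta>'] by (simp add: inner_diff_left)
  show "integrable (sample \<theta>) (\<lambda>S. deviation \<theta> S \<bullet> s \<theta> (S i))" if "i < n" for i
    using Bochner_Integration.integrable_diff[OF ic[OF that] im[OF that]]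
    by (rule Bochner_Integration.integrable_cong[THEN iffD1, rotated -1]) (simp_all add: eq)
  have "div_mean \<theta> = (\<Sum>i<n. \<integral>S. cond_mean S \<bullet> s \<theta> (S i) \<partial>sample \<theta>)"
    unfolding div_mean_def score_def inner_sum_right
    using ic by (intro Bochner_Integration.integral_sum) auto
  also have "\<dots> = (\<Sum>i<n. \<integral>S. deviation \<theta> S \<bullet> s \<theta> (S i) \<partial>sample \<theta>)"
  proof (intro sum.cong refl)
    fix i assume "i \<in> {..<n}"
    then have i: "i < n" by simp
    have "(\<integral>S. deviation \<theta> S \<bullet> s \<theta> (S i) \<partial>sample \<theta>)
      = (\<integral>S. cond_mean S \<bullet> s \<theta> (S i) - mean \<theta> \<bullet> s \<theta> (S i) \<partial>sample \<theta>)"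
      by (intro Bochner_Integration.integral_cong refl eq)
    then show "(\<integral>S. cond_mean S \<bullet> s \<theta> (S i) \<partial>sample \<theta>) = (\<integral>S. deviation \<theta> S \<bullet> s \<theta> (S i) \<partial>sample \<theta>)"
      using ic[OF i] im[OF i] m0[OF i] by simp
  qed
  finally show "div_mean \<theta> = (\<Sum>i<n. \<integral>S. deviation \<theta> S \<bullet> s \<theta> (S i) \<partial>sample \<theta>)" .
qed

text \<open>
  Each of the \<open>n\<close> correlations is bounded by privacy with parameter \<open>u = t / (n L)\<close>, where \<open>L\<close> is the
  spectral norm of the information; this choice makes the sum of the first terms \<open>t V\<close>. As \<open>L\<close> may be
  zero, the bound is proved for \<open>L + \<epsilon>\<close> and then \<open>\<epsilon>\<close> tends to zero.
\<close>

lemma div_mean_le_private: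
  assumes \<theta>: "\<theta> \<in> interior \<Theta>" and t: "0 < t"
  shows "div_mean \<theta> \<le> (t * spread \<theta> (mean \<theta>)
    + (exp (2 * \<rho>) - 1) * (real n)\<^sup>2 * spectral_norm (fisher_info (P \<theta>) (s \<theta>)) / t) / 2"
proof (cases "n = 0")
  case True
  have \<theta>': "\<theta> \<in> \<Theta>" using \<theta> interior_subset by auto
  have "0 \<le> spread \<theta> (mean \<theta>)" by (simp add: spread_def)
  then show ?thesis using True t unfolding div_mean_centered(2)[OF \<theta>] by simp
next
  case False
  then have n: "0 < n" by simp
  have \<theta>': "\<theta> \<in> \<Theta>" using \<theta> interior_subset by auto
  note D = regular_model_density[OF model \<theta>']
  define \<kappa> where "\<kappa> = exp (2 * \<rho>) - 1"
  have \<kappa>: "0 \<le> \<kappa>" using \<rho> by (simp add: \<kappa>_def)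
  define L where "L = spectral_norm (fisher_info (P \<theta>) (s \<theta>))"
  define V where "V = spread \<theta> (mean \<theta>)"
  have sm: "s \<theta> \<in> borel_measurable (P \<theta>)" using D(5,7) by (simp cong: measurable_cong_sets)
  have s2: "integrable (P \<theta>) (\<lambda>x. (norm (s \<theta> x))\<^sup>2)" by (rule regular_model_score_square_integrable[OF model \<theta>])
  have each: "div_mean \<theta> \<le> (t * V + \<kappa> * (real n)\<^sup>2 * (L + \<epsilon>) / t) / 2" if \<epsilon>: "0 < \<epsilon>" for \<epsilon>
  proof -
    define L' where "L' = L + \<epsilon>"
    have L': "0 < L'" using \<epsilon> spectral_norm_nonneg[of "fisher_info (P \<theta>) (s \<theta>)"] by (simp add: L'_def L_def add_nonneg_pos)
    define u where "u = t / (real n * L')"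
    have u: "0 < u" using t n L' by (simp add: u_def)
    have q: "(\<integral>x. (v \<bullet> s \<theta> x)\<^sup>2 \<partial>P \<theta>) \<le> L' * (norm v)\<^sup>2" for v
    proof -
      have "(\<integral>x. (v \<bullet> s \<theta> x)\<^sup>2 \<partial>P \<theta>) \<le> L * (norm v)\<^sup>2"
        unfolding L_def by (rule fisher_info_quadratic_le[OF sm s2])
      also have "\<dots> \<le> L' * (norm v)\<^sup>2" using \<epsilon> by (intro mult_right_mono) (auto simp: L'_def)
      finally show ?thesis .
    qed
    have "(\<integral>S. deviation \<theta> S \<bullet> s \<theta> (S i) \<partial>sample \<theta>) \<le> (u * L' * V + \<kappa> / u) / 2" if "i < n" for i
      unfolding V_def spread_def \<kappa>_def
      by (rule inner_integral_le_zCDP_coordinate[OF zcdp \<rho> D(1,5) that u _ _ _ score_mean_zero[OF \<theta>] s2 q, where B="R + norm (mean \<theta>)"])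
         (auto simp: norm_centered_le regular_model_integrable_score(1)[OF model \<theta>'])
    then have "div_mean \<theta> \<le> (\<Sum>i<n. (u * L' * V + \<kappa> / u) / 2)"
      unfolding div_mean_centered(2)[OF \<theta>] by (intro sum_mono) auto
    also have "\<dots> = (t * V + \<kappa> * (real n)\<^sup>2 * L' / t) / 2"
      using t n L' by (simp add: u_def field_simps power2_eq_square)
    finally show ?thesis by (simp add: L'_def)
  qed
  have "((\<lambda>\<epsilon>. (t * V + \<kappa> * (real n)\<^sup>2 * (L + \<epsilon>) / t) / 2) \<longlongrightarrow> (t * V + \<kappa> * (real n)\<^sup>2 * (L + 0) / t) / 2) (at_right 0)"
    using t by (intro tendsto_intros) auto
  moreover have "\<forall>\<^sub>F \<epsilon> in at_right 0. div_mean \<theta> \<le> (t * V + \<kappa> * (real n)\<^sup>2 * (L + \<epsilon>) / t) / 2"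
    using eventually_at_right_less[of "0::real"] by eventually_elim (rule each)
  ultimately have "div_mean \<theta> \<le> (t * V + \<kappa> * (real n)\<^sup>2 * (L + 0) / t) / 2"
    by (rule tendsto_lowerbound) simp
  then show ?thesis by (simp add: V_def L_def \<kappa>_def)
qed

text \<open>
  The classical bound, from the second moment of the score of the whole sample.
\<close>

lemma div_mean_le_sampling:
  assumes \<theta>: "\<theta> \<in> interior \<Theta>" and t: "0 < t"
  shows "div_mean \<theta> \<le> (t * spread \<theta> (mean \<theta>) + real n * trace (fisher_info (P \<theta>) (s \<theta>)) / t) / 2"
proof -
  have \<theta>': "\<theta> \<in> \<Theta>" using \<theta> interior_subset by auto
  note D = regular_model_density[OF model \<theta>']
  have sm [measurable]: "s \<theta> \<in> borel_measurable (P \<theta>)" using D(5,7) by (simp cong: measurable_cong_sets)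
  have s2: "integrable (P \<theta>) (\<lambda>x. (norm (s \<theta> x))\<^sup>2)" by (rule regular_model_score_square_integrable[OF model \<theta>])
  have si: "integrable (P \<theta>) (s \<theta>)" by (rule regular_model_integrable_score(1)[OF model \<theta>'])
  have k1: "integrable (P \<theta>) (\<lambda>x. s \<theta> x $ k)" for k
    using si integrable_inner_left[of "axis k 1" "P \<theta>" "s \<theta>"] by (simp add: inner_axis)
  have k0: "(\<integral>x. s \<theta> x $ k \<partial>P \<theta>) = 0" for k
    using si integral_inner_left[of "axis k 1" "P \<theta>" "s \<theta>"] score_mean_zero[OF \<theta>] by (simp add: inner_axis)
  have k2: "integrable (P \<theta>) (\<lambda>x. (s \<theta> x $ k)\<^sup>2)" for k
    using power_mono[OF component_le_norm_cart abs_ge_zero, of "s \<theta> _" k 2]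
    by (intro integrable_dominated[OF s2]) simp_all
  have sq: "(norm (score \<theta> S))\<^sup>2 = (\<Sum>k\<in>UNIV. (\<Sum>i<n. s \<theta> (S i) $ k)\<^sup>2)" for S
    unfolding power2_norm_eq_inner score_def inner_vec_def by (simp add: power2_eq_square)
  have iid: "integrable (sample \<theta>) (\<lambda>S. (\<Sum>i<n. s \<theta> (S i) $ k)\<^sup>2)"
    "(\<integral>S. (\<Sum>i<n. s \<theta> (S i) $ k)\<^sup>2 \<partial>sample \<theta>) = real n * (\<integral>x. (s \<theta> x $ k)\<^sup>2 \<partial>P \<theta>)" for k
    using integrable_iid_sum_sq[OF D(1) finite_lessThan[of n] k1 k2 k0, of k]
      integral_iid_sum_sq[OF D(1) finite_lessThan[of n] k1 k2 k0, of k] by simp_all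
  have isq: "integrable (sample \<theta>) (\<lambda>S. (norm (score \<theta> S))\<^sup>2)"
    unfolding sq using iid(1) by (intro Bochner_Integration.integrable_sum)
  have "(\<integral>S. (norm (score \<theta> S))\<^sup>2 \<partial>sample \<theta>) = (\<Sum>k\<in>UNIV. real n * (\<integral>x. (s \<theta> x $ k)\<^sup>2 \<partial>P \<theta>))"
    unfolding sq using iid by (subst Bochner_Integration.integral_sum) auto
  also have "\<dots> = real n * trace (fisher_info (P \<theta>) (s \<theta>))"
    by (simp add: trace_def fisher_info_def sum_distrib_left power2_eq_square)
  finally have Esq: "(\<integral>S. (norm (score \<theta> S))\<^sup>2 \<partial>sample \<theta>) = real n * trace (fisher_info (P \<theta>) (s \<theta>))" .
  let ?V = "\<lambda>S. \<integral>t. (norm (\<tau> t - mean \<theta>))\<^sup>2 \<partial>A S"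
  have "div_mean \<theta> = (\<integral>S. (\<Sum>i<n. deviation \<theta> S \<bullet> s \<theta> (S i)) \<partial>sample \<theta>)"
    unfolding div_mean_centered(2)[OF \<theta>] using div_mean_centered(1)[OF \<theta>]
    by (intro Bochner_Integration.integral_sum[symmetric]) auto
  also have "\<dots> \<le> (\<integral>S. (t * ?V S + (norm (score \<theta> S))\<^sup>2 / t) / 2 \<partial>sample \<theta>)"
  proof (rule integral_mono)
    show "integrable (sample \<theta>) (\<lambda>S. \<Sum>i<n. deviation \<theta> S \<bullet> s \<theta> (S i))"
      using div_mean_centered(1)[OF \<theta>] by (intro Bochner_Integration.integrable_sum) auto
    show "integrable (sample \<theta>) (\<lambda>S. (t * ?V S + (norm (score \<theta> S))\<^sup>2 / t) / 2)"
      using isq integrable_spread(1)[OF \<theta>'] by auto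
    fix S assume "S \<in> space (sample \<theta>)"
    then have S: "S \<in> space data" using sample_prob(3)[OF \<theta>'] by simp
    interpret A: prob_space "A S" by (rule A_prob[OF S])
    have i: "integrable (A S) (\<lambda>t. \<tau> t - mean \<theta>)"
      by (rule A_integral_bounded(1)[OF S _ norm_centered_le]) measurable
    have "(\<Sum>i<n. deviation \<theta> S \<bullet> s \<theta> (S i)) = (\<integral>t. (\<tau> t - mean \<theta>) \<bullet> score \<theta> S \<partial>A S)"
      using i by (simp add: score_def inner_sum_right)
    also have "\<dots> \<le> (\<integral>r. (t * (norm (\<tau> r - mean \<theta>))\<^sup>2 + (norm (score \<theta> S))\<^sup>2 / t) / 2 \<partial>A S)"
    proof (rule integral_mono)
      show "integrable (A S) (\<lambda>t. (\<tau> t - mean \<theta>) \<bullet> score \<theta> S)" using i by simp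
      show "integrable (A S) (\<lambda>r. (t * (norm (\<tau> r - mean \<theta>))\<^sup>2 + (norm (score \<theta> S))\<^sup>2 / t) / 2)"
        using inner_spread(1)[OF S] by simp
      fix r
      show "(\<tau> r - mean \<theta>) \<bullet> score \<theta> S \<le> (t * (norm (\<tau> r - mean \<theta>))\<^sup>2 + (norm (score \<theta> S))\<^sup>2 / t) / 2"
        by (rule inner_le_weighted_squares[OF t])
    qed
    also have "\<dots> = (t * ?V S + (norm (score \<theta> S))\<^sup>2 / t) / 2"
      using inner_spread(1)[OF S] by (simp add: A.prob_space)
    finally show "(\<Sum>i<n. deviation \<theta> S \<bullet> s \<theta> (S i)) \<le> (t * ?V S + (norm (score \<theta> S))\<^sup>2 / t) / 2" .
  qed
  also have "\<dots> = (t * (\<integral>S. ?V S \<partial>sample \<theta>) + (\<integral>S. (norm (score \<theta> S))\<^sup>2 \<partial>sample \<theta>) / t) / 2"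
    using isq integrable_spread(1)[OF \<theta>', of "mean \<theta>"] by simp
  also have "\<dots> = (t * spread \<theta> (mean \<theta>) + real n * trace (fisher_info (P \<theta>) (s \<theta>)) / t) / 2"
    unfolding Esq spread_def ..
  finally show ?thesis .
qed

end

section \<open>The van Trees inequality\<close>

context clipped_private_estimator
begin

lemma continuous_sample_integral:
  fixes f :: "_ \<Rightarrow> real"
  assumes f: "f \<in> borel_measurable data" and b: "\<And>S. S \<in> space data \<Longrightarrow> \<bar>f S\<bar> \<le> B"
  shows "continuous_on (interior \<Theta>) (\<lambda>\<theta>. \<integral>S. f S \<partial>sample \<theta>)"
proof (rule continuous_at_imp_continuous_on, rule ballI)
  fix \<theta> assume "\<theta> \<in> interior \<Theta>"
  from tv_differentiable_has_derivative[OF score_tv_differentiable[OF this] f b]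
  show "isCont (\<lambda>\<theta>. \<integral>S. f S \<partial>sample \<theta>) \<theta>" by (rule has_derivative_continuous)
qed

lemma continuous_mean_component: "continuous_on (interior \<Theta>) (\<lambda>\<theta>. mean \<theta> $ k)"
proof -
  have "continuous_on (interior \<Theta>) (\<lambda>\<theta>. \<integral>S. cond_mean S $ k \<partial>sample \<theta>)"
    using order_trans[OF component_le_norm_cart cond_mean_le] by (intro continuous_sample_integral) auto
  then show ?thesis
    by (rule continuous_on_eq) (simp add: mean_component[OF subsetD[OF interior_subset]])
qed

lemma continuous_spread: "continuous_on (interior \<Theta>) (\<lambda>\<theta>. spread \<theta> 0)"
  unfolding spread_def using inner_spread(2)[of _ 0]
  by (intro continuous_sample_integral[OF inner_spread_measurable]) simp

lemma mean_component_line_derivative: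
  assumes \<theta>: "\<theta> \<in> interior \<Theta>"
  shows "((\<lambda>t. mean (\<theta> + t *\<^sub>R axis k 1) $ k) has_real_derivative
    (\<integral>S. cond_mean S $ k * (axis k 1 \<bullet> score \<theta> S) \<partial>sample \<theta>)) (at 0)"
  by (rule DERIV_along_line[OF mean_has_derivative[OF \<theta>] open_interior \<theta>])
     (simp add: mean_component[OF subsetD[OF interior_subset]])

text \<open>
  Integration by parts in the \<open>k\<close>-th coordinate direction with weight \<open>\<pi>\<close> and function
  \<open>m\<^sub>k(\<theta>) - \<theta>\<^sub>k\<close>, summed over \<open>k\<close>. Each coordinate contributes one from the derivative of
  \<open>\<theta>\<^sub>k\<close>, hence the dimension on the right.
\<close>

lemma van_trees_identity:
  assumes prior: "regular_prior \<Theta> \<nu> \<pi>" and R: "\<Theta> \<subseteq> cball 0 R"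
  defines "W \<equiv> prior_weight \<Theta> \<pi>"
  shows "integrable lborel (\<lambda>\<theta>. W \<theta> * ((mean \<theta> - \<theta>) \<bullet> prior_score \<pi> \<theta> + div_mean \<theta>))"
    and "(\<integral>\<theta>. W \<theta> * ((mean \<theta> - \<theta>) \<bullet> prior_score \<pi> \<theta> + div_mean \<theta>) \<partial>lborel) = real CARD('p)"
proof -
  have W0: "0 \<le> W \<theta>" for \<theta> unfolding W_def by (rule prior_weight_nonneg[OF prior])
  have Wint: "W \<theta> > 0 \<Longrightarrow> \<theta> \<in> interior \<Theta>" "W \<theta> > 0 \<Longrightarrow> \<theta> \<in> \<Theta>" for \<theta>
    using prior_weight_pos(1)[OF prior compact] interior_subset unfolding W_def by blast+
  have Wc: "continuous_on UNIV W" unfolding W_def by (rule continuous_prior_weight[OF prior compact])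
  have supp: "W x = 0" if "R < norm x" for x
    using Wint(2)[of x] W0[of x] R that by (cases "W x = 0") auto
  define D where "D = {\<theta>. 0 < W \<theta>}"
  have oD: "open D" unfolding D_def by (intro open_Collect_less continuous_intros Wc)
  have indW: "indicator D \<theta> * (W \<theta> * c) = W \<theta> * c" for \<theta> and c :: real
    using W0[of \<theta>] by (auto simp: D_def indicator_def)
  obtain B where B: "0 \<le> B" "\<And>\<theta>. \<theta> \<in> \<Theta> \<Longrightarrow> (\<integral>x. norm (s \<theta> x) \<partial>P \<theta>) \<le> B"
    by (rule regular_model_score_bounded[OF model compact], rule that)
  define dm where "dm k \<theta> = (\<integral>S. cond_mean S $ k * (axis k 1 \<bullet> score \<theta> S) \<partial>sample \<theta>)" for k \<theta>
  define C where "C = max (2 * R) (R * (real n * B) + 1)"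
  have parts: "integrable lborel (\<lambda>\<theta>. W \<theta> * prior_score \<pi> \<theta> $ k * (mean \<theta> $ k - \<theta> $ k))"
    "integrable lborel (\<lambda>\<theta>. W \<theta> * (dm k \<theta> - 1))"
    "(\<integral>\<theta>. W \<theta> * prior_score \<pi> \<theta> $ k * (mean \<theta> $ k - \<theta> $ k) \<partial>lborel) + (\<integral>\<theta>. W \<theta> * (dm k \<theta> - 1) \<partial>lborel) = 0" for k
  proof -
    let ?w = "\<lambda>\<theta>. W \<theta> * prior_score \<pi> \<theta> $ k"
    let ?g = "\<lambda>\<theta>. mean \<theta> $ k - \<theta> $ k"
    let ?g' = "\<lambda>\<theta>. dm k \<theta> - 1"
    have 1: "((\<lambda>t. W (x + t *\<^sub>R axis k 1)) has_real_derivative ?w x) (at 0)" if "x \<in> {x. 0 < W x}" for x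
      using that prior_weight_derivative(1)[OF prior compact] unfolding W_def by simp
    have 2: "continuous_on {x. 0 < W x} ?w"
      unfolding W_def by (rule prior_weight_derivative(2)[OF prior compact])
    have 3: "integrable lborel (\<lambda>x. indicator {x. 0 < W x} x * ?w x)"
      unfolding D_def[symmetric] indW unfolding W_def by (rule prior_score_integrable(3)[OF prior compact])
    have 4: "(\<lambda>x. indicator {x. 0 < W x} x * ?g x) \<in> borel_measurable borel"
    proof -
      have "continuous_on D ?g"
        using Wint(1) by (intro continuous_intros continuous_on_subset[OF continuous_mean_component]) (auto simp: D_def)
      then have "(\<lambda>x. indicator D x *\<^sub>R ?g x) \<in> borel_measurable borel"
        using oD by (intro borel_measurable_continuous_on_indicator) auto
      then show ?thesis by (simp add: D_def)
    qed
    have 5: "((\<lambda>t. ?g (x + t *\<^sub>R axis k 1)) has_real_derivative ?g' x) (at 0)" if "x \<in> {x. 0 < W x}" for x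
    proof -
      have "((\<lambda>t. (x + t *\<^sub>R axis k 1) $ k) has_real_derivative 1) (at 0)"
        by (auto intro!: derivative_eq_intros simp: axis_def)
      then show ?thesis
        unfolding dm_def using that by (intro DERIV_diff mean_component_line_derivative Wint(1)) simp_all
    qed
    have 6: "\<bar>?g x\<bar> \<le> C" if "x \<in> {x. 0 < W x}" for x
    proof -
      have x: "x \<in> \<Theta>" using Wint(2) that by simp
      have "\<bar>mean x $ k\<bar> \<le> R" "\<bar>x $ k\<bar> \<le> R"
        using order_trans[OF component_le_norm_cart mean_le[OF x]] order_trans[OF component_le_norm_cart, of x R k] x R by auto
      then show ?thesis unfolding C_def by linarith
    qed
    have 7: "\<bar>?g' x\<bar> \<le> C" if "x \<in> {x. 0 < W x}" for x
    proof -
      have x: "x \<in> \<Theta>" using Wint(2) that by simp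
      have "\<bar>dm k x\<bar> \<le> R * norm (axis k 1 :: real^'p) * (\<integral>S. norm (score x S) \<partial>sample x)"
        unfolding dm_def
      proof (rule abs_integral_mult_score_le(2)[OF integrable_score[OF x]])
        show "(\<lambda>S. cond_mean S $ k) \<in> borel_measurable (sample x)"
          using integrable_cond_mean[OF x] by (intro borel_measurable_vec_nth) auto
        show "\<bar>cond_mean S $ k\<bar> \<le> R" if "S \<in> space (sample x)" for S
          using that order_trans[OF component_le_norm_cart cond_mean_le] sample_prob(3)[OF x] by simp
      qed
      also have "\<dots> \<le> R * (real n * B)"
        using integral_score_norm_le[OF x B(2)[OF x]] R_nonneg by (simp add: mult_left_mono)
      finally show ?thesis unfolding C_def by linarith
    qed
    note ibp = integrable_weight_derivative[OF Wc W0 supp 1 2 3 4 5 6 7]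
      integrable_weight_mult[OF Wc W0 supp 1 2 3 4 5 6 7]
      integration_by_parts_weight[OF Wc W0 supp 1 2 3 4 5 6 7]
    show "integrable lborel (\<lambda>\<theta>. W \<theta> * prior_score \<pi> \<theta> $ k * (mean \<theta> $ k - \<theta> $ k))"
      "integrable lborel (\<lambda>\<theta>. W \<theta> * (dm k \<theta> - 1))"
      "(\<integral>\<theta>. W \<theta> * prior_score \<pi> \<theta> $ k * (mean \<theta> $ k - \<theta> $ k) \<partial>lborel) + (\<integral>\<theta>. W \<theta> * (dm k \<theta> - 1) \<partial>lborel) = 0"
      using ibp unfolding D_def[symmetric] mult.assoc indW by blast+
  qed
  have iW: "integrable lborel W" "(\<integral>\<theta>. W \<theta> \<partial>lborel) = 1"
    unfolding W_def by (rule prior_weight_integral[OF prior compact])+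
  have eq: "W \<theta> * ((mean \<theta> - \<theta>) \<bullet> prior_score \<pi> \<theta> + div_mean \<theta>)
      = (\<Sum>k\<in>UNIV. W \<theta> * prior_score \<pi> \<theta> $ k * (mean \<theta> $ k - \<theta> $ k) + W \<theta> * (dm k \<theta> - 1) + W \<theta>)" for \<theta>
  proof (cases "0 < W \<theta>")
    case True
    then have "div_mean \<theta> = (\<Sum>k\<in>UNIV. dm k \<theta>)" unfolding dm_def by (intro inner_score_eq Wint)
    then have "W \<theta> * ((mean \<theta> - \<theta>) \<bullet> prior_score \<pi> \<theta> + div_mean \<theta>)
      = (\<Sum>k\<in>UNIV. W \<theta> * ((mean \<theta> $ k - \<theta> $ k) * prior_score \<pi> \<theta> $ k + dm k \<theta>))"
      by (simp add: inner_vec_def sum.distrib sum_distrib_left distrib_left)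
    also have "\<dots> = (\<Sum>k\<in>UNIV. W \<theta> * prior_score \<pi> \<theta> $ k * (mean \<theta> $ k - \<theta> $ k) + W \<theta> * (dm k \<theta> - 1) + W \<theta>)"
      by (intro sum.cong refl) (simp add: algebra_simps)
    finally show ?thesis .
  next
    case False
    then have "W \<theta> = 0" using W0[of \<theta>] by simp
    then show ?thesis by simp
  qed
  show "integrable lborel (\<lambda>\<theta>. W \<theta> * ((mean \<theta> - \<theta>) \<bullet> prior_score \<pi> \<theta> + div_mean \<theta>))"
    unfolding eq using parts iW by (intro Bochner_Integration.integrable_sum Bochner_Integration.integrable_add)
  have "(\<integral>\<theta>. W \<theta> * prior_score \<pi> \<theta> $ k * (mean \<theta> $ k - \<theta> $ k) + W \<theta> * (dm k \<theta> - 1) + W \<theta> \<partial>lborel) = 1" for k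
    using parts[of k] iW by simp
  then show "(\<integral>\<theta>. W \<theta> * ((mean \<theta> - \<theta>) \<bullet> prior_score \<pi> \<theta> + div_mean \<theta>) \<partial>lborel) = real CARD('p)"
    unfolding eq using parts iW
    by (subst Bochner_Integration.integral_sum) (auto intro!: Bochner_Integration.integrable_add)
qed

lemma integrable_bayes_risk:
  assumes prior: "regular_prior \<Theta> \<nu> \<pi>" and R: "\<Theta> \<subseteq> cball 0 R"
  shows "integrable lborel (\<lambda>\<theta>. prior_weight \<Theta> \<pi> \<theta> * spread \<theta> \<theta>)"
proof -
  let ?W = "prior_weight \<Theta> \<pi>"
  define D where "D = {\<theta>. 0 < ?W \<theta>}"
  have W0: "0 \<le> ?W \<theta>" for \<theta> by (rule prior_weight_nonneg[OF prior])
  have Wint: "\<theta> \<in> D \<Longrightarrow> \<theta> \<in> interior \<Theta>" "\<theta> \<in> D \<Longrightarrow> \<theta> \<in> \<Theta>" for \<theta>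
    using prior_weight_pos(1)[OF prior compact] interior_subset unfolding D_def by blast+
  have Wc: "continuous_on UNIV ?W" by (rule continuous_prior_weight[OF prior compact])
  have c: "continuous_on D (\<lambda>\<theta>. ?W \<theta> * (spread \<theta> 0 - 2 * (\<Sum>k\<in>UNIV. mean \<theta> $ k * \<theta> $ k) + (norm \<theta>)\<^sup>2))"
    using Wint(1) by (intro continuous_intros continuous_on_subset[OF continuous_spread] continuous_on_subset[OF Wc]
      continuous_on_subset[OF continuous_mean_component]) auto
  have "continuous_on D (\<lambda>\<theta>. ?W \<theta> * spread \<theta> \<theta>)"
  proof (rule continuous_on_eq[OF c])
    fix \<theta> assume "\<theta> \<in> D"
    show "?W \<theta> * (spread \<theta> 0 - 2 * (\<Sum>k\<in>UNIV. mean \<theta> $ k * \<theta> $ k) + (norm \<theta>)\<^sup>2) = ?W \<theta> * spread \<theta> \<theta>"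
      unfolding spread_expand[OF Wint(2)[OF \<open>\<theta> \<in> D\<close>], of \<theta>] by (simp add: inner_vec_def)
  qed
  then have m: "(\<lambda>\<theta>. ?W \<theta> * spread \<theta> \<theta>) \<in> borel_measurable lborel"
    using borel_measurable_weight_mult[OF Wc W0] by (simp add: D_def)
  show ?thesis
  proof (rule integrable_dominated[OF _ m])
    show "integrable lborel (\<lambda>\<theta>. ?W \<theta> * (R + R)\<^sup>2)" using prior_weight_integral(1)[OF prior compact] by simp
    show "norm (?W \<theta> * spread \<theta> \<theta>) \<le> norm (?W \<theta> * (R + R)\<^sup>2)" for \<theta>
    proof (cases "\<theta> \<in> D")
      case True
      then have \<theta>: "\<theta> \<in> \<Theta>" by (rule Wint)
      have "\<bar>spread \<theta> \<theta>\<bar> \<le> (R + norm \<theta>)\<^sup>2" by (rule integrable_spread(2)[OF \<theta>])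
      also have "\<dots> \<le> (R + R)\<^sup>2" using \<theta> R R_nonneg by (intro power_mono) auto
      finally show ?thesis using W0[of \<theta>] by (simp add: abs_mult mult_left_mono)
    next
      case False
      then have "?W \<theta> = 0" using W0[of \<theta>] by (simp add: D_def)
      then show ?thesis by simp
    qed
  qed
qed

text \<open>
  The bias term is paired with the score of the prior and the divergence term with the spread. Bias and
  spread add up to the risk, so the two informations add up as well.
\<close>

lemma van_trees_inequality:
  assumes prior: "regular_prior \<Theta> \<nu> \<pi>" and R: "\<Theta> \<subseteq> cball 0 R" and t: "0 < t"
    and B: "\<And>\<theta>. \<theta> \<in> interior \<Theta> \<Longrightarrow> div_mean \<theta> \<le> (t * spread \<theta> (mean \<theta>) + b \<theta> / t) / 2"
    and ib: "integrable lborel (\<lambda>\<theta>. prior_weight \<Theta> \<pi> \<theta> * b \<theta>)"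
  shows "real CARD('p) \<le> (t * (\<integral>\<theta>. prior_weight \<Theta> \<pi> \<theta> * spread \<theta> \<theta> \<partial>lborel)
    + ((\<integral>\<theta>. prior_weight \<Theta> \<pi> \<theta> * b \<theta> \<partial>lborel) + trace (prior_fisher_info \<Theta> \<nu> \<pi>)) / t) / 2"
proof -
  let ?W = "prior_weight \<Theta> \<pi>"
  note ir = integrable_bayes_risk[OF prior R] and ps = prior_score_integrable(1,2)[OF prior compact]
  have "real CARD('p) = (\<integral>\<theta>. ?W \<theta> * ((mean \<theta> - \<theta>) \<bullet> prior_score \<pi> \<theta> + div_mean \<theta>) \<partial>lborel)"
    by (rule van_trees_identity(2)[OF prior R, symmetric])
  also have "\<dots> \<le> (\<integral>\<theta>. (t * (?W \<theta> * spread \<theta> \<theta>) + (?W \<theta> * b \<theta> + ?W \<theta> * (norm (prior_score \<pi> \<theta>))\<^sup>2) / t) / 2 \<partial>lborel)"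
  proof (rule integral_mono[OF van_trees_identity(1)[OF prior R]])
    show "integrable lborel (\<lambda>\<theta>. (t * (?W \<theta> * spread \<theta> \<theta>) + (?W \<theta> * b \<theta> + ?W \<theta> * (norm (prior_score \<pi> \<theta>))\<^sup>2) / t) / 2)"
      using ir ps(1) ib by simp
    fix \<theta>
    show "?W \<theta> * ((mean \<theta> - \<theta>) \<bullet> prior_score \<pi> \<theta> + div_mean \<theta>)
      \<le> (t * (?W \<theta> * spread \<theta> \<theta>) + (?W \<theta> * b \<theta> + ?W \<theta> * (norm (prior_score \<pi> \<theta>))\<^sup>2) / t) / 2"
    proof (cases "0 < ?W \<theta>")
      case True
      have i: "\<theta> \<in> interior \<Theta>" by (rule prior_weight_pos(1)[OF prior compact True])
      then have \<theta>: "\<theta> \<in> \<Theta>" using interior_subset by blast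
      have "(mean \<theta> - \<theta>) \<bullet> prior_score \<pi> \<theta> + div_mean \<theta>
        \<le> (t * (norm (mean \<theta> - \<theta>))\<^sup>2 + (norm (prior_score \<pi> \<theta>))\<^sup>2 / t) / 2 + (t * spread \<theta> (mean \<theta>) + b \<theta> / t) / 2"
        by (intro add_mono inner_le_weighted_squares[OF t] B[OF i])
      also have "\<dots> = (t * spread \<theta> \<theta> + (b \<theta> + (norm (prior_score \<pi> \<theta>))\<^sup>2) / t) / 2"
        unfolding spread_bias_variance[OF \<theta>, of \<theta>] by (simp add: distrib_left add_divide_distrib)
      finally have "?W \<theta> * ((mean \<theta> - \<theta>) \<bullet> prior_score \<pi> \<theta> + div_mean \<theta>)
        \<le> ?W \<theta> * ((t * spread \<theta> \<theta> + (b \<theta> + (norm (prior_score \<pi> \<theta>))\<^sup>2) / t) / 2)"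
        using True by (intro mult_left_mono) auto
      also have "\<dots> = (t * (?W \<theta> * spread \<theta> \<theta>) + (?W \<theta> * b \<theta> + ?W \<theta> * (norm (prior_score \<pi> \<theta>))\<^sup>2) / t) / 2"
        by (simp add: distrib_left add_divide_distrib mult.left_commute)
      finally show ?thesis .
    next
      case False
      then have "?W \<theta> = 0" using prior_weight_nonneg[OF prior, of \<theta>] by simp
      then show ?thesis by simp
    qed
  qed
  also have "\<dots> = (t * (\<integral>\<theta>. ?W \<theta> * spread \<theta> \<theta> \<partial>lborel)
    + ((\<integral>\<theta>. ?W \<theta> * b \<theta> \<partial>lborel) + trace (prior_fisher_info \<Theta> \<nu> \<pi>)) / t) / 2"
    unfolding ps(2) using ir ps(1) ib by simp
  finally show ?thesis .
qed

lemma ennreal_spread: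
  assumes \<theta>: "\<theta> \<in> \<Theta>"
  shows "(\<integral>\<^sup>+S. (\<integral>\<^sup>+t. ennreal ((norm (\<tau> t - c))\<^sup>2) \<partial>A S) \<partial>sample \<theta>) = ennreal (spread \<theta> c)"
proof -
  have "(\<integral>\<^sup>+S. (\<integral>\<^sup>+t. ennreal ((norm (\<tau> t - c))\<^sup>2) \<partial>A S) \<partial>sample \<theta>)
    = (\<integral>\<^sup>+S. ennreal (\<integral>t. (norm (\<tau> t - c))\<^sup>2 \<partial>A S) \<partial>sample \<theta>)"
  proof (rule nn_integral_cong)
    fix S assume "S \<in> space (sample \<theta>)"
    then have "S \<in> space data" using sample_prob(3)[OF \<theta>] by simp
    then show "(\<integral>\<^sup>+t. ennreal ((norm (\<tau> t - c))\<^sup>2) \<partial>A S) = ennreal (\<integral>t. (norm (\<tau> t - c))\<^sup>2 \<partial>A S)"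
      by (intro nn_integral_eq_integral inner_spread) auto
  qed
  also have "\<dots> = ennreal (spread \<theta> c)"
    unfolding spread_def by (intro nn_integral_eq_integral integrable_spread(1)[OF \<theta>]) auto
  finally show ?thesis .
qed

end

section \<open>The lower bound\<close>

theorem theorem4p1:
  fixes \<Theta> :: "(real^'p) set"
    and \<mu> :: "'x measure"
    and P :: "real^'p \<Rightarrow> 'x measure"
    and p :: "real^'p \<Rightarrow> 'x \<Rightarrow> real"
    and s :: "real^'p \<Rightarrow> 'x \<Rightarrow> real^'p"
    and \<nu> :: "(real^'p) measure"
    and \<pi> :: "real^'p \<Rightarrow> real"
    and \<rho> :: real
    and n :: nat
    and A :: "(nat \<Rightarrow> 'x) \<Rightarrow> (real^'p) measure"
  assumes "compact \<Theta>" and "piecewise_smooth_boundary \<Theta>"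
    and "regular_model \<Theta> \<mu> P p s"
    and "regular_prior \<Theta> \<nu> \<pi>"
    and "set_integrable \<nu> \<Theta> (\<lambda>\<theta>. spectral_norm (fisher_info (P \<theta>) (s \<theta>)))"
    and "\<rho> > 0"
    and "zCDP \<rho> n \<mu> borel A"
  defines "C\<^sub>\<rho> \<equiv> (exp (2 * \<rho>) - 1) / \<rho>"
  defines "I \<equiv> min
      (C\<^sub>\<rho> * \<rho> * (real n)\<^sup>2 * (LINT \<theta>:\<Theta>|\<nu>. spectral_norm (fisher_info (P \<theta>) (s \<theta>))))
      (real n * (LINT \<theta>:\<Theta>|\<nu>. trace (fisher_info (P \<theta>) (s \<theta>))))"
  shows "(\<integral>\<^sup>+\<theta>\<in>\<Theta>. (\<integral>\<^sup>+S. (\<integral>\<^sup>+t. ennreal ((norm (t - \<theta>))\<^sup>2) \<partial>A S)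
             \<partial>PiM {..<n} (\<lambda>_. P \<theta>)) \<partial>\<nu>)
         \<ge> ennreal ((real CARD('p))\<^sup>2 / (I + trace (prior_fisher_info \<Theta> \<nu> \<pi>)))"
proof -
  obtain R where R0: "0 < R" and "\<forall>\<theta>\<in>\<Theta>. norm \<theta> \<le> R"
    using compact_imp_bounded[OF assms(1)] unfolding bounded_pos by blast
  then have R: "\<Theta> \<subseteq> cball 0 R" by auto
  define \<tau> :: "real^'p \<Rightarrow> real^'p" where "\<tau> = closest_point (cball 0 R)"
  have ne: "cball (0 :: real^'p) R \<noteq> {}" using R0 by simp
  have \<tau>m: "\<tau> \<in> borel_measurable borel"
    unfolding \<tau>_def by (intro borel_measurable_continuous_onI continuous_on_closest_point) (use ne in auto)
  have \<tau>_le: "norm (\<tau> t) \<le> R" for t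
    using closest_point_in_set[OF closed_cball ne, of t] by (simp add: \<tau>_def)
  have contract: "norm (\<tau> t - \<theta>) \<le> norm (t - \<theta>)" if "\<theta> \<in> \<Theta>" for t \<theta>
  proof -
    have "\<tau> \<theta> = \<theta>" unfolding \<tau>_def using R that by (intro closest_point_self) auto
    then show ?thesis
      using closest_point_lipschitz[OF convex_cball closed_cball ne, of t \<theta>] by (simp add: \<tau>_def dist_norm)
  qed
  interpret clipped_private_estimator \<Theta> \<mu> P p s \<rho> n A \<tau> R
    by unfold_locales (use assms \<tau>m \<tau>_le in auto)
  let ?W = "prior_weight \<Theta> \<pi>"
  let ?L = "\<lambda>\<theta>. spectral_norm (fisher_info (P \<theta>) (s \<theta>))"
  let ?T = "\<lambda>\<theta>. trace (fisher_info (P \<theta>) (s \<theta>))"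
  note prior = assms(4)
  note \<nu> = regular_priorD(2)[OF prior]
  have \<Theta>s: "\<Theta> \<in> sets borel" using assms(1) by (simp add: borel_compact)
  \<comment> \<open>needed so that the integral of the trace is not zero by convention\<close>
  have iT: "set_integrable \<nu> \<Theta> ?T"
    unfolding set_integrable_def
  proof (rule integrable_dominated)
    show "integrable \<nu> (\<lambda>\<theta>. real CARD('p) * (indicator \<Theta> \<theta> *\<^sub>R ?L \<theta>))"
      using assms(5) unfolding set_integrable_def by (rule integrable_mult_right)
    have "(\<lambda>\<theta>. indicator \<Theta> \<theta> *\<^sub>R ?T \<theta>) \<in> borel_measurable borel"
      using regular_model_trace_measurable[OF assms(3)] \<Theta>s by (subst (asm) borel_measurable_restrict_space_iff) auto
    then show "(\<lambda>\<theta>. indicator \<Theta> \<theta> *\<^sub>R ?T \<theta>) \<in> borel_measurable \<nu>" unfolding \<nu> by simp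
    show "norm (indicator \<Theta> \<theta> *\<^sub>R ?T \<theta>) \<le> norm (real CARD('p) * (indicator \<Theta> \<theta> *\<^sub>R ?L \<theta>))" for \<theta>
      using abs_trace_le_spectral_norm[of "fisher_info (P \<theta>) (s \<theta>)"]
        spectral_norm_nonneg[of "fisher_info (P \<theta>) (s \<theta>)"] by (simp add: indicator_def abs_mult)
  qed
  define K1 where "K1 = (exp (2 * \<rho>) - 1) * (real n)\<^sup>2 * (\<integral>\<theta>. ?W \<theta> * ?L \<theta> \<partial>lborel)"
  define K2 where "K2 = real n * (\<integral>\<theta>. ?W \<theta> * ?T \<theta> \<partial>lborel)"
  note sL = set_integral_prior[OF prior assms(1,5)] and sT = set_integral_prior[OF prior assms(1) iT]
  have I: "I = min K1 K2"
    unfolding I_def C\<^sub>\<rho>_def K1_def K2_def sL(2) sT(2) using assms(6) by simp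
  define risk where "risk = (\<integral>\<theta>. ?W \<theta> * spread \<theta> \<theta> \<partial>lborel)"
  define J where "J = trace (prior_fisher_info \<Theta> \<nu> \<pi>)"
  have v1: "real CARD('p) \<le> (t * risk + (K1 + J) / t) / 2" if t: "0 < t" for t
  proof -
    have e: "?W \<theta> * ((exp (2 * \<rho>) - 1) * (real n)\<^sup>2 * ?L \<theta>) = (exp (2 * \<rho>) - 1) * (real n)\<^sup>2 * (?W \<theta> * ?L \<theta>)" for \<theta>
      by simp
    show ?thesis
      using van_trees_inequality[OF prior R t div_mean_le_private[OF _ t], unfolded e] sL(1)
      by (simp add: risk_def J_def K1_def)
  qed
  have v2: "real CARD('p) \<le> (t * risk + (K2 + J) / t) / 2" if t: "0 < t" for t
  proof -
    have e: "?W \<theta> * (real n * ?T \<theta>) = real n * (?W \<theta> * ?T \<theta>)" for \<theta> by simp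
    show ?thesis
      using van_trees_inequality[OF prior R t div_mean_le_sampling[OF _ t], unfolded e] sT(1)
      by (simp add: risk_def J_def K2_def)
  qed
  have v: "real CARD('p) \<le> (t * risk + (I + J) / t) / 2" if "0 < t" for t
    using v1[OF that] v2[OF that] unfolding I by (cases "K1 \<le> K2") (auto simp: min_def)
  have bound: "(real CARD('p))\<^sup>2 / (I + J) \<le> risk"
  proof (cases "0 < I + J")
    case True
    define d where "d = real CARD('p)"
    have d: "0 < d" by (simp add: d_def)
    \<comment> \<open>\<open>t = (I + J) / d\<close> makes the information term equal to \<open>d\<close>\<close>
    have "d \<le> ((I + J) / d * risk + (I + J) / ((I + J) / d)) / 2"
      unfolding d_def by (rule v) (use True d in \<open>simp add: d_def\<close>)
    moreover have "(I + J) / ((I + J) / d) = d" using True by simp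
    ultimately have "d \<le> (I + J) / d * risk" by simp
    then have "d\<^sup>2 \<le> (I + J) * risk" using d by (simp add: pos_le_divide_eq power2_eq_square)
    then show ?thesis using True by (simp add: d_def divide_le_eq mult.commute)
  next
    case False
    have "0 \<le> risk" unfolding risk_def
      using prior_weight_nonneg[OF prior] by (intro Bochner_Integration.integral_nonneg mult_nonneg_nonneg) (auto simp: spread_def)
    moreover have "(real CARD('p))\<^sup>2 / (I + J) \<le> 0" using False by (simp add: divide_nonneg_nonpos)
    ultimately show ?thesis by linarith
  qed
  have Wm: "?W \<in> borel_measurable borel"
    by (rule borel_measurable_continuous_onI[OF continuous_prior_weight[OF prior assms(1)]])
  have sp0: "0 \<le> spread \<theta> c" for \<theta> c by (simp add: spread_def)
  have ri: "integrable lborel (\<lambda>\<theta>. ?W \<theta> * spread \<theta> \<theta>)" by (rule integrable_bayes_risk[OF prior R])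
  define D where "D = {\<theta>. 0 < ?W \<theta>}"
  have D\<Theta>: "\<theta> \<in> \<Theta>" if "\<theta> \<in> D" for \<theta>
    using prior_weight_pos(1)[OF prior assms(1)] interior_subset that unfolding D_def by blast
  \<comment> \<open>a measurable minorant of the risk, equal to it wherever the prior density is positive\<close>
  define f where "f \<theta> = indicator D \<theta> * spread \<theta> \<theta>" for \<theta>
  have fm: "f \<in> borel_measurable borel"
  proof -
    have "(\<lambda>\<theta>. (?W \<theta> * spread \<theta> \<theta>) / ?W \<theta>) \<in> borel_measurable borel"
      by (rule borel_measurable_divide[OF _ Wm]) (use borel_measurable_integrable[OF ri] in simp)
    moreover have "(\<lambda>\<theta>. (?W \<theta> * spread \<theta> \<theta>) / ?W \<theta>) = f"
    proof
      show "(?W \<theta> * spread \<theta> \<theta>) / ?W \<theta> = f \<theta>" for \<theta>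
        using prior_weight_nonneg[OF prior, of \<theta>] by (auto simp: f_def D_def indicator_def)
    qed
    ultimately show ?thesis by (simp only:)
  qed
  have Wf: "?W \<theta> * f \<theta> = ?W \<theta> * spread \<theta> \<theta>" for \<theta>
    using prior_weight_nonneg[OF prior, of \<theta>] by (auto simp: f_def D_def indicator_def)
  have "ennreal ((real CARD('p))\<^sup>2 / (I + J)) \<le> ennreal risk" using bound by (rule ennreal_leI)
  also have "\<dots> = (\<integral>\<^sup>+\<theta>. ennreal (?W \<theta> * f \<theta>) \<partial>lborel)"
    unfolding risk_def Wf using ri prior_weight_nonneg[OF prior] sp0
    by (intro nn_integral_eq_integral[symmetric]) auto
  also have "\<dots> = (\<integral>\<^sup>+\<theta>. ennreal (f \<theta>) \<partial>\<nu>)"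
    unfolding \<nu> using Wm fm prior_weight_nonneg[OF prior] by (simp add: nn_integral_density ennreal_mult')
  also have "\<dots> \<le> (\<integral>\<^sup>+\<theta>\<in>\<Theta>. (\<integral>\<^sup>+S. (\<integral>\<^sup>+t. ennreal ((norm (t - \<theta>))\<^sup>2) \<partial>A S) \<partial>sample \<theta>) \<partial>\<nu>)"
  proof (rule nn_integral_mono)
    fix \<theta>
    show "ennreal (f \<theta>) \<le> (\<integral>\<^sup>+S. (\<integral>\<^sup>+t. ennreal ((norm (t - \<theta>))\<^sup>2) \<partial>A S) \<partial>sample \<theta>) * indicator \<Theta> \<theta>"
    proof (cases "\<theta> \<in> D")
      case True
      have "ennreal (f \<theta>) = (\<integral>\<^sup>+S. (\<integral>\<^sup>+t. ennreal ((norm (\<tau> t - \<theta>))\<^sup>2) \<partial>A S) \<partial>sample \<theta>)"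
        unfolding ennreal_spread[OF D\<Theta>[OF True]] using True by (simp add: f_def)
      also have "\<dots> \<le> (\<integral>\<^sup>+S. (\<integral>\<^sup>+t. ennreal ((norm (t - \<theta>))\<^sup>2) \<partial>A S) \<partial>sample \<theta>)"
        using contract[OF D\<Theta>[OF True]] by (intro nn_integral_mono ennreal_leI power_mono) auto
      finally show ?thesis using D\<Theta>[OF True] by simp
    qed (simp add: f_def)
  qed
  finally show ?thesis unfolding J_def .
qed

end
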